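(* Let $n,p\ge 1$, let $n_1,\dots,n_p$ be positive integers with $n_1+\cdots+n_p=n$, and for each $a=1,\dots,p$ let $N_a\ge 1$ and let $k_{a1}\ge k_{a2}\ge\cdots\ge k_{aN_a}\geq 1$ be integers with $k_{a1}+\cdots+k_{aN_a}=n_a$. Put $k_{aj}=0$ for $j>N_a$, $N^\ast=\max_a N_a$, and $m_j=\sum_{a=1}^p k_{aj}$. Consider the set of all complex $n\times n$ matrices $A$ which have exactly $p$ distinct eigenvalues $\lambda_1,\dots,\lambda_p$ (of arbitrary values) with multiplicities $n_1,\dots,n_p$, such that $\lambda_a$ occurs in exactly $N_a$ blocks of the Jordan canonical form of $A$, these blocks having orders $k_{a1},\dots,k_{aN_a}$, for $a=1,\dots,p$. The complex dimension of this set is $$n^2-\sum_{j=1}^{N^\ast}(2j-1)\sum_{a=1}^p k_{aj}+p\;=\;n^2-\sum_{j=1}^{N^\ast}(2j-1)\,m_j+p .$$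
   Context: Multiplicity of an eigenvalue means algebraic multiplicity. "Complex dimension" of a subset of the space of complex $n\times n$ matrices is the usual dimension over $\mathbb C$ (of a complex manifold, or of a constructible subset of affine space). The number $m_j$ is the degree of the $j$-th invariant polynomial of $A$, where invariant polynomials are ordered with the one of highest degree first. *)

theory Defs
  imports
    "HOL-Analysis.Analysis"
    "HOL-Library.Multiset"
    "Jordan_Normal_Form.Jordan_Normal_Form"
begin

no_notation Matrix.vec_index (infixl "$" 100)
no_notation Matrix.scalar_prod (infix "\<bullet>" 70)

section \<open>Complex dimension of a set of complex matrices\<close>

text \<open>
  Complex multiples of a matrix. The type class scaling \<^term>\<open>(*\<^sub>R)\<close> on
  \<^typ>\<open>complex^'n^'m\<close> only covers real scalars.
\<close>

definition cscale :: "complex \<Rightarrow> complex^'n^'m \<Rightarrow> complex^'n^'m" where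
  "cscale c A = (\<chi> i j. c * A $ i $ j)"

text \<open>
  Holomorphic maps between open sets of matrices: the Frechet derivative exists at every point and
  is complex-linear (it is real-linear by definition).
\<close>

definition mat_holomorphic_on :: "(complex^'n^'m \<Rightarrow> complex^'n^'m) \<Rightarrow> (complex^'n^'m) set \<Rightarrow> bool" where
  "mat_holomorphic_on f U \<longleftrightarrow>
    (\<forall>A\<in>U. \<exists>D. (f has_derivative D) (at A) \<and> (\<forall>c X. D (cscale c X) = cscale c (D X)))"

definition coord_subspace :: "('m \<times> 'n) set \<Rightarrow> (complex^'n^'m) set" where
  "coord_subspace I = {X. \<forall>i j. (i, j) \<notin> I \<longrightarrow> X $ i $ j = 0}"

text \<open>
  \<open>S\<close> is an (embedded) complex submanifold of dimension \<open>d\<close> of the space of matrices: around each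
  of its points a biholomorphic change of coordinates \<open>f\<close>, with inverse \<open>g\<close>, takes \<open>S\<close> to a
  coordinate subspace of complex dimension \<open>d\<close>.
\<close>

definition complex_submanifold :: "nat \<Rightarrow> (complex^'n^'m) set \<Rightarrow> bool" where
  "complex_submanifold d S \<longleftrightarrow>
    (\<forall>A\<in>S. \<exists>U V f g I.
        open U \<and> open V \<and> A \<in> U \<and> homeomorphism U V f g \<and>
        mat_holomorphic_on f U \<and> mat_holomorphic_on g V \<and>
        card I = d \<and> f ` (S \<inter> U) = coord_subspace I \<inter> V)"

text \<open>
  Without the nonemptiness requirement the empty set would have every dimension.
\<close>

definition has_complex_dimension :: "(complex^'n^'m) set \<Rightarrow> nat \<Rightarrow> bool" where
  "has_complex_dimension S d \<longleftrightarrow> S \<noteq> {} \<and> complex_submanifold d S"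

lemma subspace_coord_subspace: "subspace (coord_subspace I)"
  by (auto simp: subspace_def coord_subspace_def)

lemma dim_coord_subspace:
  fixes I :: "('m::finite \<times> 'n::finite) set"
  shows "dim (coord_subspace I :: (complex^'n^'m) set) = 2 * card I"
proof -
  define e where "e = (\<lambda>((i::'m, j::'n), c::complex). axis i (axis j c))"
  define B where "B = e ` (I \<times> {1, \<i>})"
  have inj: "inj_on e (I \<times> {1, \<i>})"
    by (auto simp: inj_on_def e_def axis_eq_axis)
  have basis: "B \<subseteq> Basis"
    by (auto simp: B_def e_def Basis_vec_def Basis_complex_def)
  have card: "card B = 2 * card I"
    unfolding B_def by (simp add: card_image[OF inj] card_cartesian_product)
  have eq: "coord_subspace I = {x :: complex^'n^'m. \<forall>b\<in>Basis. b \<notin> B \<longrightarrow> x \<bullet> b = 0}"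
  proof (intro Set.set_eqI iffI)
    fix x :: "complex^'n^'m"
    assume x: "x \<in> coord_subspace I"
    show "x \<in> {x. \<forall>b\<in>Basis. b \<notin> B \<longrightarrow> x \<bullet> b = 0}"
    proof safe
      fix b :: "complex^'n^'m" assume b: "b \<in> Basis" "b \<notin> B"
      then obtain i j c where bc: "b = axis i (axis j c)" "c \<in> {1, \<i>}"
        by (auto simp: Basis_vec_def Basis_complex_def)
      then have "b = e ((i, j), c)" by (simp add: e_def)
      with b bc have "(i, j) \<notin> I" unfolding B_def by blast
      with x bc show "x \<bullet> b = 0" by (simp add: coord_subspace_def inner_axis)
    qed
  next
    fix x :: "complex^'n^'m"
    assume x: "x \<in> {x. \<forall>b\<in>Basis. b \<notin> B \<longrightarrow> x \<bullet> b = 0}"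
    have "x $ i $ j = 0" if ij: "(i, j) \<notin> I" for i j
    proof -
      have "x $ i $ j \<bullet> c = 0" if c: "c \<in> {1, \<i>}" for c
      proof -
        have "axis i (axis j c) \<notin> B"
          using ij c by (auto simp: B_def e_def axis_eq_axis)
        moreover have "axis i (axis j c) \<in> (Basis :: (complex^'n^'m) set)"
          using c by (auto simp: Basis_vec_def Basis_complex_def)
        ultimately have "x \<bullet> axis i (axis j c) = 0" using x by blast
        then show ?thesis by (simp add: inner_axis)
      qed
      from this[of 1] this[of "\<i>"] show ?thesis by (simp add: complex_eq_iff inner_complex_def)
    qed
    then show "x \<in> coord_subspace I" by (simp add: coord_subspace_def)
  qed
  show ?thesis
    unfolding eq using dim_substandard[OF basis] card by simp
qed

text \<open>The dimension is well defined.\<close>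

lemma has_complex_dimension_le:
  fixes S :: "(complex^'n::finite^'m::finite) set"
  assumes "has_complex_dimension S d" "has_complex_dimension S d'"
  shows "d \<le> d'"
proof -
  obtain A where A: "A \<in> S" using assms unfolding has_complex_dimension_def by blast
  obtain U V f g I where c: "open U" "open V" "A \<in> U" "homeomorphism U V f g"
      "mat_holomorphic_on f U" "mat_holomorphic_on g V" "card I = d"
      "f ` (S \<inter> U) = coord_subspace I \<inter> V"
    using assms(1) A unfolding has_complex_dimension_def complex_submanifold_def by meson
  obtain U' V' f' g' I' where c': "open U'" "open V'" "A \<in> U'" "homeomorphism U' V' f' g'"
      "mat_holomorphic_on f' U'" "mat_holomorphic_on g' V'" "card I' = d'"
      "f' ` (S \<inter> U') = coord_subspace I' \<inter> V'"
    using assms(2) A unfolding has_complex_dimension_def complex_submanifold_def by meson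
  have gf: "g (f x) = x" if "x \<in> U" for x using c(4) that by (auto simp: homeomorphism_def)
  have gf': "g' (f' x) = x" if "x \<in> U'" for x using c'(4) that by (auto simp: homeomorphism_def)
  have fU: "f x \<in> V" if "x \<in> U" for x using c(4) that by (auto simp: homeomorphism_def)
  have fU': "f' x \<in> V'" if "x \<in> U'" for x using c'(4) that by (auto simp: homeomorphism_def)
  have fg: "f (g y) = y" if "y \<in> V" for y using c(4) that by (auto simp: homeomorphism_def)
  obtain Df where Df: "(f has_derivative Df) (at A)"
    using c(3,5) unfolding mat_holomorphic_on_def by blast
  obtain Dg where Dg: "(g has_derivative Dg) (at (f A))"
    using c(6) fU[OF c(3)] unfolding mat_holomorphic_on_def by blast
  obtain Df' where Df': "(f' has_derivative Df') (at A)"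
    using c'(3,5) unfolding mat_holomorphic_on_def by blast
  obtain Dg' where Dg': "(g' has_derivative Dg') (at (f' A))"
    using c'(6) fU'[OF c'(3)] unfolding mat_holomorphic_on_def by blast
  have 1: "((\<lambda>x. f (g x)) has_derivative (\<lambda>x. Df (Dg x))) (at (f A))"
    using has_derivative_compose[OF Dg] Df gf[OF c(3)] by simp
  have "((\<lambda>x. x) has_derivative (\<lambda>x. Df (Dg x))) (at (f A))"
    by (rule has_derivative_transform_within_open[OF 1 c(2) fU[OF c(3)]]) (simp add: fg)
  then have DfDg: "Df (Dg x) = x" for x
    using has_derivative_unique[OF _ has_derivative_ident] by metis
  have 2: "((\<lambda>x. g' (f' x)) has_derivative (\<lambda>x. Dg' (Df' x))) (at A)"
    by (rule has_derivative_compose[OF Df' Dg'])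
  have "((\<lambda>x. x) has_derivative (\<lambda>x. Dg' (Df' x))) (at A)"
    by (rule has_derivative_transform_within_open[OF 2 c'(1) c'(3)]) (simp add: gf')
  then have DgDf': "Dg' (Df' x) = x" for x
    using has_derivative_unique[OF _ has_derivative_ident] by metis
  define T where "T = (\<lambda>x. Df' (Dg x))"
  have T: "((\<lambda>x. f' (g x)) has_derivative T) (at (f A))"
    unfolding T_def using has_derivative_compose[OF Dg] Df' gf[OF c(3)] by simp
  have linT: "linear T" using T has_derivative_linear by blast
  have injT: "inj T"
    by (rule inj_on_inverseI[of _ "\<lambda>x. Df (Dg' x)"]) (simp add: T_def DgDf' DfDg)
  have fA: "f A \<in> coord_subspace I" using c(3,8) A by blast
  have Timg: "T v \<in> coord_subspace I'" if v: "v \<in> coord_subspace I" for v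
  proof -
    have line: "((\<lambda>t::real. f A + t *\<^sub>R v) has_derivative (\<lambda>t. t *\<^sub>R v)) (at 0)"
      by (auto intro!: derivative_eq_intros)
    have tends: "((\<lambda>t::real. f A + t *\<^sub>R v) \<longlongrightarrow> f A) (at 0)"
      by (auto intro!: tendsto_eq_intros)
    have "((\<lambda>x. f' (g x)) has_derivative T) (at (f A + (0::real) *\<^sub>R v))" using T by simp
    from has_derivative_compose[OF line this]
    have comp: "((\<lambda>t::real. f' (g (f A + t *\<^sub>R v))) has_derivative (\<lambda>t. T (t *\<^sub>R v))) (at 0)" .
    have Tscale: "T (t *\<^sub>R v) = t *\<^sub>R T v" for t :: real
      using linear_scale[OF linT] .
    have lim0: "((\<lambda>t::real. norm (f' (g (f A + t *\<^sub>R v)) - f' A - t *\<^sub>R T v) / norm t) \<longlongrightarrow> 0) (at 0)"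
      using comp unfolding has_derivative_at Tscale
      by (simp only: gf[OF c(3)] add_0 scaleR_zero_left add_0_right)
    have quot: "norm ((y - z) /\<^sub>R t - w) = norm (y - z - t *\<^sub>R w) / norm t"
      if "t \<noteq> 0" for y z w :: "complex^'n^'m" and t :: real
    proof -
      have "(y - z) /\<^sub>R t - w = (y - z - t *\<^sub>R w) /\<^sub>R t"
        using that by (simp add: scaleR_right_diff_distrib)
      then show ?thesis by (simp only: norm_scaleR abs_inverse real_norm_def divide_inverse mult.commute)
    qed
    have "((\<lambda>t::real. norm ((f' (g (f A + t *\<^sub>R v)) - f' A) /\<^sub>R t - T v)) \<longlongrightarrow> 0) (at 0)"
      by (rule Lim_transform_eventually[OF lim0]) (rule eventually_mono[OF eventually_neq_at_within[of 0]], simp only: quot not_False_eq_True)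
    then have lim: "((\<lambda>t::real. (f' (g (f A + t *\<^sub>R v)) - f' A) /\<^sub>R t) \<longlongrightarrow> T v) (at 0)"
      by (rule LIM_zero_cancel[OF tendsto_norm_zero_cancel])
    have contg: "isCont g (f A)" using Dg has_derivative_continuous by blast
    have evV: "\<forall>\<^sub>F t in at (0::real). f A + t *\<^sub>R v \<in> V"
      using topological_tendstoD[OF tends c(2) fU[OF c(3)]] .
    have "((\<lambda>t::real. g (f A + t *\<^sub>R v)) \<longlongrightarrow> A) (at 0)"
      using isCont_tendsto_compose[OF contg tends] gf[OF c(3)] by simp
    then have evU: "\<forall>\<^sub>F t in at (0::real). g (f A + t *\<^sub>R v) \<in> U'"
      using topological_tendstoD c'(1,3) by blast
    have ev: "\<forall>\<^sub>F t in at (0::real). (f' (g (f A + t *\<^sub>R v)) - f' A) /\<^sub>R t \<in> coord_subspace I'"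
      using evV evU
    proof eventually_elim
      case (elim t)
      have "f A + t *\<^sub>R v \<in> coord_subspace I \<inter> V"
        using elim fA v subspace_coord_subspace[of I]
        by (simp add: subspace_add subspace_scale)
      then obtain x where x: "x \<in> S \<inter> U" "f x = f A + t *\<^sub>R v" using c(8) by (metis imageE)
      then have "g (f A + t *\<^sub>R v) = x" using gf by (metis IntD2)
      then have "f' (g (f A + t *\<^sub>R v)) \<in> coord_subspace I'" using x elim c'(8) by blast
      moreover have "f' A \<in> coord_subspace I'" using c'(3,8) A by blast
      ultimately show ?case
        using subspace_coord_subspace[of I'] by (simp add: subspace_diff subspace_scale)
    qed
    show ?thesis
      using Lim_in_closed_set[OF closed_subspace[OF subspace_coord_subspace] ev _ lim] by simp
  qed
  have "dim (coord_subspace I :: (complex^'n^'m) set) = dim (T ` coord_subspace I)"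
    using dim_image_eq[OF linT] injT by (metis inj_on_subset subset_UNIV)
  also have "\<dots> \<le> dim (coord_subspace I' :: (complex^'n^'m) set)"
    using Timg by (intro dim_subset) blast
  finally show ?thesis using c(7) c'(7) by (simp add: dim_coord_subspace)
qed

lemma has_complex_dimension_unique:
  fixes S :: "(complex^'n::finite^'m::finite) set"
  assumes "has_complex_dimension S d" "has_complex_dimension S d'"
  shows "d = d'"
  using has_complex_dimension_le assms by (metis le_antisym)


section \<open>Matrices of a given Jordan type\<close>

text \<open>
  Translation into \<^typ>\<open>'a mat\<close>, where characteristic polynomials and Jordan normal forms live.
  The index type is enumerated by an arbitrary bijection from \<open>{..<CARD('n)}\<close>; another
  enumeration gives a similar matrix.
\<close>

definition to_mat :: "'a^'n::finite^'n \<Rightarrow> 'a mat" where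
  "to_mat A = Matrix.mat CARD('n) CARD('n)
     (\<lambda>(i, j). A $ from_nat_into UNIV i $ from_nat_into UNIV j)"

text \<open>
  The eigenvalues \<open>lam 1, \<dots>, lam p\<close> are distinct but otherwise arbitrary; \<open>lam a\<close> has algebraic
  multiplicity \<open>ns a\<close>, and the Jordan blocks belonging to it have orders \<open>k a 1, \<dots>, k a (N a)\<close>.
  In \<^term>\<open>jordan_nf B bs\<close> the list \<open>bs\<close> consists of the pairs (order of the block, eigenvalue).
\<close>

definition jordan_type_set ::
  "nat \<Rightarrow> (nat \<Rightarrow> nat) \<Rightarrow> (nat \<Rightarrow> nat) \<Rightarrow> (nat \<Rightarrow> nat \<Rightarrow> nat) \<Rightarrow> (complex^'n::finite^'n) set" where
  "jordan_type_set p ns N k =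
    {A. \<exists>lam :: nat \<Rightarrow> complex.
          inj_on lam {1..p} \<and>
          {z. eigenvalue (to_mat A) z} = lam ` {1..p} \<and>
          (\<forall>a\<in>{1..p}. Polynomial.order (lam a) (char_poly (to_mat A)) = ns a) \<and>
          (\<exists>bs. jordan_nf (to_mat A) bs \<and>
            (\<forall>a\<in>{1..p}. {# fst b. b \<in># filter_mset (\<lambda>b. snd b = lam a) (mset bs) #} =
                        {# k a j. j \<in># mset_set {1..N a} #}))}"

end

(*
  A matrix B is similar to A as soon as the space of intertwiners {X. A X = X B} contains an
  invertible element, and the dimension of this space is upper semicontinuous in (A, B). For Jordan
  matrices it equals the sum of min (k a i) (k b j) over the pairs of blocks with equal
  eigenvalues, that is, a sum of inner products of conjugate partitions.

  Let A = P J(lam) P' be a point of the set. A nearby point B of the set has eigenvalues mu a close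
  to lam a, by continuity of the characteristic polynomial. Semicontinuity together with the equality
  case of the Cauchy-Schwarz inequality shows that mu a has the same blocks as lam a, so that B is
  similar to B' = P J(mu) P'. The intertwiners of B and B' then have the same dimension as
  the centralizer of A, so they are complementary to a fixed complement C of this centralizer. Hence
  1 = (1 + X) - X with X in C small and 1 + X an intertwiner: B = (1 + X) B' (1 + X)^-1.

  By the inverse function theorem (X, mu, Z) |-> (1 + X) P J(mu) P' (1 + X)^-1 + Z, with X in C and Z
  transversal to the range of [., A] and to the spectral projections of A, is a local biholomorphism,
  and by the above the set is locally the image of Z = 0. The complex dimension is therefore
  dim C + p = n^2 - dim (centralizer of A) + p.
*)

theory Submission
  imports Defs
begin

section \<open>Complex linear algebra on matrices\<close>

text \<open>The obstacle is embeddedness. A chart needs every point of the set near \<open>A\<close>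
  to come from parameters near 0, so that no second sheet of the set accumulates at
  \<open>A\<close>. Two things could go wrong. First, labels of equal multiplicity but different
  block sizes could exchange their places: a nearby point could carry, close to
  \<open>lam a\<close>, the blocks of another label. The dimension count for intertwiners excludes
  this, and it only uses that some eigenvalue lies close to each \<open>lam a\<close>; no continuity
  of multiplicities enters. Second, a similarity between B and B' could be far from 1, since
  conjugators are neither unique nor bounded. Correcting 1 inside a fixed complement of the
  centralizer gives 1 + X with norm X at most K * norm (B - B'), by the same estimate that yields
  semicontinuity. Holomorphy comes for free, because all complements are built from complex-linear
  generalized inverses. Dimensions of subspaces are counted over the reals, hence the factors 2
  throughout.\<close>

lemma axis_nth_if: "axis i x $ j = (if j = i then x else 0)"
  by (simp add: axis_def)

definition unit_matrices :: "(complex^'n^'m) set" where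
  "unit_matrices = range (\<lambda>(i, j). axis i (axis j 1))"

lemma cscale_nth [simp]: "cscale c X $ i $ j = c * X $ i $ j"
  by (simp add: cscale_def)

lemma sum_cscale_unit_matrices:
  fixes X :: "complex^'n^'m"
  shows "X = (\<Sum>x\<in>UNIV. cscale (X $ fst x $ snd x) (axis (fst x) (axis (snd x) 1)))"
proof -
  have "(\<Sum>x\<in>UNIV. cscale (X $ fst x $ snd x) (axis (fst x) (axis (snd x) 1))) $ i $ j = X $ i $ j"
    for i j
  proof -
    have "(\<Sum>x\<in>UNIV. cscale (X $ fst x $ snd x) (axis (fst x) (axis (snd x) 1))) $ i $ j
      = (\<Sum>x\<in>UNIV. if x = (i, j) then X $ i $ j else 0)"
      unfolding sum_component by (intro sum.cong) (auto simp: axis_def)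
    also have "\<dots> = X $ i $ j" by simp
    finally show ?thesis .
  qed
  then show ?thesis by (simp add: Finite_Cartesian_Product.vec_eq_iff)
qed

text \<open>Supplies bases, spans and extensions of linear maps over the complex numbers. The
  unprefixed \<open>dim\<close>, \<open>subspace\<close> and \<open>linear\<close> remain the real
  notions.\<close>

interpretation cvec: vector_space "cscale :: complex \<Rightarrow> complex^'n^'m \<Rightarrow> complex^'n^'m"
  by unfold_locales (simp_all add: Finite_Cartesian_Product.vec_eq_iff algebra_simps)

lemma unit_matrices_independent: "cvec.independent (unit_matrices :: (complex^'n^'m) set)"
proof -
  have inj: "inj (\<lambda>(i::'m, j::'n). axis i (axis j (1::complex)))"
    by (auto simp: inj_on_def axis_eq_axis)
  show ?thesis
    unfolding unit_matrices_def
  proof (rule cvec.independent_if_scalars_zero)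
    show "finite (range (\<lambda>(i::'m, j::'n). axis i (axis j (1::complex))))" by simp
    fix f :: "complex^'n^'m \<Rightarrow> complex" and x
    let ?e = "\<lambda>(i::'m, j::'n). axis i (axis j (1::complex))"
    assume s: "(\<Sum>x\<in>range ?e. cscale (f x) x) = 0" and x: "x \<in> range ?e"
    have s': "(\<Sum>y\<in>UNIV. cscale (f (?e y)) (?e y)) = 0"
      using s by (simp add: sum.reindex[OF inj] o_def)
    obtain i j where ij: "x = ?e (i, j)" using x by auto
    have "(\<Sum>y\<in>UNIV. cscale (f (?e y)) (?e y)) $ i $ j = (\<Sum>y\<in>UNIV. if y = (i, j) then f x else 0)"
      unfolding sum_component by (intro sum.cong refl) (auto simp: ij split_def prod_eq_iff axis_nth_if)
    also have "\<dots> = f x" by simp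
    finally show "f x = 0" by (simp only: s' zero_index)
  qed
qed

lemma cspan_unit_matrices: "cvec.span (unit_matrices :: (complex^'n^'m) set) = UNIV"
proof -
  have "X \<in> cvec.span unit_matrices" for X :: "complex^'n^'m"
    by (subst sum_cscale_unit_matrices, intro cvec.span_sum cvec.span_scale cvec.span_base)
      (auto simp: unit_matrices_def)
  then show ?thesis by blast
qed

interpretation cvec: finite_dimensional_vector_space
  "cscale :: complex \<Rightarrow> complex^'n^'m \<Rightarrow> complex^'n^'m" unit_matrices
  by unfold_locales
    (simp_all add: unit_matrices_independent cspan_unit_matrices, simp add: unit_matrices_def)

interpretation cvec: vector_space_pair
  "cscale :: complex \<Rightarrow> complex^'n^'m \<Rightarrow> complex^'n^'m" "cscale :: complex \<Rightarrow> complex^'n^'m \<Rightarrow> complex^'n^'m"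
  by unfold_locales

abbreviation clinear :: "(complex^'n^'m \<Rightarrow> complex^'n^'m) \<Rightarrow> bool" where
  "clinear \<equiv> Vector_Spaces.linear cscale cscale"

lemma scaleR_cscale: "r *\<^sub>R X = cscale (of_real r) X"
  by (simp add: Finite_Cartesian_Product.vec_eq_iff scaleR_conv_of_real[symmetric])

lemma clinear_iff: "clinear f \<longleftrightarrow> (\<forall>X Y. f (X + Y) = f X + f Y) \<and> (\<forall>c X. f (cscale c X) = cscale c (f X))"
  unfolding Vector_Spaces.linear_def module_hom_def module_hom_axioms_def
  using cvec.vector_space_axioms cvec.module_axioms by auto

lemma clinear_imp_linear: "clinear f \<Longrightarrow> linear f"
  by (simp add: clinear_iff linear_iff scaleR_cscale)

lemma clinear_imp_bounded_linear: "clinear f \<Longrightarrow> bounded_linear f"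
  by (simp add: clinear_imp_linear linear_conv_bounded_linear[symmetric])

lemma csubspace_iff:
  "cvec.subspace S \<longleftrightarrow> 0 \<in> S \<and> (\<forall>X\<in>S. \<forall>Y\<in>S. X + Y \<in> S) \<and> (\<forall>c. \<forall>X\<in>S. cscale c X \<in> S)"
  by (auto simp: cvec.subspace_def)

lemma generalized_inverse:
  assumes "clinear f"
  obtains g where "clinear g" "\<And>X. f (g (f X)) = f X"
  using cvec.linear_exists_right_inverse_on[OF assms cvec.subspace_UNIV] by auto

text \<open>The definition of a submanifold asks for coordinate subspaces, whereas charts produce
  arbitrary ones. A basis of \<open>S\<close> extends to a basis of the whole space, which has as
  many elements as there are unit matrices; any bijection between the two bases extends to an
  isomorphism, and \<open>I\<close> records the images of the basis of \<open>S\<close>.\<close>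

lemma csubspace_straighten:
  fixes S :: "(complex^'n^'m) set"
  assumes S: "cvec.subspace S"
  obtains f g I where "clinear f" "clinear g" "\<And>X. g (f X) = X" "\<And>X. f (g X) = X"
    "f ` S = coord_subspace I"
proof -
  obtain B1 where B1: "B1 \<subseteq> S" "cvec.independent B1" "S \<subseteq> cvec.span B1"
    using cvec.basis_exists by metis
  obtain B where B: "B1 \<subseteq> B" "cvec.independent B" "UNIV \<subseteq> cvec.span B"
    using cvec.maximal_independent_subset_extend[OF subset_UNIV B1(2)] by metis
  have fin: "finite B" using B(2) cvec.finiteI_independent by blast
  have finU: "finite (unit_matrices :: (complex^'n^'m) set)" by (simp add: unit_matrices_def)
  have "card B = card (unit_matrices :: (complex^'n^'m) set)"
    using cvec.dim_eq_card[of B UNIV] cvec.dim_eq_card[OF _ unit_matrices_independent, of UNIV] B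
      cspan_unit_matrices by (metis cvec.span_UNIV top.extremum_uniqueI)
  then obtain h where h: "bij_betw h B (unit_matrices :: (complex^'n^'m) set)"
    using finite_same_card_bij[OF fin finU] by blast
  obtain f where f: "clinear f" "\<forall>x\<in>B. f x = h x"
    using cvec.linear_independent_extend[OF B(2)] by blast
  obtain g where g: "clinear g" "\<forall>x\<in>unit_matrices. g x = inv_into B h x"
    using cvec.linear_independent_extend[OF unit_matrices_independent] by blast
  have gf: "g (f X) = X" for X
  proof -
    have "clinear (g \<circ> f)" "clinear (\<lambda>X. X)"
      using f(1) g(1) by (auto simp: clinear_iff)
    moreover have "(g \<circ> f) b = b" if "b \<in> B" for b
    proof -
      have "h b \<in> unit_matrices" using h that by (auto simp: bij_betw_def)
      then show ?thesis using that f(2) g(2) h by (simp add: bij_betw_def)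
    qed
    ultimately have "(g \<circ> f) X = X"
      using cvec.linear_eq_on_span[of "g \<circ> f" "\<lambda>X. X" B X] B(3) by blast
    then show ?thesis by simp
  qed
  have fg: "f (g X) = X" for X
  proof -
    have "clinear (f \<circ> g)" "clinear (\<lambda>X. X)"
      using f(1) g(1) by (auto simp: clinear_iff)
    moreover have "(f \<circ> g) b = b" if "b \<in> unit_matrices" for b
      using that f g h by (auto simp: bij_betw_def f_inv_into_f inv_into_into)
    ultimately have "(f \<circ> g) X = X"
      using cvec.linear_eq_on_span[of "f \<circ> g" "\<lambda>X. X" unit_matrices X] cspan_unit_matrices by blast
    then show ?thesis by simp
  qed
  define e where "e = (\<lambda>(i::'m, j::'n). axis i (axis j (1::complex)))"
  define I where "I = e -` h ` B1"
  have "h ` B1 \<subseteq> range e"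
    using h B(1) by (auto simp: bij_betw_def unit_matrices_def e_def)
  then have hB1: "h ` B1 = e ` I" by (auto simp: I_def image_vimage_eq)
  have "S = cvec.span B1"
    using B1 S cvec.span_minimal by blast
  then have "f ` S = cvec.span (f ` B1)"
    by (simp add: cvec.linear_span_image[OF f(1)])
  also have "f ` B1 = e ` I" using hB1 f(2) B(1) by (metis image_cong subset_iff)
  also have "cvec.span (e ` I) = coord_subspace I"
  proof
    have "cvec.subspace (coord_subspace I)"
      by (auto simp: csubspace_iff coord_subspace_def)
    moreover have "e ` I \<subseteq> coord_subspace I"
      by (auto simp: e_def coord_subspace_def axis_def)
    ultimately show "cvec.span (e ` I) \<subseteq> coord_subspace I"
      using cvec.span_minimal by blast
    show "coord_subspace I \<subseteq> cvec.span (e ` I)"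
    proof
      fix X :: "complex^'n^'m" assume X: "X \<in> coord_subspace I"
      show "X \<in> cvec.span (e ` I)"
      proof (subst sum_cscale_unit_matrices, rule cvec.span_sum)
        fix x :: "'m \<times> 'n"
        show "cscale (X $ fst x $ snd x) (axis (fst x) (axis (snd x) 1)) \<in> cvec.span (e ` I)"
        proof (cases "x \<in> I")
          case True
          then have "axis (fst x) (axis (snd x) 1) \<in> e ` I"
            by (auto simp: e_def image_iff split_def intro!: bexI[of _ x])
          then show ?thesis by (intro cvec.span_scale cvec.span_base)
        next
          case False
          then have "X $ fst x $ snd x = 0" using X by (simp add: coord_subspace_def)
          then show ?thesis by (simp add: cvec.span_zero)
        qed
      qed
    qed
  qed
  finally have "f ` S = coord_subspace I" .
  then show thesis using that f(1) g(1) gf fg by blast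
qed

section \<open>Analysis of the matrix operations\<close>

lemma bounded_bilinear_matrix_mult:
  "bounded_bilinear ((**) :: complex^'n^'m \<Rightarrow> complex^'k^'n \<Rightarrow> complex^'k^'m)"
proof -
  have "bilinear ((**) :: complex^'n^'m \<Rightarrow> complex^'k^'n \<Rightarrow> complex^'k^'m)"
    by (auto simp: bilinear_def linear_iff matrix_matrix_mult_def
        Finite_Cartesian_Product.vec_eq_iff scaleR_sum_right algebra_simps sum.distrib)
  then show ?thesis by (simp add: bilinear_conv_bounded_bilinear)
qed

lemmas has_derivative_matrix_mult [derivative_intros] =
  bounded_bilinear.FDERIV[OF bounded_bilinear_matrix_mult]
lemmas continuous_on_matrix_mult [continuous_intros] =
  bounded_bilinear.continuous_on[OF bounded_bilinear_matrix_mult]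
lemma cscale_matrix_mult:
  "cscale c A ** B = cscale c (A ** B)" "A ** cscale c B = cscale c (A ** B)"
  by (simp_all add: matrix_matrix_mult_def Finite_Cartesian_Product.vec_eq_iff sum_distrib_left algebra_simps)

lemma matrix_add_rdistrib: "(B + C) ** (A::'a::semiring_1^'n^'m) = B ** A + C ** A"
  by (simp add: matrix_matrix_mult_def Finite_Cartesian_Product.vec_eq_iff sum.distrib algebra_simps)

lemma matrix_diff_ldistrib: "(A::'a::ring_1^'n^'m) ** (B - C) = A ** B - A ** C"
  by (simp add: matrix_matrix_mult_def Finite_Cartesian_Product.vec_eq_iff sum_subtractf algebra_simps)

lemma matrix_diff_rdistrib: "(B - C) ** (A::'a::ring_1^'n^'m) = B ** A - C ** A"
  by (simp add: matrix_matrix_mult_def Finite_Cartesian_Product.vec_eq_iff sum_subtractf algebra_simps)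

lemma continuous_on_Det [continuous_intros]:
  fixes f :: "'a::topological_space \<Rightarrow> complex^'n^'n"
  assumes "continuous_on S f"
  shows "continuous_on S (\<lambda>x. Determinants.det (f x))"
  unfolding Determinants.det_def using assms by (intro continuous_intros)

lemma matrix_inv_mult:
  fixes A :: "complex^'n^'n"
  assumes "Determinants.det A \<noteq> 0"
  shows "A ** matrix_inv A = Finite_Cartesian_Product.mat 1"
    and "matrix_inv A ** A = Finite_Cartesian_Product.mat 1"
proof -
  have "\<exists>B. A ** B = Finite_Cartesian_Product.mat 1 \<and> B ** A = Finite_Cartesian_Product.mat 1"
    using assms by (simp add: invertible_det_nz[symmetric] Finite_Cartesian_Product.invertible_def)
  then show "A ** matrix_inv A = Finite_Cartesian_Product.mat 1"
    and "matrix_inv A ** A = Finite_Cartesian_Product.mat 1"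
    unfolding matrix_inv_def by (metis (mono_tags, lifting) someI_ex)+
qed

text \<open>Cramer's rule, column by column. It reduces continuity of the inverse to continuity of
  the determinant.\<close>

lemma matrix_inv_nth:
  fixes A :: "complex^'n^'n"
  assumes "Determinants.det A \<noteq> 0"
  shows "matrix_inv A $ k $ l =
    Determinants.det (\<chi> i j. if j = k then axis l 1 $ i else A $ i $ j) / Determinants.det A"
proof -
  have "A *v (matrix_inv A *v axis l 1) = axis l 1"
    using matrix_inv_mult(1)[OF assms] by (simp add: matrix_vector_mul_assoc)
  then have "matrix_inv A *v axis l 1 =
      (\<chi> k. Determinants.det (\<chi> i j. if j = k then axis l 1 $ i else A $ i $ j) / Determinants.det A)"
    using cramer[OF assms] by blast
  then show ?thesis
    by (simp add: Finite_Cartesian_Product.vec_eq_iff matrix_vector_mult_def axis_def if_distrib cong: if_cong)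
qed

lemma continuous_on_matrix_inv:
  "continuous_on {A :: complex^'n^'n. Determinants.det A \<noteq> 0} matrix_inv"
proof -
  have "continuous_on {A :: complex^'n^'n. Determinants.det A \<noteq> 0}
      (\<lambda>A. \<chi> k l. Determinants.det (\<chi> i j. if j = k then axis l 1 $ i else A $ i $ j) / Determinants.det A)"
  proof (intro continuous_on_vec_lambda continuous_on_divide continuous_on_Det continuous_on_id)
    fix k l i j :: 'n
    show "continuous_on {A :: complex^'n^'n. Determinants.det A \<noteq> 0}
      (\<lambda>A. if j = k then axis l 1 $ i else A $ i $ j)"
      by (cases "j = k") (auto intro!: continuous_intros)
  qed auto
  then show ?thesis
    by (rule continuous_on_eq) (simp add: matrix_inv_nth Finite_Cartesian_Product.vec_eq_iff)
qed

lemma open_det_nz: "open {A :: complex^'n^'n. Determinants.det A \<noteq> 0}"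
proof -
  have "open ((\<lambda>A :: complex^'n^'n. Determinants.det A) -` (- {0}))"
    by (intro open_vimage continuous_intros)
  then show ?thesis by (simp add: vimage_def)
qed

text \<open>Expanding matrix_inv Y ** (Y - A) ** matrix_inv A shows that the error of the linear
  approximation is exactly (matrix_inv A - matrix_inv Y) ** (Y - A) ** matrix_inv A. Continuity of
  the inverse makes the first factor small, so the error is o(norm (Y - A)).\<close>

lemma has_derivative_matrix_inv:
  fixes A :: "complex^'n^'n"
  assumes A: "Determinants.det A \<noteq> 0"
  shows "(matrix_inv has_derivative (\<lambda>H. - (matrix_inv A ** H ** matrix_inv A))) (at A)"
proof -
  interpret bb: bounded_bilinear "(**) :: complex^'n^'n \<Rightarrow> complex^'n^'n \<Rightarrow> complex^'n^'n"
    by (rule bounded_bilinear_matrix_mult)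
  let ?B = "matrix_inv A"
  let ?U = "{A :: complex^'n^'n. Determinants.det A \<noteq> 0}"
  have inv: "matrix_inv Y ** Y = Finite_Cartesian_Product.mat 1" "Y ** matrix_inv Y = Finite_Cartesian_Product.mat 1"
    if "Y \<in> ?U" for Y :: "complex^'n^'n"
    using that matrix_inv_mult[of Y] by auto
  have rem: "matrix_inv Y - ?B - - (?B ** (Y - A) ** ?B) = (?B - matrix_inv Y) ** (Y - A) ** ?B"
    if "Y \<in> ?U" for Y
  proof -
    have "matrix_inv Y ** (Y - A) ** ?B = ?B - matrix_inv Y"
      using inv[OF that] inv[of A] A
      by (simp add: matrix_diff_ldistrib matrix_diff_rdistrib matrix_mul_assoc[symmetric])
    then show ?thesis by (simp add: matrix_diff_rdistrib)
  qed
  obtain K where K: "K > 0" "\<forall>(X::complex^'n^'n) (Y::complex^'n^'n). norm (X ** Y) \<le> norm X * norm Y * K"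
    using bb.pos_bounded by metis
  have lim: "((\<lambda>Y. norm (?B - matrix_inv Y) * (K * K * norm ?B)) \<longlongrightarrow> 0) (at A)"
  proof -
    have "isCont matrix_inv A"
      using continuous_on_interior[OF continuous_on_matrix_inv, of A] A
      by (simp add: interior_open[OF open_det_nz])
    then have "(matrix_inv \<longlongrightarrow> ?B) (at A)" by (simp add: isCont_def)
    then show ?thesis by (auto intro!: tendsto_eq_intros)
  qed
  have ev: "\<forall>\<^sub>F Y in at A. Y \<in> ?U"
    using open_det_nz A eventually_at_topological by blast
  show ?thesis
    unfolding has_derivative_iff_norm
  proof
    show "bounded_linear (\<lambda>H. - (?B ** H ** ?B))"
      by (intro bounded_linear_minus bounded_linear_compose[OF bb.bounded_linear_left bb.bounded_linear_right])
    show "((\<lambda>Y. norm (matrix_inv Y - ?B - - (?B ** (Y - A) ** ?B)) / norm (Y - A)) \<longlongrightarrow> 0) (at A)"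
    proof (rule tendsto_sandwich[OF _ _ tendsto_const lim])
      show "\<forall>\<^sub>F Y in at A. 0 \<le> norm (matrix_inv Y - ?B - - (?B ** (Y - A) ** ?B)) / norm (Y - A)"
        by simp
      show "\<forall>\<^sub>F Y in at A. norm (matrix_inv Y - ?B - - (?B ** (Y - A) ** ?B)) / norm (Y - A)
          \<le> norm (?B - matrix_inv Y) * (K * K * norm ?B)"
        using ev eventually_neq_at_within[of A]
      proof eventually_elim
        case (elim Y)
        have "norm ((?B - matrix_inv Y) ** (Y - A) ** ?B)
            \<le> norm ((?B - matrix_inv Y) ** (Y - A)) * norm ?B * K" using K by simp
        also have "\<dots> \<le> (norm (?B - matrix_inv Y) * norm (Y - A) * K) * norm ?B * K"
          using K by (intro mult_right_mono) auto
        finally show ?case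
          using elim by (simp only: rem) (simp add: field_simps)
      qed
    qed
  qed
qed

text \<open>The function \<open>r\<close> plays the role of a linear order in which \<open>A\<close> is upper triangular.\<close>

lemma det_triangular_rank:
  fixes A :: "'a::comm_ring_1^'n^'n" and r :: "'n \<Rightarrow> nat"
  assumes tri: "\<And>i j. A $ i $ j \<noteq> 0 \<Longrightarrow> i = j \<or> r i < r j"
  shows "Determinants.det A = (\<Prod>i\<in>UNIV. A $ i $ i)"
proof -
  \<comment> \<open>If no factor vanished, \<open>r\<close> would never drop along \<open>q\<close>
    and would rise somewhere, although the total of \<open>r\<close> is invariant under a
    permutation.\<close>
  have z: "(\<Prod>i\<in>UNIV. A $ i $ q i) = 0" if q: "q permutes (UNIV :: 'n set)" "q \<noteq> id" for q
  proof (rule ccontr)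
    assume "(\<Prod>i\<in>UNIV. A $ i $ q i) \<noteq> 0"
    then have nz: "A $ i $ q i \<noteq> 0" for i
      using prod_zero[of UNIV "\<lambda>i. A $ i $ q i"] by auto
    have le: "r i \<le> r (q i)" for i using tri[OF nz[of i]] by auto
    obtain i where "q i \<noteq> i" using q(2) by (auto simp: fun_eq_iff)
    then have "r i < r (q i)" using tri[OF nz[of i]] by auto
    then have "(\<Sum>i\<in>UNIV. r i) < (\<Sum>i\<in>UNIV. r (q i))"
      by (intro sum_strict_mono_ex1) (auto simp: le)
    moreover have "(\<Sum>i\<in>UNIV. r (q i)) = (\<Sum>i\<in>UNIV. r i)"
      using sum.permute[OF q(1), of r] by (simp add: o_def)
    ultimately show False by simp
  qed
  have "Determinants.det A = (\<Sum>q\<in>{id}. of_int (sign q) * (\<Prod>i\<in>UNIV. A $ i $ q i))"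
    unfolding Determinants.det_def
    by (rule sum.mono_neutral_right) (auto simp: z permutes_id finite_permutations)
  then show ?thesis by (simp add: sign_id)
qed

lemma det_similar:
  fixes A P P' :: "'a::comm_ring_1^'n^'n"
  assumes "P ** P' = Finite_Cartesian_Product.mat 1"
  shows "Determinants.det (P ** A ** P') = Determinants.det A"
proof -
  have "Determinants.det P * Determinants.det P' = 1"
    using assms by (simp flip: det_mul)
  then show ?thesis by (simp add: det_mul mult.commute mult.left_commute)
qed

section \<open>Intertwiners of matrices\<close>

definition intertwiners :: "'a::semiring_1^'n^'n \<Rightarrow> 'a^'n^'n \<Rightarrow> ('a^'n^'n) set" where
  "intertwiners A B = {X. A ** X = X ** B}"

lemma clinear_commutator: "clinear (\<lambda>X. X ** B - A ** X)"
  by (simp add: clinear_iff cscale_matrix_mult matrix_add_ldistrib matrix_add_rdistrib cvec.scale_right_diff_distrib)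

lemma intertwiners_eq_kernel:
  "intertwiners A B = {X. X ** B - A ** X = (0 :: 'a::ring_1^'n^'n)}"
  by (auto simp: intertwiners_def)

lemma subspace_intertwiners: "subspace (intertwiners A B :: (complex^'n^'n) set)"
  unfolding intertwiners_eq_kernel
  by (rule linear_subspace_kernel[OF clinear_imp_linear[OF clinear_commutator]])

lemma linear_matrix_mult_left_right:
  "linear (\<lambda>X. P ** X ** Q :: complex^'n^'n)" for P Q :: "complex^'n^'n"
proof -
  interpret bb: bounded_bilinear "(**) :: complex^'n^'n \<Rightarrow> complex^'n^'n \<Rightarrow> complex^'n^'n"
    by (rule bounded_bilinear_matrix_mult)
  show ?thesis
    using bounded_linear_compose[OF bb.bounded_linear_left[of Q] bb.bounded_linear_right[of P]]
    by (simp add: linear_conv_bounded_linear o_def)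
qed

text \<open>The map X \<mapsto> P X Q' carries one space onto the other. The two conjugations are
  independent, so either matrix can be replaced by its Jordan form separately.\<close>

lemma dim_intertwiners_similar:
  fixes A B P P' Q Q' :: "complex^'n^'n"
  assumes P: "P ** P' = Finite_Cartesian_Product.mat 1" "P' ** P = Finite_Cartesian_Product.mat 1"
    and Q: "Q ** Q' = Finite_Cartesian_Product.mat 1" "Q' ** Q = Finite_Cartesian_Product.mat 1"
  shows "dim (intertwiners (P ** A ** P') (Q ** B ** Q')) = dim (intertwiners A B)"
proof -
  have c: "P' ** (P ** X) = X" "P ** (P' ** X) = X" "Q' ** (Q ** X) = X" "Q ** (Q' ** X) = X" 
    for X :: "complex^'n^'n"
    using P Q by (simp_all add: matrix_mul_assoc)
  let ?f = "\<lambda>X. P ** X ** Q'"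
  have inj: "inj ?f"
    by (rule inj_on_inverseI[where g = "\<lambda>X. P' ** X ** Q"])
      (simp add: matrix_mul_assoc[symmetric] c Q)
  have "intertwiners (P ** A ** P') (Q ** B ** Q') = ?f ` intertwiners A B"
  proof
    show "?f ` intertwiners A B \<subseteq> intertwiners (P ** A ** P') (Q ** B ** Q')"
    proof (clarsimp simp: intertwiners_def)
      fix X assume X: "A ** X = X ** B"
      have "P ** A ** P' ** (P ** X ** Q') = P ** (A ** X) ** Q'"
        by (simp add: matrix_mul_assoc[symmetric] c)
      also have "\<dots> = P ** X ** Q' ** (Q ** B ** Q')"
        by (simp add: X) (simp add: matrix_mul_assoc[symmetric] c)
      finally show "P ** A ** P' ** (P ** X ** Q') = P ** X ** Q' ** (Q ** B ** Q')" .
    qed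
    show "intertwiners (P ** A ** P') (Q ** B ** Q') \<subseteq> ?f ` intertwiners A B"
    proof
      fix Y assume "Y \<in> intertwiners (P ** A ** P') (Q ** B ** Q')"
      then have Y: "P ** (A ** (P' ** Y)) = Y ** (Q ** (B ** Q'))"
        by (simp add: intertwiners_def matrix_mul_assoc)
      have "A ** (P' ** Y ** Q) = P' ** (P ** (A ** (P' ** Y))) ** Q"
        by (simp add: matrix_mul_assoc[symmetric] c)
      also have "\<dots> = P' ** Y ** Q ** B"
        unfolding Y by (simp add: matrix_mul_assoc[symmetric] c Q)
      finally have "P' ** Y ** Q \<in> intertwiners A B" by (simp add: intertwiners_def)
      moreover have "Y = ?f (P' ** Y ** Q)" by (simp add: matrix_mul_assoc[symmetric] c Q)
      ultimately show "Y \<in> ?f ` intertwiners A B" by blast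
    qed
  qed
  then show ?thesis
    using dim_image_eq[OF linear_matrix_mult_left_right[of P Q'], of "intertwiners A B"] inj
    by (metis inj_on_subset subset_UNIV)
qed

section \<open>Jordan matrices with prescribed block sizes\<close>

text \<open>
  The rows and columns are labelled by the triples \<open>(a, j, l)\<close>: position \<open>l\<close> in the \<open>j\<close>-th
  block belonging to the \<open>a\<close>-th eigenvalue.
\<close>

fun jordan_entry :: "(nat \<Rightarrow> complex) \<Rightarrow> nat \<times> nat \<times> nat \<Rightarrow> nat \<times> nat \<times> nat \<Rightarrow> complex" where
  "jordan_entry lam (a, i, l) (b, j, l') =
    (if a = b \<and> i = j then if l = l' then lam a else if l' = Suc l then 1 else 0 else 0)"

locale jordan_labelling =
  fixes p :: nat and N :: "nat \<Rightarrow> nat" and k :: "nat \<Rightarrow> nat \<Rightarrow> nat"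
    and label :: "'n::finite \<Rightarrow> nat \<times> nat \<times> nat"
  assumes label: "bij_betw label UNIV {(a, j, l). a \<in> {1..p} \<and> j \<in> {1..N a} \<and> l < k a j}"
begin

definition labels :: "(nat \<times> nat \<times> nat) set" where
  "labels = {(a, j, l). a \<in> {1..p} \<and> j \<in> {1..N a} \<and> l < k a j}"

lemma in_labels_iff [simp]: "(a, j, l) \<in> labels \<longleftrightarrow> a \<in> {1..p} \<and> j \<in> {1..N a} \<and> l < k a j"
  by (simp add: labels_def)

definition index :: "nat \<times> nat \<times> nat \<Rightarrow> 'n" where
  "index = inv_into UNIV label"

definition jordan :: "(nat \<Rightarrow> complex) \<Rightarrow> complex^'n^'n" where
  "jordan lam = (\<chi> x y. jordan_entry lam (label x) (label y))"

lemma label_in: "label x = (a, j, l) \<Longrightarrow> a \<in> {1..p} \<and> j \<in> {1..N a} \<and> l < k a j"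
  using bij_betwE[OF label, rule_format, of x] by simp

lemma label_index [simp]: "t \<in> labels \<Longrightarrow> label (index t) = t"
  using bij_betw_inv_into_right[OF label[folded labels_def], of t] by (simp add: index_def)

lemma index_label [simp]: "index (label x) = x"
  using label by (simp add: index_def bij_betw_def)

lemma label_eq_iff: "t \<in> labels \<Longrightarrow> label x = t \<longleftrightarrow> x = index t"
  using label_index[of t] index_label[of x] by metis

text \<open>Within a block, multiplication from the left adds the next row, and multiplication from
  the right adds the previous column. The boundary conditions \<open>Suc l < k a i\<close> and
  \<open>l' > 0\<close> are what makes the block orders constrain an intertwiner.\<close>

lemma jordan_mult_left:
  assumes x: "label x = (a, i, l)"
  shows "(jordan lam ** X) $ x $ y =
    lam a * X $ x $ y + (if Suc l < k a i then X $ index (a, i, Suc l) $ y else 0)"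
proof -
  have "(jordan lam ** X) $ x $ y = (\<Sum>z\<in>UNIV. jordan_entry lam (a, i, l) (label z) * X $ z $ y)"
    by (simp add: jordan_def matrix_matrix_mult_def x)
  also have "\<dots> = (\<Sum>z\<in>UNIV. (if z = x then lam a * X $ x $ y else 0) +
      (if Suc l < k a i \<and> z = index (a, i, Suc l) then X $ index (a, i, Suc l) $ y else 0))"
  proof (rule sum.cong[OF refl])
    fix z
    obtain b j l' where z: "label z = (b, j, l')" by (metis prod_cases3)
    have 1: "z = x \<longleftrightarrow> (b, j, l') = (a, i, l)"
      using x z index_label by metis
    have 2: "Suc l < k a i \<and> z = index (a, i, Suc l) \<longleftrightarrow> (b, j, l') = (a, i, Suc l)"
    proof (cases "Suc l < k a i")
      case True
      then have "(a, i, Suc l) \<in> labels" using label_in[OF x] by simp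
      from label_eq_iff[OF this, of z] show ?thesis using z True by simp
    next
      case False
      then show ?thesis using label_in[OF z] by auto
    qed
    show "jordan_entry lam (a, i, l) (label z) * X $ z $ y = (if z = x then lam a * X $ x $ y else 0) +
      (if Suc l < k a i \<and> z = index (a, i, Suc l) then X $ index (a, i, Suc l) $ y else 0)"
    proof (cases "z = x")
      case True
      with 1 2 have "\<not> (Suc l < k a i \<and> z = index (a, i, Suc l))" by auto
      then show ?thesis using True x by (simp only: if_False) simp
    next
      case False
      then show ?thesis using 1 2 by (auto simp: z)
    qed
  qed
  also have "\<dots> = lam a * X $ x $ y + (if Suc l < k a i then X $ index (a, i, Suc l) $ y else 0)"
    by (simp add: sum.distrib)
  finally show ?thesis .
qed

lemma jordan_mult_right:
  assumes y: "label y = (b, j, l')"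
  shows "(X ** jordan lam) $ x $ y =
    lam b * X $ x $ y + (if l' > 0 then X $ x $ index (b, j, l' - 1) else 0)"
proof -
  have "(X ** jordan lam) $ x $ y = (\<Sum>z\<in>UNIV. X $ x $ z * jordan_entry lam (label z) (b, j, l'))"
    by (simp add: jordan_def matrix_matrix_mult_def y)
  also have "\<dots> = (\<Sum>z\<in>UNIV. (if z = y then lam b * X $ x $ y else 0) +
      (if l' > 0 \<and> z = index (b, j, l' - 1) then X $ x $ index (b, j, l' - 1) else 0))"
  proof (rule sum.cong[OF refl])
    fix z
    obtain a i l where z: "label z = (a, i, l)" by (metis prod_cases3)
    have 1: "z = y \<longleftrightarrow> (a, i, l) = (b, j, l')"
      using y z index_label by metis
    have 2: "l' > 0 \<and> z = index (b, j, l' - 1) \<longleftrightarrow> a = b \<and> i = j \<and> l' = Suc l"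
    proof (cases "l' > 0")
      case True
      then have "(b, j, l' - 1) \<in> labels" using label_in[OF y] by auto
      from label_eq_iff[OF this, of z] show ?thesis using z True by auto
    qed simp
    show "X $ x $ z * jordan_entry lam (label z) (b, j, l') = (if z = y then lam b * X $ x $ y else 0) +
      (if l' > 0 \<and> z = index (b, j, l' - 1) then X $ x $ index (b, j, l' - 1) else 0)"
    proof (cases "z = y")
      case True
      with 1 2 have "\<not> (l' > 0 \<and> z = index (b, j, l' - 1))" by auto
      then show ?thesis using True y by (simp only: if_False) simp
    next
      case False
      then show ?thesis using 1 2 by (auto simp: z)
    qed
  qed
  also have "\<dots> = lam b * X $ x $ y + (if l' > 0 then X $ x $ index (b, j, l' - 1) else 0)"
    by (simp add: sum.distrib)
  finally show ?thesis .
qed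

lemma in_intertwiners_jordan_iff:
  "X \<in> intertwiners (jordan lam) (jordan lam') \<longleftrightarrow>
    (\<forall>a i l b j l'. (a, i, l) \<in> labels \<longrightarrow> (b, j, l') \<in> labels \<longrightarrow>
      lam a * X $ index (a, i, l) $ index (b, j, l') +
        (if Suc l < k a i then X $ index (a, i, Suc l) $ index (b, j, l') else 0) =
      lam' b * X $ index (a, i, l) $ index (b, j, l') +
        (if l' > 0 then X $ index (a, i, l) $ index (b, j, l' - 1) else 0))"
  (is "_ \<longleftrightarrow> ?R")
proof -
  have "X \<in> intertwiners (jordan lam) (jordan lam') \<longleftrightarrow>
      (\<forall>x y. (jordan lam ** X) $ x $ y = (X ** jordan lam') $ x $ y)"
    by (simp add: intertwiners_def Finite_Cartesian_Product.vec_eq_iff)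
  also have "\<dots> \<longleftrightarrow> ?R"
  proof (intro iffI allI impI)
    fix a i l b j l'
    assume *: "\<forall>x y. (jordan lam ** X) $ x $ y = (X ** jordan lam') $ x $ y"
      and t: "(a, i, l) \<in> labels" "(b, j, l') \<in> labels"
    show "lam a * X $ index (a, i, l) $ index (b, j, l') +
        (if Suc l < k a i then X $ index (a, i, Suc l) $ index (b, j, l') else 0) =
      lam' b * X $ index (a, i, l) $ index (b, j, l') +
        (if l' > 0 then X $ index (a, i, l) $ index (b, j, l' - 1) else 0)"
      using *[rule_format, of "index (a, i, l)" "index (b, j, l')"]
      unfolding jordan_mult_left[OF label_index[OF t(1)]] jordan_mult_right[OF label_index[OF t(2)]] .
  next
    fix x y assume R: ?R
    obtain a i l where x: "label x = (a, i, l)" by (metis prod_cases3)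
    obtain b j l' where y: "label y = (b, j, l')" by (metis prod_cases3)
    have xy: "index (a, i, l) = x" "index (b, j, l') = y"
      using x y index_label by metis+
    have "(a, i, l) \<in> labels" "(b, j, l') \<in> labels"
      using label_in[OF x] label_in[OF y] by auto
    from R[rule_format, OF this]
    show "(jordan lam ** X) $ x $ y = (X ** jordan lam') $ x $ y"
      unfolding jordan_mult_left[OF x] jordan_mult_right[OF y] xy .
  qed
  finally show ?thesis .
qed

end

section \<open>Dimension of the space of intertwiners of two Jordan matrices\<close>

context jordan_labelling
begin

definition overlap :: "nat \<Rightarrow> nat \<Rightarrow> nat" where
  "overlap a b = (\<Sum>i = 1..N a. \<Sum>j = 1..N b. min (k a i) (k b j))"

text \<open>
  An intertwiner of two Jordan matrices consists of Toeplitz blocks, and is determined by those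
  entries in the first rows of the blocks whose diagonal leaves the block through the last column.
\<close>

definition free_entries :: "(nat \<Rightarrow> complex) \<Rightarrow> (nat \<Rightarrow> complex) \<Rightarrow> ('n \<times> 'n) set" where
  "free_entries lam lam' = {(index (a, i, 0), index (b, j, l')) |a i b j l'.
    (a, i, 0) \<in> labels \<and> (b, j, l') \<in> labels \<and> lam a = lam' b \<and> k b j \<le> l' + k a i}"

lemma index_eq_iff: "s \<in> labels \<Longrightarrow> t \<in> labels \<Longrightarrow> index s = index t \<longleftrightarrow> s = t"
  by (auto dest: arg_cong[of "index s" "index t" label])

lemma free_entries_iff:
  assumes "(a, i, 0) \<in> labels" "(b, j, l') \<in> labels"
  shows "(index (a, i, 0), index (b, j, l')) \<in> free_entries lam lam' \<longleftrightarrow>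
    lam a = lam' b \<and> k b j \<le> l' + k a i"
proof
  assume "(index (a, i, 0), index (b, j, l')) \<in> free_entries lam lam'"
  then obtain a' i' b' j' m where *: "index (a, i, 0) = index (a', i', 0)" "index (b, j, l') = index (b', j', m)"
    "(a', i', 0) \<in> labels" "(b', j', m) \<in> labels" "lam a' = lam' b'" "k b' j' \<le> m + k a' i'"
    unfolding free_entries_def by blast
  then have "(a, i, 0::nat) = (a', i', 0)" "(b, j, l') = (b', j', m)"
    using index_eq_iff[OF assms(1) *(3)] index_eq_iff[OF assms(2) *(4)] by simp_all
  then show "lam a = lam' b \<and> k b j \<le> l' + k a i" using * by simp
next
  assume "lam a = lam' b \<and> k b j \<le> l' + k a i"
  then show "(index (a, i, 0), index (b, j, l')) \<in> free_entries lam lam'"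
    unfolding free_entries_def using assms by blast
qed

text \<open>In a block with different eigenvalues, \<open>lam a - lam' b\<close> times an entry is a
  combination of its lower and left neighbours, so the block vanishes starting from the lower left
  corner. With equal eigenvalues the entries are constant along diagonals. A diagonal that starts in
  the first column below the first row is zero, and so is one that ends in the last row before the
  last column; the remaining ones start at a free entry.\<close>

lemma intertwiner_determined:
  assumes X: "X \<in> intertwiners (jordan lam) (jordan lam')"
    and free: "\<And>x y. (x, y) \<in> free_entries lam lam' \<Longrightarrow> X $ x $ y = 0"
  shows "X = 0"
proof -
  have "X $ index (a, i, l) $ index (b, j, l') = 0"
    if t: "(a, i, l) \<in> labels" "(b, j, l') \<in> labels" for a i l b j l'
  proof -
    define u where "u l l' = X $ index (a, i, l) $ index (b, j, l')" for l l'
    have ab: "a \<in> {1..p}" "i \<in> {1..N a}" "b \<in> {1..p}" "j \<in> {1..N b}" and l: "l < k a i" "l' < k b j"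
      using t by auto
    have eq: "lam a * u l l' + (if Suc l < k a i then u (Suc l) l' else 0) =
        lam' b * u l l' + (if l' > 0 then u l (l' - 1) else 0)"
      if "l < k a i" "l' < k b j" for l l'
    proof -
      have "(a, i, l) \<in> labels" "(b, j, l') \<in> labels" using that ab by auto
      from X[unfolded in_intertwiners_jordan_iff, rule_format, OF this] show ?thesis
        unfolding u_def .
    qed
    have "u l l' = 0"
    proof (cases "lam a = lam' b")
      case False
      have "u l l' = 0" if "l < k a i" "l' < k b j" for l l'
        using that
      \<comment> \<open>The measure decreases both for the neighbour below and for the neighbour on
        the left.\<close>
      proof (induction "(k a i - l) + l'" arbitrary: l l' rule: less_induct)
        case less
        have 1: "(if Suc l < k a i then u (Suc l) l' else 0) = 0"
          using less.hyps[of "Suc l" l'] less.prems by auto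
        have 2: "(if l' > 0 then u l (l' - 1) else 0) = 0"
          using less.hyps[of l "l' - 1"] less.prems by auto
        show ?case using eq[OF less.prems] False unfolding 1 2 by simp
      qed
      then show ?thesis using l by blast
    next
      case True
      have step: "(if Suc l < k a i then u (Suc l) l' else 0) = (if l' > 0 then u l (l' - 1) else 0)"
        if "l < k a i" "l' < k b j" for l l'
        using eq[OF that] True by simp
      have diag: "u (l + s) (l' + s) = u l l'" if "l + s < k a i" "l' + s < k b j" for l l' s
        using that
      proof (induction s)
        case (Suc s)
        then show ?case using step[of "l + s" "Suc (l' + s)"] by simp
      qed simp
      show ?thesis
      proof (cases "l' < l")
        case True
        then have "u l l' = u (l - l') 0"
          using diag[of "l - l'" l' 0] l by simp
        also have "\<dots> = 0"
        proof -
          obtain m where m: "l - l' = Suc m" using True by (metis Suc_diff_Suc)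
          then have "Suc m < k a i" using l by simp
          with step[of m 0] l show ?thesis by (simp add: m)
        qed
        finally show ?thesis .
      next
        case False
        then have "u l l' = u 0 (l' - l)"
          using diag[of 0 l "l' - l"] l by simp
        also have "\<dots> = 0"
        proof (cases "k b j \<le> l' - l + k a i")
          case True
          have "(a, i, 0) \<in> labels" "(b, j, l' - l) \<in> labels" using t by auto
          note free_entries_iff[OF this, of lam lam']
          then show ?thesis unfolding u_def using free True \<open>lam a = lam' b\<close> by blast
        next
          case far: False
          then have "u 0 (l' - l) = u (k a i - 1) (l' - l + (k a i - 1))"
            using diag[of 0 "k a i - 1" "l' - l"] l by simp
          also have "\<dots> = 0"
            using step[of "k a i - 1" "l' - l + k a i"] far l by (auto simp: split: if_splits)
          finally show ?thesis .
        qed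
        finally show ?thesis .
      qed
    qed
    then show ?thesis by (simp add: u_def)
  qed
  note zero = this
  have "X $ x $ y = 0" for x y
  proof -
    obtain a i l where x: "label x = (a, i, l)" by (metis prod_cases3)
    obtain b j l' where y: "label y = (b, j, l')" by (metis prod_cases3)
    have xy: "index (a, i, l) = x" "index (b, j, l') = y"
      using x y index_label by metis+
    have "(a, i, l) \<in> labels" "(b, j, l') \<in> labels"
      using label_in[OF x] label_in[OF y] by auto
    then have "X $ index (a, i, l) $ index (b, j, l') = 0" by (rule zero)
    then show ?thesis unfolding xy .
  qed
  then show ?thesis by (simp add: Finite_Cartesian_Product.vec_eq_iff)
qed

text \<open>The first row of each block is continued along the diagonals, with zeros below the main
  diagonal and in blocks with different eigenvalues.\<close>

lemma intertwiner_exists: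
  assumes Y: "Y \<in> coord_subspace (free_entries lam lam')"
  shows "\<exists>X\<in>intertwiners (jordan lam) (jordan lam').
    \<forall>x y. (x, y) \<in> free_entries lam lam' \<longrightarrow> X $ x $ y = Y $ x $ y"
proof -
  define w where "w a i l b j l' = (if lam a = lam' b \<and> l \<le> l'
    then Y $ index (a, i, 0) $ index (b, j, l' - l) else 0)" for a i l b j l'
  define X where "X = (\<chi> x y. case label x of (a, i, l) \<Rightarrow> case label y of (b, j, l') \<Rightarrow> w a i l b j l')"
  have X: "X $ index (a, i, l) $ index (b, j, l') = w a i l b j l'"
    if "(a, i, l) \<in> labels" "(b, j, l') \<in> labels" for a i l b j l'
    unfolding X_def by (simp add: label_index[OF that(1)] label_index[OF that(2)])
  have "X \<in> intertwiners (jordan lam) (jordan lam')"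
    unfolding in_intertwiners_jordan_iff
  proof (intro allI impI)
    fix a i l b j l'
    assume t: "(a, i, l) \<in> labels" "(b, j, l') \<in> labels"
    \<comment> \<open>In the last row the intertwining equation has no term from the row below. The
      entry to its left must therefore vanish; its diagonal starts at an entry that is not free,
      where \<open>Y\<close> is 0.\<close>
    have zero: "w a i l b j (l' - 1) = 0" if "\<not> Suc l < k a i" "l' > 0" "lam a = lam' b"
    proof (cases "l \<le> l' - 1")
      case True
      have "(index (a, i, 0), index (b, j, l' - 1 - l)) \<notin> free_entries lam lam'"
      proof -
        have "(a, i, 0) \<in> labels" "(b, j, l' - 1 - l) \<in> labels" using t by auto
        note free_entries_iff[OF this, of lam lam']
        moreover have "\<not> k b j \<le> l' - 1 - l + k a i" using t that True by auto
        ultimately show ?thesis by blast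
      qed
      then show ?thesis using Y by (simp add: w_def coord_subspace_def)
    qed (simp add: w_def)
    have 1: "(if Suc l < k a i then X $ index (a, i, Suc l) $ index (b, j, l') else 0) =
        (if Suc l < k a i then w a i (Suc l) b j l' else 0)"
      using X[of a i "Suc l" b j l'] t by auto
    have 2: "(if l' > 0 then X $ index (a, i, l) $ index (b, j, l' - 1) else 0) =
        (if l' > 0 then w a i l b j (l' - 1) else 0)"
      using X[of a i l b j "l' - 1"] t by auto
    show "lam a * X $ index (a, i, l) $ index (b, j, l') +
        (if Suc l < k a i then X $ index (a, i, Suc l) $ index (b, j, l') else 0) =
      lam' b * X $ index (a, i, l) $ index (b, j, l') +
        (if l' > 0 then X $ index (a, i, l) $ index (b, j, l' - 1) else 0)"
    proof (cases "lam a = lam' b")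
      case True
      have "(if Suc l < k a i then w a i (Suc l) b j l' else 0) = (if l' > 0 then w a i l b j (l' - 1) else 0)"
        using zero True by (auto simp: w_def)
      then show ?thesis unfolding 1 2 using True by simp
    next
      case False
      then show ?thesis unfolding 1 2 X[OF t] by (simp add: w_def)
    qed
  qed
  moreover have "X $ x $ y = Y $ x $ y" if "(x, y) \<in> free_entries lam lam'" for x y
  proof -
    from that obtain a i b j l' where *: "x = index (a, i, 0)" "y = index (b, j, l')"
      "(a, i, 0) \<in> labels" "(b, j, l') \<in> labels" "lam a = lam' b" "k b j \<le> l' + k a i"
      unfolding free_entries_def by blast
    show ?thesis unfolding * X[OF *(3,4)] using * by (simp add: w_def)
  qed
  ultimately show ?thesis by blast
qed

text \<open>For a pair of blocks the free columns form the interval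
  \<open>{k b j - k a i..<k b j}\<close>. With truncated subtraction its length is
  \<open>min (k a i) (k b j)\<close>.\<close>

lemma card_free_entries:
  "card (free_entries lam lam') = (\<Sum>a = 1..p. \<Sum>b = 1..p. if lam a = lam' b then overlap a b else 0)"
proof -
  define T where "T = (SIGMA a:{1..p}. SIGMA b:{1..p}. SIGMA i:{1..N a}. SIGMA j:{1..N b}.
    (if lam a = lam' b then {k b j - k a i..<k b j} else ({} :: nat set)))"
  define T' where "T' = {t \<in> T. case t of (a, b, i, j, l') \<Rightarrow> 0 < k a i}"
  define f where "f = (\<lambda>(a, b, i, j, l'). (index (a, i, 0), index (b, j, l')))"
  \<comment> \<open>The condition makes \<open>(a, i, 0)\<close> a label. On \<open>T\<close> it is
    automatic, because the interval for \<open>k a i = 0\<close> is empty.\<close>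
  have T': "T' = T"
    by (auto simp: T'_def T_def split: if_splits)
  have "free_entries lam lam' = f ` T'"
  proof (intro Set.equalityI subsetI)
    fix z assume "z \<in> free_entries lam lam'"
    then obtain a i b j l' where *: "z = (index (a, i, 0), index (b, j, l'))"
      "(a, i, 0) \<in> labels" "(b, j, l') \<in> labels" "lam a = lam' b" "k b j \<le> l' + k a i"
      unfolding free_entries_def by blast
    then have "(a, b, i, j, l') \<in> T'" by (simp add: T'_def T_def le_diff_conv)
    then show "z \<in> f ` T'" unfolding *(1) f_def by force
  next
    fix z assume "z \<in> f ` T'"
    then obtain a b i j l' where *: "(a, b, i, j, l') \<in> T'" "z = (index (a, i, 0), index (b, j, l'))"
      by (auto simp: f_def)
    then have "(a, i, 0) \<in> labels" "(b, j, l') \<in> labels" "lam a = lam' b" "k b j \<le> l' + k a i"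
      by (auto simp: T'_def T_def split: if_splits)
    then show "z \<in> free_entries lam lam'" unfolding *(2) free_entries_def by blast
  qed
  moreover have "inj_on f T'"
  proof (rule inj_onI)
    fix z z' assume zT: "z \<in> T'" "z' \<in> T'" and fz: "f z = f z'"
    obtain a b i j l' where z: "z = (a, b, i, j, l')" by (metis prod_cases5)
    obtain a' b' i' j' m where z': "z' = (a', b', i', j', m)" by (metis prod_cases5)
    have t: "(a, b, i, j, l') \<in> T'" "(a', b', i', j', m) \<in> T'" using zT z z' by simp_all
    have eq: "f (a, b, i, j, l') = f (a', b', i', j', m)" using fz z z' by simp
    have "(a, i, 0) \<in> labels" "(b, j, l') \<in> labels" "(a', i', 0) \<in> labels" "(b', j', m) \<in> labels"
      using t by (auto simp: T'_def T_def split: if_splits)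
    then show "z = z'" unfolding z z'
      using eq index_eq_iff[of "(a, i, 0)" "(a', i', 0)"] index_eq_iff[of "(b, j, l')" "(b', j', m)"]
      by (simp only: f_def split_conv prod.inject simp_thms)
  qed
  ultimately have "card (free_entries lam lam') = card T"
    by (simp add: card_image T')
  also have "\<dots> = (\<Sum>a = 1..p. \<Sum>b = 1..p. \<Sum>i = 1..N a. \<Sum>j = 1..N b.
      card (if lam a = lam' b then {k b j - k a i..<k b j} else {}))"
    unfolding T_def by (simp add: card_SigmaI)
  also have "\<dots> = (\<Sum>a = 1..p. \<Sum>b = 1..p. if lam a = lam' b then overlap a b else 0)"
    unfolding overlap_def
    by (intro sum.cong refl) (auto intro!: sum.cong)
  finally show ?thesis .
qed

text \<open>Restriction to the free entries is an isomorphism onto a coordinate subspace. Its real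
  dimension is twice the number of these entries.\<close>

lemma dim_intertwiners_jordan:
  "dim (intertwiners (jordan lam) (jordan lam')) =
    2 * (\<Sum>a = 1..p. \<Sum>b = 1..p. if lam a = lam' b then overlap a b else 0)"
proof -
  define f where "f X = (\<chi> x y. if (x, y) \<in> free_entries lam lam' then X $ x $ y else 0)"
    for X :: "complex^'n^'n"
  have lin: "linear f"
    by (simp add: linear_iff f_def Finite_Cartesian_Product.vec_eq_iff)
  have sub: "subspace (intertwiners (jordan lam) (jordan lam'))"
    by (rule subspace_intertwiners)
  have f: "f X $ x $ y = (if (x, y) \<in> free_entries lam lam' then X $ x $ y else 0)" for X x y
    by (simp add: f_def)
  have "inj_on f (intertwiners (jordan lam) (jordan lam'))"
  proof (subst linear_injective_on_subspace_0[OF lin sub], intro ballI impI)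
    fix X assume X: "X \<in> intertwiners (jordan lam) (jordan lam')" "f X = 0"
    have "X $ x $ y = 0" if "(x, y) \<in> free_entries lam lam'" for x y
      using f[of X x y] that X(2) by simp
    then show "X = 0" using intertwiner_determined[OF X(1)] by blast
  qed
  then have "inj_on f (span (intertwiners (jordan lam) (jordan lam')))"
    by (simp only: span_eq_iff[THEN iffD2, OF sub])
  then have "dim (intertwiners (jordan lam) (jordan lam')) = dim (f ` intertwiners (jordan lam) (jordan lam'))"
    using dim_image_eq[OF lin] by metis
  also have "f ` intertwiners (jordan lam) (jordan lam') = coord_subspace (free_entries lam lam')"
  proof
    show "f ` intertwiners (jordan lam) (jordan lam') \<subseteq> coord_subspace (free_entries lam lam')"
      by (auto simp: coord_subspace_def f_def)
    show "coord_subspace (free_entries lam lam') \<subseteq> f ` intertwiners (jordan lam) (jordan lam')"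
    proof
      fix Y assume Y: "Y \<in> coord_subspace (free_entries lam lam')"
      from intertwiner_exists[OF this] obtain X where X: "X \<in> intertwiners (jordan lam) (jordan lam')"
        "\<forall>x y. (x, y) \<in> free_entries lam lam' \<longrightarrow> X $ x $ y = Y $ x $ y" by blast
      have "Y = f X"
        using X(2) Y by (simp add: Finite_Cartesian_Product.vec_eq_iff f coord_subspace_def)
      then show "Y \<in> f ` intertwiners (jordan lam) (jordan lam')" using X(1) by blast
    qed
  qed
  finally show ?thesis by (simp add: dim_coord_subspace card_free_entries)
qed

end

section \<open>Semicontinuity of the space of intertwiners\<close>

lemma kernel_perturbation:
  fixes L g :: "'a::euclidean_space \<Rightarrow> 'a"
  assumes L: "linear L" and g: "linear g" and LgL: "\<And>x. L (g (L x)) = L x"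
  obtains e K where "e > 0" "K > 0"
    "\<And>L' x. linear L' \<Longrightarrow> (\<And>x. norm (L' x - L x) \<le> e * norm x) \<Longrightarrow> x \<in> g ` range L \<Longrightarrow>
      norm x \<le> K * norm (L' x)"
    "\<And>L'. linear L' \<Longrightarrow> (\<And>x. norm (L' x - L x) \<le> e * norm x) \<Longrightarrow>
      dim {x. L' x = 0} \<le> dim {x. L x = 0}"
    "\<And>L' y. linear L' \<Longrightarrow> (\<And>x. norm (L' x - L x) \<le> e * norm x) \<Longrightarrow>
      dim {x. L x = 0} \<le> dim {x. L' x = 0} \<Longrightarrow> \<exists>x. L' (y + x) = 0 \<and> x \<in> g ` range L"
proof -
  define C where "C = g ` range L"
  obtain K where K: "K > 0" "\<And>x. norm (g x) \<le> norm x * K"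
    using bounded_linear.pos_bounded[OF g[unfolded linear_conv_bounded_linear]] by blast
  have gL: "g (L x) = x" if "x \<in> C" for x using that LgL by (auto simp: C_def)
  have subC: "subspace C" unfolding C_def
    using L g by (intro linear_subspace_image) auto
  \<comment> \<open>With the tolerance \<open>1 / (2 * K)\<close> the perturbation contributes at
    most half of \<open>norm x\<close>, which is absorbed on the left; this costs the factor
    2.\<close>
  have est: "norm x \<le> 2 * K * norm (L' x)"
    if "\<And>x. norm (L' x - L x) \<le> 1 / (2 * K) * norm x" "x \<in> C" for L' x
  proof -
    have "norm x = norm (g (L x))" using gL that by simp
    also have "\<dots> \<le> norm (L x) * K" by (rule K)
    also have "\<dots> \<le> (norm (L' x) + norm (L' x - L x)) * K"
      using K(1) norm_triangle_ineq4[of "L' x" "L' x - L x"] by (intro mult_right_mono) auto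
    also have "\<dots> \<le> (norm (L' x) + 1 / (2 * K) * norm x) * K"
      using K(1) that(1)[of x] by (intro mult_right_mono) auto
    also have "\<dots> = norm (L' x) * K + norm x / 2" using K(1) by (simp add: field_simps)
    finally show ?thesis by (simp add: algebra_simps)
  qed
  have sums: "dim {x + y |x y. x \<in> {x. L' x = 0} \<and> y \<in> C} = dim {x. L' x = 0} + dim C"
    and sub: "subspace {x + y |x y. x \<in> {x. L' x = 0} \<and> y \<in> C}"
    if "linear L'" "\<And>x. norm (L' x - L x) \<le> 1 / (2 * K) * norm x" for L'
  proof -
    have s: "subspace {x. L' x = 0}" using that(1) by (rule linear_subspace_kernel)
    have "x = 0" if "x \<in> {x. L' x = 0} \<inter> C" for x
      using est[of L' x] that \<open>\<And>x. norm (L' x - L x) \<le> 1 / (2 * K) * norm x\<close> by simp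
    then have "{x. L' x = 0} \<inter> C \<subseteq> {0}" by blast
    then have "dim ({x. L' x = 0} \<inter> C) = 0" by (simp only: dim_eq_0)
    then show "dim {x + y |x y. x \<in> {x. L' x = 0} \<and> y \<in> C} = dim {x. L' x = 0} + dim C"
      using dim_sums_Int[OF s subC] by linarith
    show "subspace {x + y |x y. x \<in> {x. L' x = 0} \<and> y \<in> C}"
      using subspace_sums[OF s subC] .
  qed
  have "dim {x + y |x y. x \<in> {x. L x = 0} \<and> y \<in> C} = DIM('a)"
  proof -
    have "z \<in> {x + y |x y. x \<in> {x. L x = 0} \<and> y \<in> C}" for z
    proof -
      have "L (z - g (L z)) = 0" using linear_diff[OF L, of z "g (L z)"] LgL[of z] by simp
      moreover have "z = (z - g (L z)) + g (L z)" by simp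
      ultimately show ?thesis unfolding C_def by blast
    qed
    then have "{x + y |x y. x \<in> {x. L x = 0} \<and> y \<in> C} = UNIV" by blast
    then show ?thesis by simp
  qed
  then have dimC: "dim {x. L x = 0} + dim C = DIM('a)" using sums[OF L] K(1) by simp
  show thesis
  proof (rule that[of "1 / (2 * K)" "2 * K"])
    show "1 / (2 * K) > 0" "2 * K > 0" using K(1) by auto
    show "norm x \<le> 2 * K * norm (L' x)"
      if "linear L'" "\<And>x. norm (L' x - L x) \<le> 1 / (2 * K) * norm x" "x \<in> g ` range L" for L' x
      using est that by (simp add: C_def)
    show "dim {x. L' x = 0} \<le> dim {x. L x = 0}"
      if "linear L'" "\<And>x. norm (L' x - L x) \<le> 1 / (2 * K) * norm x" for L'
      using sums[OF that] dimC dim_subset_UNIV[of "{x + y |x y. x \<in> {x. L' x = 0} \<and> y \<in> C}"] by linarith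
    show "\<exists>x. L' (y + x) = 0 \<and> x \<in> g ` range L"
      if L': "linear L'" "\<And>x. norm (L' x - L x) \<le> 1 / (2 * K) * norm x"
        "dim {x. L x = 0} \<le> dim {x. L' x = 0}" for L' y
    proof -
      have "dim {x + y |x y. x \<in> {x. L' x = 0} \<and> y \<in> C} = DIM('a)"
        using sums[OF L'(1,2)] L'(3) dimC dim_subset_UNIV[of "{x + y |x y. x \<in> {x. L' x = 0} \<and> y \<in> C}"]
        by linarith
      then have "span {x + y |x y. x \<in> {x. L' x = 0} \<and> y \<in> C} = UNIV"
        by (rule dim_eq_full[THEN iffD1])
      moreover have "span {x + y |x y. x \<in> {x. L' x = 0} \<and> y \<in> C} = {x + y |x y. x \<in> {x. L' x = 0} \<and> y \<in> C}"
        by (rule span_eq_iff[THEN iffD2, OF sub[OF L'(1,2)]])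
      ultimately have "{x + y |x y. x \<in> {x. L' x = 0} \<and> y \<in> C} = UNIV" by (rule trans[OF sym, rotated])
      then have "y \<in> {x + y |x y. x \<in> {x. L' x = 0} \<and> y \<in> C}" by (simp only: UNIV_I)
      then obtain x z where "y = x + z" "L' x = 0" "z \<in> C" by blast
      then show ?thesis
        using subspace_neg[OF subC, of z] by (intro exI[of _ "- z"]) (simp add: C_def)
    qed
  qed
qed

text \<open>The perturbation lemma for X \<mapsto> X B - A X, where the vector to be moved into the
  kernel is the identity matrix. The perturbed map sends 1 to B' - A', so it sends the correction
  \<open>X\<close> to A' - B', and the lower bound on the complement controls
  \<open>X\<close>.\<close>

lemma intertwiner_perturbation:
  fixes A B :: "complex^'n^'n"
  assumes g: "clinear g" and LgL: "\<And>X. g (X ** B - A ** X) ** B - A ** g (X ** B - A ** X) = X ** B - A ** X"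
  obtains d K where "d > 0" "K > 0"
    "\<And>A' B'. norm (A' - A) < d \<Longrightarrow> norm (B' - B) < d \<Longrightarrow> dim (intertwiners A' B') \<le> dim (intertwiners A B)"
    "\<And>A' B'. norm (A' - A) < d \<Longrightarrow> norm (B' - B) < d \<Longrightarrow>
      dim (intertwiners A B) \<le> dim (intertwiners A' B') \<Longrightarrow>
      \<exists>X. X \<in> g ` range (\<lambda>X. X ** B - A ** X) \<and> Finite_Cartesian_Product.mat 1 + X \<in> intertwiners A' B' \<and>
        norm X \<le> K * norm (A' - B')"
proof -
  interpret bb: bounded_bilinear "(**) :: complex^'n^'n \<Rightarrow> complex^'n^'n \<Rightarrow> complex^'n^'n"
    by (rule bounded_bilinear_matrix_mult)
  obtain M where M: "M > 0" "\<And>(X::complex^'n^'n) (Y::complex^'n^'n). norm (X ** Y) \<le> norm X * norm Y * M"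
    using bb.pos_bounded by blast
  let ?L = "\<lambda>A B X. X ** B - A ** (X :: complex^'n^'n)"
  have lin: "linear (?L A B)" for A B :: "complex^'n^'n"
    by (rule clinear_imp_linear[OF clinear_commutator])
  show thesis
  proof (rule kernel_perturbation[OF lin[of B A] clinear_imp_linear[OF g], OF LgL])
    fix e K
    assume eK: "e > 0" "K > 0"
      "\<And>L' x. linear L' \<Longrightarrow> (\<And>x. norm (L' x - ?L A B x) \<le> e * norm x) \<Longrightarrow> x \<in> g ` range (?L A B) \<Longrightarrow>
        norm x \<le> K * norm (L' x)"
      "\<And>L'. linear L' \<Longrightarrow> (\<And>x. norm (L' x - ?L A B x) \<le> e * norm x) \<Longrightarrow>
        dim {x. L' x = 0} \<le> dim {x. ?L A B x = 0}"
      "\<And>L' y. linear L' \<Longrightarrow> (\<And>x. norm (L' x - ?L A B x) \<le> e * norm x) \<Longrightarrow>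
        dim {x. ?L A B x = 0} \<le> dim {x. L' x = 0} \<Longrightarrow> \<exists>x. L' (y + x) = 0 \<and> x \<in> g ` range (?L A B)"
    \<comment> \<open>The two maps differ by two products, each bounded by
      \<open>norm X * d * M\<close>.\<close>
    define d where "d = e / (2 * M)"
    have close: "norm (?L A' B' X - ?L A B X) \<le> e * norm X" if "norm (A' - A) < d" "norm (B' - B) < d" for A' B' X
    proof -
      have "?L A' B' X - ?L A B X = X ** (B' - B) - (A' - A) ** X"
        by (simp add: matrix_diff_ldistrib matrix_diff_rdistrib)
      then have "norm (?L A' B' X - ?L A B X) \<le> norm (X ** (B' - B)) + norm ((A' - A) ** X)"
        using norm_triangle_ineq4 by metis
      also have "\<dots> \<le> norm X * d * M + d * norm X * M"
        using that M(1) by (intro add_mono order_trans[OF M(2)] mult_right_mono mult_left_mono) auto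
      also have "\<dots> = e * norm X" using M(1) by (simp add: d_def field_simps)
      finally show ?thesis .
    qed
    show thesis
    proof (rule that[of d K])
      show "d > 0" "K > 0" using eK(1,2) M(1) by (auto simp: d_def)
      fix A' B' assume AB: "norm (A' - A) < d" "norm (B' - B) < d"
      show "dim (intertwiners A' B') \<le> dim (intertwiners A B)"
        using eK(4)[OF lin close[OF AB]] by (simp add: intertwiners_eq_kernel)
      assume "dim (intertwiners A B) \<le> dim (intertwiners A' B')"
      then have "\<exists>X. ?L A' B' (Finite_Cartesian_Product.mat 1 + X) = 0 \<and> X \<in> g ` range (?L A B)"
        using eK(5)[OF lin close[OF AB]] by (simp add: intertwiners_eq_kernel)
      then obtain X where X: "?L A' B' (Finite_Cartesian_Product.mat 1 + X) = 0" "X \<in> g ` range (?L A B)"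
        by blast
      have "?L A' B' (Finite_Cartesian_Product.mat 1 + X) = ?L A' B' X - (A' - B')"
        by (simp add: matrix_add_ldistrib matrix_add_rdistrib)
      then have "?L A' B' X = A' - B'" using X(1) by simp
      then have "norm X \<le> K * norm (A' - B')"
        using eK(3)[OF lin close[OF AB] X(2)] by simp
      then show "\<exists>X. X \<in> g ` range (\<lambda>X. X ** B - A ** X) \<and>
          Finite_Cartesian_Product.mat 1 + X \<in> intertwiners A' B' \<and> norm X \<le> K * norm (A' - B')"
        using X by (auto simp: intertwiners_eq_kernel)
    qed
  qed
qed

section \<open>Comparing block sizes\<close>

lemma downward_closed_eq_atLeastAtMost:
  fixes J :: "nat set"
  assumes "finite J" "0 \<notin> J" "\<And>i j. j \<in> J \<Longrightarrow> 1 \<le> i \<Longrightarrow> i \<le> j \<Longrightarrow> i \<in> J"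
  shows "J = {1..card J}"
proof (cases "J = {}")
  case False
  have "J = {1..Max J}"
  proof
    show "J \<subseteq> {1..Max J}"
      using assms(1,2) by (auto simp: Suc_le_eq intro!: gr0I)
    show "{1..Max J} \<subseteq> J"
      using assms(3)[OF Max_in[OF assms(1) False]] by auto
  qed
  then show ?thesis by (metis card_atLeastAtMost add_diff_cancel_right' Suc_eq_plus1)
qed simp

text \<open>The minimum is the value at the larger index, and exactly 2j - 1 pairs have larger index
  j. This is the origin of the weights in the dimension formula.\<close>

lemma sum_min_decreasing:
  fixes x :: "nat \<Rightarrow> nat"
  assumes "\<And>i j. 1 \<le> i \<Longrightarrow> i \<le> j \<Longrightarrow> j \<le> n \<Longrightarrow> x j \<le> x i"
  shows "(\<Sum>i = 1..n. \<Sum>j = 1..n. int (min (x i) (x j))) = (\<Sum>j = 1..n. (2 * int j - 1) * int (x j))"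
  using assms
proof (induction n)
  case (Suc n)
  have 1: "(\<Sum>i = 1..n. int (min (x i) (x (Suc n)))) = int n * int (x (Suc n))"
  proof -
    have "(\<Sum>i = 1..n. int (min (x i) (x (Suc n)))) = (\<Sum>i = 1..n. int (x (Suc n)))"
      using Suc.prems by (intro sum.cong) (auto simp: min_absorb2)
    then show ?thesis by simp
  qed
  have 2: "(\<Sum>i = 1..n. int (min (x (Suc n)) (x i))) = int n * int (x (Suc n))"
    using 1 by (simp add: min.commute)
  have IH: "(\<Sum>i = 1..n. \<Sum>j = 1..n. int (min (x i) (x j))) = (\<Sum>j = 1..n. (2 * int j - 1) * int (x j))"
    using Suc.prems by (intro Suc.IH) auto
  show ?case
    using 1 2 IH by (simp add: sum.distrib algebra_simps)
qed simp

locale jordan_shape = jordan_labelling p N k label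
  for p :: nat and N :: "nat \<Rightarrow> nat" and k :: "nat \<Rightarrow> nat \<Rightarrow> nat"
    and label :: "'n::finite \<Rightarrow> nat \<times> nat \<times> nat" +
  assumes N_pos: "\<And>a. a \<in> {1..p} \<Longrightarrow> N a \<ge> 1"
    and k_pos: "\<And>a j. a \<in> {1..p} \<Longrightarrow> j \<in> {1..N a} \<Longrightarrow> k a j \<ge> 1"
    and k_decr: "\<And>a i j. a \<in> {1..p} \<Longrightarrow> 1 \<le> i \<Longrightarrow> i \<le> j \<Longrightarrow> j \<le> N a \<Longrightarrow> k a j \<le> k a i"
begin

text \<open>This is the partition conjugate to the list of block sizes \<open>k a 1, \<dots>, k a (N a)\<close>.\<close>

definition conj_size :: "nat \<Rightarrow> nat \<Rightarrow> nat" where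
  "conj_size a s = card {j \<in> {1..N a}. s < k a j}"

text \<open>As the orders decrease, the blocks longer than \<open>s\<close> form an initial segment.
  Both sides say that the cell (j, s) belongs to the Young diagram, read by rows and by
  columns.\<close>

lemma less_k_iff:
  assumes "a \<in> {1..p}" "j \<in> {1..N a}"
  shows "s < k a j \<longleftrightarrow> j \<le> conj_size a s"
proof -
  have "{j \<in> {1..N a}. s < k a j} = {1..conj_size a s}"
    unfolding conj_size_def
    by (rule downward_closed_eq_atLeastAtMost) (use k_decr[OF assms(1)] in \<open>auto intro: less_le_trans\<close>)
  then have "j \<in> {j \<in> {1..N a}. s < k a j} \<longleftrightarrow> j \<in> {1..conj_size a s}" by (simp only:)
  then show ?thesis using assms(2) by simp
qed

lemma conj_size_0: "a \<in> {1..p} \<Longrightarrow> conj_size a 0 = N a"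
proof -
  assume a: "a \<in> {1..p}"
  have "{j \<in> {1..N a}. 0 < k a j} = {1..N a}" using k_pos[OF a] by (force simp: Suc_le_eq)
  then show ?thesis by (simp add: conj_size_def)
qed

lemma blocks_eq_if_conj_size_eq:
  assumes "a \<in> {1..p}" "b \<in> {1..p}" "\<And>s. conj_size a s = conj_size b s"
  shows "N a = N b" and "\<And>j. j \<in> {1..N a} \<Longrightarrow> k a j = k b j"
proof -
  show N: "N a = N b" using assms conj_size_0 by metis
  fix j assume "j \<in> {1..N a}"
  then have "s < k a j \<longleftrightarrow> s < k b j" for s
    using less_k_iff[OF assms(1), of j s] less_k_iff[OF assms(2), of j s] assms(3)[of s] N by simp
  then show "k a j = k b j" by (metis less_irrefl linorder_neqE_nat)
qed

text \<open>A minimum counts the numbers s below both arguments; summing over the blocks first turns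
  the overlap into an inner product of conjugate partitions.\<close>

lemma overlap_conj_size:
  assumes "a \<in> {1..p}" "b \<in> {1..p}" "\<And>a j. a \<in> {1..p} \<Longrightarrow> j \<in> {1..N a} \<Longrightarrow> k a j \<le> M"
  shows "overlap a b = (\<Sum>s<M. conj_size a s * conj_size b s)"
proof -
  have "overlap a b = (\<Sum>i = 1..N a. \<Sum>j = 1..N b. \<Sum>s<M. of_bool (s < k a i) * of_bool (s < k b j))"
    unfolding overlap_def
  proof (intro sum.cong refl)
    fix i j assume ij: "i \<in> {1..N a}" "j \<in> {1..N b}"
    have "(\<Sum>s<M. of_bool (s < k a i) * of_bool (s < k b j)) = (\<Sum>s<M. of_bool (s < min (k a i) (k b j)) :: nat)"
      by (intro sum.cong) auto
    also have "\<dots> = card ({..<M} \<inter> {s. s < min (k a i) (k b j)})"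
      by (simp add: sum_of_bool_eq)
    also have "{..<M} \<inter> {s. s < min (k a i) (k b j)} = {..<min (k a i) (k b j)}"
      using assms(3)[OF assms(1) ij(1)] by auto
    finally show "min (k a i) (k b j) = (\<Sum>s<M. of_bool (s < k a i) * of_bool (s < k b j))" by simp
  qed
  also have "\<dots> = (\<Sum>i = 1..N a. \<Sum>s<M. \<Sum>j = 1..N b. of_bool (s < k a i) * of_bool (s < k b j))"
    by (intro sum.cong refl sum.swap)
  also have "\<dots> = (\<Sum>s<M. \<Sum>i = 1..N a. \<Sum>j = 1..N b. of_bool (s < k a i) * of_bool (s < k b j))"
    by (rule sum.swap)
  also have "\<dots> = (\<Sum>s<M. conj_size a s * conj_size b s)"
  proof -
    have "conj_size a s = (\<Sum>i = 1..N a. of_bool (s < k a i))" for a s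
      by (simp add: conj_size_def sum_of_bool_eq Int_def)
    then show ?thesis by (simp only: sum_product)
  qed
  finally show ?thesis .
qed

text \<open>The equality case of the Cauchy-Schwarz inequality for the vectors of conjugate block sizes.\<close>

lemma blocks_permuted:
  assumes q: "bij_betw q {1..p} {1..p}"
    and le: "(\<Sum>a = 1..p. overlap a a) \<le> (\<Sum>a = 1..p. overlap a (q a))"
    and a: "a \<in> {1..p}"
  shows "conj_size a s = conj_size (q a) s"
proof -
  \<comment> \<open>Besides bounding all orders, \<open>M\<close> exceeds \<open>s\<close>, so that
    the term at \<open>s\<close> occurs in the sums over \<open>{..<M}\<close>.\<close>
  define M where "M = Suc (s + Max (insert 0 (\<Union>a\<in>{1..p}. k a ` {1..N a})))"
  have M: "k a j \<le> M" if "a \<in> {1..p}" "j \<in> {1..N a}" for a j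
  proof -
    have "k a j \<le> Max (insert 0 (\<Union>a\<in>{1..p}. k a ` {1..N a}))"
    proof (rule Max_ge)
      show "k a j \<in> insert 0 (\<Union>a\<in>{1..p}. k a ` {1..N a})" using that by blast
    qed simp
    then show ?thesis by (simp add: M_def)
  qed
  define v where "v a s = int (conj_size a s)" for a s
  have ov: "int (overlap a b) = (\<Sum>s<M. v a s * v b s)" if "a \<in> {1..p}" "b \<in> {1..p}" for a b
    using overlap_conj_size[OF that, of M] M by (simp add: v_def)
  have q': "q a \<in> {1..p}" if "a \<in> {1..p}" for a using q that by (auto simp: bij_betw_def)
  \<comment> \<open>Since \<open>q\<close> only rearranges the squared norms, the sum of squared
    distances is twice the gap between the two sides of \<open>le\<close>; the hypothesis forces it
    to be 0.\<close>
  have "(\<Sum>a = 1..p. \<Sum>s<M. (v a s - v (q a) s)\<^sup>2) =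
      (\<Sum>a = 1..p. int (overlap a a) + int (overlap (q a) (q a)) - 2 * int (overlap a (q a)))"
  proof (rule sum.cong[OF refl])
    fix a assume a: "a \<in> {1..p}"
    show "(\<Sum>s<M. (v a s - v (q a) s)\<^sup>2) = int (overlap a a) + int (overlap (q a) (q a)) - 2 * int (overlap a (q a))"
      unfolding ov[OF a a] ov[OF q'[OF a] q'[OF a]] ov[OF a q'[OF a]] sum_distrib_left
        sum.distrib[symmetric] sum_subtractf[symmetric]
      by (intro sum.cong refl) (simp add: power2_eq_square algebra_simps)
  qed
  also have "\<dots> = (\<Sum>a = 1..p. int (overlap a a)) + (\<Sum>a = 1..p. int (overlap (q a) (q a)))
      - 2 * (\<Sum>a = 1..p. int (overlap a (q a)))"
    by (simp add: sum.distrib sum_subtractf sum_distrib_left)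
  also have "(\<Sum>a = 1..p. int (overlap (q a) (q a))) = (\<Sum>a = 1..p. int (overlap a a))"
    by (rule sum.reindex_bij_betw[OF q, of "\<lambda>a. int (overlap a a)"])
  also have "(\<Sum>a = 1..p. int (overlap a a)) + (\<Sum>a = 1..p. int (overlap a a))
      - 2 * (\<Sum>a = 1..p. int (overlap a (q a))) \<le> 0"
    using le by (simp flip: of_nat_sum)
  finally have "(\<Sum>a = 1..p. \<Sum>s<M. (v a s - v (q a) s)\<^sup>2) \<le> 0" .
  then have "(\<Sum>a = 1..p. \<Sum>s<M. (v a s - v (q a) s)\<^sup>2) = 0"
    by (intro antisym sum_nonneg) auto
  then have "(\<Sum>s<M. (v a s - v (q a) s)\<^sup>2) = 0"
    using a by (subst (asm) sum_nonneg_eq_0_iff) (auto intro: sum_nonneg)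
  then have "(v a s - v (q a) s)\<^sup>2 = 0"
    by (subst (asm) sum_nonneg_eq_0_iff) (auto simp: M_def)
  then show ?thesis by (simp add: v_def)
qed

lemma overlap_self:
  "a \<in> {1..p} \<Longrightarrow> int (overlap a a) = (\<Sum>j = 1..N a. (2 * int j - 1) * int (k a j))"
  unfolding overlap_def using sum_min_decreasing[of "N a" "k a"] k_decr by simp

end

section \<open>Matrices of the same Jordan type\<close>

lemma norm_le_sum_entries: "norm (X :: complex^'n^'m) \<le> (\<Sum>x\<in>UNIV. \<Sum>y\<in>UNIV. norm (X $ x $ y))"
proof -
  have "norm X \<le> (\<Sum>x\<in>UNIV. norm (X $ x))"
    unfolding norm_vec_def[of X] by (rule L2_set_le_sum) simp
  also have "\<dots> \<le> (\<Sum>x\<in>UNIV. \<Sum>y\<in>UNIV. norm (X $ x $ y))"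
    by (intro sum_mono) (auto simp: norm_vec_def intro!: L2_set_le_sum)
  finally show ?thesis .
qed

lemma permuted_matrix_similar:
  fixes A B :: "complex^'n^'n" and f :: "'n \<Rightarrow> 'n"
  assumes f: "bij f" and AB: "\<And>x y. A $ x $ y = B $ f x $ f y"
  obtains P P' where "P ** P' = Finite_Cartesian_Product.mat 1" "P' ** P = Finite_Cartesian_Product.mat 1"
    "A = P ** B ** P'"
proof -
  define P :: "complex^'n^'n" where "P = (\<chi> x y. if y = f x then 1 else 0)"
  define P' :: "complex^'n^'n" where "P' = (\<chi> x y. if x = f y then 1 else 0)"
  have inj: "f x = f y \<longleftrightarrow> x = y" for x y using f by (auto simp: bij_def inj_eq)
  have "P ** P' = Finite_Cartesian_Product.mat 1"
    by (simp add: P_def P'_def matrix_matrix_mult_def Finite_Cartesian_Product.mat_def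
        Finite_Cartesian_Product.vec_eq_iff if_distrib[of "\<lambda>x. x * _"] inj cong: if_cong)
  moreover from this have "P' ** P = Finite_Cartesian_Product.mat 1"
    by (simp add: matrix_left_right_inverse)
  moreover have "(P ** B ** P') $ x $ y = A $ x $ y" for x y
  proof -
    have 1: "(P ** B) $ x $ z = B $ f x $ z" for z
      by (simp add: P_def matrix_matrix_mult_def if_distrib[of "\<lambda>x. x * _"] cong: if_cong)
    have "(P ** B ** P') $ x $ y = (\<Sum>z\<in>UNIV. (P ** B) $ x $ z * P' $ z $ y)"
      by (simp add: matrix_matrix_mult_def)
    also have "\<dots> = B $ f x $ f y"
      unfolding 1 by (simp add: P'_def if_distrib[of "\<lambda>x. _ * x"] cong: if_cong)
    finally show ?thesis by (simp add: AB)
  qed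
  ultimately show thesis
    by (intro that[of P P']) (simp_all add: Finite_Cartesian_Product.vec_eq_iff)
qed

lemma finite_inj_separated:
  fixes f :: "'a \<Rightarrow> 'b::metric_space"
  assumes "finite I" "inj_on f I"
  obtains s where "s > 0" "\<And>a b. a \<in> I \<Longrightarrow> b \<in> I \<Longrightarrow> a \<noteq> b \<Longrightarrow> s \<le> dist (f a) (f b)"
proof -
  \<comment> \<open>The element 1 keeps the minimum defined when there are no two distinct
    indices.\<close>
  define D where "D = insert 1 ((\<lambda>(a, b). dist (f a) (f b)) ` {(a, b) \<in> I \<times> I. a \<noteq> b})"
  have fin: "finite {(a, b) \<in> I \<times> I. a \<noteq> b}"
    by (rule finite_subset[of _ "I \<times> I"]) (use assms(1) in auto)
  then have "finite D" "D \<noteq> {}" by (auto simp: D_def)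
  then have "Min D > 0" using assms(2) by (auto simp: D_def inj_on_def)
  moreover have "Min D \<le> dist (f a) (f b)" if "a \<in> I" "b \<in> I" "a \<noteq> b" for a b
    using that \<open>finite D\<close> by (intro Min_le) (force simp: D_def)+
  ultimately show thesis using that by blast
qed

context jordan_shape
begin

text \<open>The form in which the set is studied: one fixed labelling of the positions, arbitrary
  distinct eigenvalues, arbitrary conjugation. For square matrices the one-sided inverse is
  two-sided.\<close>

definition jordan_class :: "(complex^'n^'n) set" where
  "jordan_class = {P ** jordan lam ** P' |P P' lam.
    P ** P' = Finite_Cartesian_Product.mat 1 \<and> inj_on lam {1..p}}"

lemma norm_jordan_diff:
  assumes "\<And>a. a \<in> {1..p} \<Longrightarrow> dist (lam a) (lam' a) \<le> e"
  shows "norm (jordan lam - jordan lam') \<le> real CARD('n) * (real CARD('n) * e)"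
proof -
  have "norm ((jordan lam - jordan lam') $ x $ y) \<le> e" for x y
  proof -
    obtain a i l where x: "label x = (a, i, l)" by (metis prod_cases3)
    obtain b j l' where y: "label y = (b, j, l')" by (metis prod_cases3)
    have "dist (lam a) (lam' a) \<le> e" using assms label_in[OF x] by simp
    moreover from this have "0 \<le> e" by (rule order_trans[OF zero_le_dist])
    ultimately show ?thesis by (auto simp: jordan_def x y dist_norm)
  qed
  then have entry: "\<And>x y. norm ((jordan lam - jordan lam') $ x $ y) \<le> e" .
  have "(\<Sum>x\<in>UNIV. \<Sum>y\<in>UNIV. norm ((jordan lam - jordan lam') $ x $ y)) \<le> (\<Sum>x\<in>(UNIV::'n set). \<Sum>y\<in>(UNIV::'n set). e)"
    by (rule sum_mono, rule sum_mono, rule entry)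
  then show ?thesis
    using norm_le_sum_entries[of "jordan lam - jordan lam'"] by simp
qed

lemma det_jordan:
  fixes P P' :: "complex^'n^'n"
  assumes "P ** P' = Finite_Cartesian_Product.mat 1"
  shows "Determinants.det (cscale z (Finite_Cartesian_Product.mat 1) - P ** jordan lam ** P') =
    (\<Prod>x\<in>UNIV. z - lam (fst (label x)))"
proof -
  let ?one = "Finite_Cartesian_Product.mat 1 :: complex^'n^'n"
  have "cscale z ?one - P ** jordan lam ** P' = P ** (cscale z ?one - jordan lam) ** P'"
    using assms by (simp add: matrix_diff_ldistrib matrix_diff_rdistrib cscale_matrix_mult)
  then have "Determinants.det (cscale z ?one - P ** jordan lam ** P') = Determinants.det (cscale z ?one - jordan lam)"
    using det_similar[OF assms] by simp
  \<comment> \<open>The rank of a position is its offset inside the block: an entry off the diagonal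
    leads from offset l to offset l + 1.\<close>
  also have "\<dots> = (\<Prod>x\<in>UNIV. (cscale z ?one - jordan lam) $ x $ x)"
  proof (rule det_triangular_rank[where r = "\<lambda>x. snd (snd (label x))"])
    fix x y assume nz: "(cscale z ?one - jordan lam) $ x $ y \<noteq> 0"
    obtain a i l where x: "label x = (a, i, l)" by (metis prod_cases3)
    obtain b j l' where y: "label y = (b, j, l')" by (metis prod_cases3)
    show "x = y \<or> snd (snd (label x)) < snd (snd (label y))"
      using nz by (auto simp: jordan_def x y Finite_Cartesian_Product.mat_def split: if_splits)
        (metis index_label x y)
  qed
  also have "\<dots> = (\<Prod>x\<in>UNIV. z - lam (fst (label x)))"
  proof (rule prod.cong[OF refl])
    fix x
    obtain a i l where x: "label x = (a, i, l)" by (metis prod_cases3)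
    show "(cscale z ?one - jordan lam) $ x $ x = z - lam (fst (label x))"
      by (simp add: jordan_def x Finite_Cartesian_Product.mat_def)
  qed
  finally show ?thesis .
qed

text \<open>The characteristic polynomial of the centre vanishes at \<open>lam a\<close>, so that of
  a nearby \<open>A\<close> is smaller there than \<open>e\<close> to the power of the size. It is a
  product of that many distances |lam a - mu b|, hence one of them is below \<open>e\<close>. The
  neighbourhood does not depend on how \<open>A\<close> is written in Jordan form.\<close>

lemma eigenvalues_close:
  fixes P P' :: "complex^'n^'n"
  assumes P: "P ** P' = Finite_Cartesian_Product.mat 1" and e: "e > 0"
  shows "\<forall>\<^sub>F A in nhds (P ** jordan lam ** P'). \<forall>(R::complex^'n^'n) (R'::complex^'n^'n) mu. R ** R' = Finite_Cartesian_Product.mat 1 \<longrightarrow>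
    A = R ** jordan mu ** R' \<longrightarrow> (\<forall>a\<in>{1..p}. \<exists>b\<in>{1..p}. dist (lam a) (mu b) < e)"
proof -
  let ?one = "Finite_Cartesian_Product.mat 1 :: complex^'n^'n"
  define F where "F a A = Determinants.det (cscale (lam a) ?one - A)" for a A
  have "\<forall>\<^sub>F A in nhds (P ** jordan lam ** P'). norm (F a A) < e ^ CARD('n)" if a: "a \<in> {1..p}" for a
  proof -
    have "(a, 1, 0) \<in> labels" using a N_pos[OF a] k_pos[OF a, of 1] by auto
    then have "label (index (a, 1, 0)) = (a, 1, 0)" by (rule label_index)
    then have "\<exists>x. lam a - lam (fst (label x)) = 0" by (intro exI[of _ "index (a, 1, 0)"]) simp
    then have "F a (P ** jordan lam ** P') = 0"
      unfolding F_def det_jordan[OF P] by simp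
    moreover have "continuous_on UNIV (F a)"
      unfolding F_def by (intro continuous_intros)
    ultimately have "(F a \<longlongrightarrow> 0) (nhds (P ** jordan lam ** P'))"
      by (metis continuous_on_eq_continuous_at isCont_def open_UNIV UNIV_I tendsto_nhds_iff)
    then show ?thesis
      using e by (auto dest!: tendstoD[where e = "e ^ CARD('n)"])
  qed
  then have "\<forall>\<^sub>F A in nhds (P ** jordan lam ** P'). \<forall>a\<in>{1..p}. norm (F a A) < e ^ CARD('n)"
    by (intro eventually_ball_finite) auto
  then show ?thesis
  proof (rule eventually_mono, intro allI impI ballI)
    fix A R R' mu a
    assume *: "\<forall>a\<in>{1..p}. norm (F a A) < e ^ CARD('n)" and R: "R ** R' = ?one"
      and A: "A = R ** jordan mu ** R'" and a: "a \<in> {1..p}"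
    have F: "norm (F a A) = (\<Prod>x\<in>UNIV. norm (lam a - mu (fst (label x))))"
      unfolding A F_def det_jordan[OF R] by (rule prod_norm[symmetric])
    show "\<exists>b\<in>{1..p}. dist (lam a) (mu b) < e"
    proof (rule ccontr)
      assume far: "\<not> (\<exists>b\<in>{1..p}. dist (lam a) (mu b) < e)"
      have "e \<le> norm (lam a - mu (fst (label x)))" for x
      proof -
        obtain b i l where x: "label x = (b, i, l)" by (metis prod_cases3)
        then show ?thesis using far label_in[OF x] by (force simp: dist_norm)
      qed
      then have "(\<Prod>x\<in>(UNIV::'n set). e) \<le> (\<Prod>x\<in>UNIV. norm (lam a - mu (fst (label x))))"
        using e by (intro prod_mono) auto
      then show False using * a F by force
    qed
  qed
qed

lemma overlap_commute: "overlap a b = overlap b a"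
  unfolding overlap_def by (subst sum.swap) (simp add: min.commute)

text \<open>As the eigenvalues are distinct, only the pairs with \<open>a = q b\<close> survive in
  the double sum.\<close>

lemma dim_intertwiners_permuted:
  assumes lam: "inj_on lam {1..p}" and q: "q permutes {1..p}"
  shows "dim (intertwiners (jordan lam) (jordan (lam \<circ> q))) = 2 * (\<Sum>b = 1..p. overlap b (q b))"
proof -
  have "(\<Sum>a = 1..p. \<Sum>b = 1..p. if lam a = (lam \<circ> q) b then overlap a b else 0) =
      (\<Sum>b = 1..p. \<Sum>a = 1..p. if lam a = lam (q b) then overlap a b else 0)"
    unfolding o_def by (rule sum.swap)
  also have "\<dots> = (\<Sum>b = 1..p. \<Sum>a = 1..p. if a = q b then overlap (q b) b else 0)"
  proof (intro sum.cong refl)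
    fix a b assume ab: "b \<in> {1..p}" "a \<in> {1..p}"
    have "q b \<in> {1..p}" using ab(1) permutes_in_image[OF q, of b] by blast
    then have "lam a = lam (q b) \<longleftrightarrow> a = q b" using inj_on_eq_iff[OF lam ab(2)] by blast
    then show "(if lam a = lam (q b) then overlap a b else 0) = (if a = q b then overlap (q b) b else 0)"
      by simp
  qed
  also have "\<dots> = (\<Sum>b = 1..p. overlap b (q b))"
  proof (rule sum.cong[OF refl])
    fix b assume "b \<in> {1..p}"
    then have "q b \<in> {1..p}" using permutes_in_image[OF q, of b] by blast
    then show "(\<Sum>a = 1..p. if a = q b then overlap (q b) b else 0) = overlap b (q b)"
      by (subst sum.delta) (simp_all add: overlap_commute)
  qed
  finally show ?thesis by (simp add: dim_intertwiners_jordan)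
qed

lemma dim_intertwiners_self:
  assumes "inj_on lam {1..p}"
  shows "dim (intertwiners (jordan lam) (jordan lam)) = 2 * (\<Sum>a = 1..p. overlap a a)"
  using dim_intertwiners_permuted[OF assms permutes_id] by simp

text \<open>Equal conjugate partitions mean equal blocks, so (a, i, l) \<mapsto> (q a, i, l)
  permutes the labels, and the two matrices differ by a permutation of the positions.\<close>

lemma jordan_permuted_similar:
  assumes q: "q permutes {1..p}" and sizes: "\<And>a s. a \<in> {1..p} \<Longrightarrow> conj_size a s = conj_size (q a) s"
  obtains P P' :: "complex^'n^'n" where "P ** P' = Finite_Cartesian_Product.mat 1" "jordan lam = P ** jordan (lam \<circ> q) ** P'"
proof -
  define f where "f x = index (case label x of (a, i, l) \<Rightarrow> (q a, i, l))" for x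
  have qa: "q a \<in> {1..p}" if "a \<in> {1..p}" for a using permutes_in_image[OF q, of a] that by blast
  have f: "label (f x) = (q a, i, l)" if x: "label x = (a, i, l)" for x a i l
  proof -
    have a: "a \<in> {1..p}" "i \<in> {1..N a}" "l < k a i" using label_in[OF x] by auto
    have "(q a, i, l) \<in> labels"
      using a qa[OF a(1)] blocks_eq_if_conj_size_eq[OF a(1) qa[OF a(1)] sizes[OF a(1)]] by auto
    then show ?thesis by (simp add: f_def x label_index)
  qed
  have "inj f"
  proof (rule injI)
    fix x y assume xy: "f x = f y"
    obtain a i l where x: "label x = (a, i, l)" by (metis prod_cases3)
    obtain b j l' where y: "label y = (b, j, l')" by (metis prod_cases3)
    have "(q a, i, l) = (q b, j, l')" using f[OF x] f[OF y] xy by simp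
    then have "label x = label y" using permutes_inj[OF q] x y by (simp add: inj_eq)
    then show "x = y" using index_label by metis
  qed
  then have bij: "bij f" by (simp add: finite_UNIV_inj_surj bij_def)
  have "jordan (lam \<circ> q) $ x $ y = jordan lam $ f x $ f y" for x y
  proof -
    obtain a i l where x: "label x = (a, i, l)" by (metis prod_cases3)
    obtain b j l' where y: "label y = (b, j, l')" by (metis prod_cases3)
    show ?thesis using permutes_inj[OF q] by (simp add: jordan_def x y f[OF x] f[OF y] inj_eq)
  qed
  then obtain P P' where *: "P ** P' = Finite_Cartesian_Product.mat 1" "P' ** P = Finite_Cartesian_Product.mat 1"
    "jordan (lam \<circ> q) = P ** jordan lam ** P'"
    using permuted_matrix_similar[OF bij] by metis
  have "P' ** jordan (lam \<circ> q) ** P = P' ** P ** jordan lam ** (P' ** P)"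
    unfolding *(3) by (simp only: matrix_mul_assoc)
  then have "jordan lam = P' ** jordan (lam \<circ> q) ** P" by (simp add: *(2))
  then show thesis using that *(2) by blast
qed

text \<open>A nearby point has its eigenvalue close to \<open>lam a\<close> at some label
  \<open>r a\<close>, a priori with the blocks of that label. Semicontinuity is therefore applied at
  \<open>?A\<close> and the Jordan matrix with permuted eigenvalues \<open>lam \<circ> q'\<close>;
  the equality case then shows that \<open>q\<close> preserves block sizes, and relabelling by
  \<open>q\<close> puts the eigenvalues into the order of \<open>lam\<close>.\<close>

lemma nearby_same_type:
  fixes P P' :: "complex^'n^'n"
  assumes P: "P ** P' = Finite_Cartesian_Product.mat 1" and lam: "inj_on lam {1..p}" and e: "e > 0"
  obtains d where "d > 0" "\<And>A. A \<in> jordan_class \<Longrightarrow> norm (A - P ** jordan lam ** P') < d \<Longrightarrow>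
    \<exists>(R::complex^'n^'n) (R'::complex^'n^'n) mu. R ** R' = Finite_Cartesian_Product.mat 1 \<and> A = R ** jordan mu ** R' \<and>
      (\<forall>a\<in>{1..p}. dist (mu a) (lam a) < e)"
proof -
  let ?one = "Finite_Cartesian_Product.mat 1 :: complex^'n^'n"
  let ?A = "P ** jordan lam ** P'"
  have P2: "P' ** P = ?one" using P by (simp add: matrix_left_right_inverse)
  define Q where "Q = {q. q permutes {1..p}}"
  have finQ: "finite Q" by (simp add: Q_def finite_permutations)
  define near where "near q d \<longleftrightarrow> d > 0 \<and> (\<forall>A' B'. norm (A' - ?A) < d \<longrightarrow> norm (B' - jordan (lam \<circ> q)) < d \<longrightarrow>
      dim (intertwiners A' B') \<le> dim (intertwiners ?A (jordan (lam \<circ> q))))" for q d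
  have "\<exists>d. near q d" for q
  proof (rule generalized_inverse[OF clinear_commutator[where A = ?A and B = "jordan (lam \<circ> q)"]])
    fix g :: "complex^'n^'n \<Rightarrow> complex^'n^'n"
    assume g: "clinear g" "\<And>X. g (X ** jordan (lam \<circ> q) - ?A ** X) ** jordan (lam \<circ> q) -
      ?A ** g (X ** jordan (lam \<circ> q) - ?A ** X) = X ** jordan (lam \<circ> q) - ?A ** X"
    show ?thesis
    proof (rule intertwiner_perturbation[OF g])
      fix d K :: real
      assume "d > 0" "\<And>A' B'. norm (A' - ?A) < d \<Longrightarrow> norm (B' - jordan (lam \<circ> q)) < d \<Longrightarrow>
        dim (intertwiners A' B') \<le> dim (intertwiners ?A (jordan (lam \<circ> q)))"
      then show ?thesis unfolding near_def by blast
    qed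
  qed
  then obtain D where "\<And>q. near q (D q)" by metis
  then have D: "\<And>q. D q > 0" "\<And>q A' B'. norm (A' - ?A) < D q \<Longrightarrow>
      norm (B' - jordan (lam \<circ> q)) < D q \<Longrightarrow>
      dim (intertwiners A' B') \<le> dim (intertwiners ?A (jordan (lam \<circ> q)))"
    unfolding near_def by blast+
  \<comment> \<open>The permutation depends on the nearby point, so the radius has to serve all of
    the finitely many permutations; the 1 is only an upper cap.\<close>
  define d1 where "d1 = Min (insert 1 (D ` Q))"
  have d1: "d1 > 0" "\<And>q. q \<in> Q \<Longrightarrow> d1 \<le> D q"
    using finQ D(1) by (auto simp: d1_def)
  obtain s where s: "s > 0" "\<And>a b. a \<in> {1..p} \<Longrightarrow> b \<in> {1..p} \<Longrightarrow> a \<noteq> b \<Longrightarrow> s \<le> dist (lam a) (lam b)"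
    using finite_inj_separated[OF _ lam] by blast
  define c where "c = real CARD('n) * real CARD('n)"
  have c: "c > 0" by (simp add: c_def)
  \<comment> \<open>\<open>e\<close> is the accuracy demanded, \<open>s / 2\<close> keeps one
    eigenvalue from being close to two of the \<open>lam a\<close>, and \<open>d1 / (2 * c)\<close>
    brings \<open>jordan mu\<close> within the semicontinuity radius.\<close>
  define e1 where "e1 = Min {e, s / 2, d1 / (2 * c)}"
  have e1: "e1 > 0" "e1 \<le> e" "e1 \<le> s / 2" "e1 \<le> d1 / (2 * c)"
    using e s(1) d1(1) c by (auto simp: e1_def)
  obtain d2 where d2: "d2 > 0" "\<And>A (R::complex^'n^'n) (R'::complex^'n^'n) mu a. norm (A - ?A) < d2 \<Longrightarrow> R ** R' = ?one \<Longrightarrow>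
      A = R ** jordan mu ** R' \<Longrightarrow> a \<in> {1..p} \<Longrightarrow> \<exists>b\<in>{1..p}. dist (lam a) (mu b) < e1"
  proof -
    from eigenvalues_close[OF P e1(1), of lam, unfolded eventually_nhds_metric] obtain d where "d > 0"
      and d: "\<forall>A. dist A ?A < d \<longrightarrow> (\<forall>(R::complex^'n^'n) (R'::complex^'n^'n) mu. R ** R' = ?one \<longrightarrow>
        A = R ** jordan mu ** R' \<longrightarrow> (\<forall>a\<in>{1..p}. \<exists>b\<in>{1..p}. dist (lam a) (mu b) < e1))"
      by (elim exE conjE)
    show thesis
      by (rule that[OF \<open>d > 0\<close>]) (use d in \<open>simp add: dist_norm del: atLeastAtMost_iff\<close>)
  qed
  show thesis
  proof (rule that[of "min d1 d2"])
    show "min d1 d2 > 0" using d1(1) d2(1) by simp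
    fix A assume A: "A \<in> jordan_class" "norm (A - ?A) < min d1 d2"
    then obtain R R' mu where R: "R ** R' = ?one" and mu: "inj_on mu {1..p}" and AR: "A = R ** jordan mu ** R'"
      unfolding jordan_class_def by blast
    have R2: "R' ** R = ?one" using R by (simp add: matrix_left_right_inverse)
    have "\<forall>a\<in>{1..p}. \<exists>b\<in>{1..p}. dist (lam a) (mu b) < e1"
      using d2(2)[OF _ R AR] A(2) by simp
    then obtain r where r: "\<And>a. a \<in> {1..p} \<Longrightarrow> r a \<in> {1..p} \<and> dist (lam a) (mu (r a)) < e1"
      by metis
    have inj: "inj_on r {1..p}"
    proof (rule inj_onI, rule ccontr)
      fix a b assume ab: "a \<in> {1..p}" "b \<in> {1..p}" "r a = r b" "a \<noteq> b"
      have "dist (lam a) (lam b) < e1 + e1"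
        using r[OF ab(1)] r[OF ab(2)] ab(3) dist_triangle2[of "lam a" "lam b" "mu (r a)"] by simp
      then show False using s(2)[OF ab(1,2,4)] e1(3) by simp
    qed
    \<comment> \<open>The extension by the identity outside the labels is what
      \<open>permutes\<close> requires.\<close>
    define q where "q a = (if a \<in> {1..p} then r a else a)" for a
    have "bij_betw r {1..p} {1..p}"
      using inj r by (intro bij_betw_imageI endo_inj_surj) auto
    moreover have "bij_betw q {1..p} {1..p} = bij_betw r {1..p} {1..p}"
      by (rule bij_betw_cong) (simp add: q_def)
    ultimately have "bij_betw q {1..p} {1..p}" by simp
    then have q: "q permutes {1..p}"
      by (rule bij_imp_permutes) (simp only: q_def if_False)
    define q' where "q' = inv_into UNIV q"
    have q': "q' permutes {1..p}" "q' \<in> Q" using permutes_inv[OF q] by (auto simp: q'_def Q_def)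
    have qq': "q (q' b) = b" for b using permutes_inverses(1)[OF q] by (simp add: q'_def)
    have close: "dist (mu b) ((lam \<circ> q') b) \<le> e1" if "b \<in> {1..p}" for b
    proof -
      have "q' b \<in> {1..p}" using that permutes_in_image[OF q'(1)] by simp
      then show ?thesis using r[of "q' b"] qq'[of b] by (auto simp: q_def dist_commute split: if_splits)
    qed
    have "norm (jordan mu - jordan (lam \<circ> q')) \<le> c * e1"
      using norm_jordan_diff[of mu "lam \<circ> q'" e1, OF close] by (simp only: c_def mult.assoc)
    also have "\<dots> \<le> c * (d1 / (2 * c))" using e1(4) c by (intro mult_left_mono) auto
    also have "\<dots> < d1" using c d1(1) by simp
    finally have J: "norm (jordan mu - jordan (lam \<circ> q')) < D q'"
      using d1(2)[OF q'(2)] by simp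
    \<comment> \<open>\<open>A\<close> is similar to \<open>jordan mu\<close>, so the intertwiners
      of this pair have the full dimension of a centralizer; semicontinuity compares it with the
      pair at the centre, where label b is paired with \<open>q' b\<close>.\<close>
    have "2 * (\<Sum>a = 1..p. overlap a a) = dim (intertwiners (jordan mu) (jordan mu))"
      using dim_intertwiners_self[OF mu] by simp
    also have "\<dots> = dim (intertwiners A (jordan mu))"
      using dim_intertwiners_similar[OF R R2, of ?one ?one "jordan mu" "jordan mu"] by (simp add: AR)
    also have "\<dots> \<le> dim (intertwiners ?A (jordan (lam \<circ> q')))"
      using D(2)[of A q' "jordan mu"] J A(2) d1(2)[OF q'(2)] by simp
    also have "\<dots> = dim (intertwiners (jordan lam) (jordan (lam \<circ> q')))"
      using dim_intertwiners_similar[OF P P2, of ?one ?one "jordan lam" "jordan (lam \<circ> q')"] by simp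
    also have "\<dots> = 2 * (\<Sum>b = 1..p. overlap b (q' b))"
      by (rule dim_intertwiners_permuted[OF lam q'(1)])
    finally have "(\<Sum>a = 1..p. overlap a a) \<le> (\<Sum>b = 1..p. overlap b (q' b))" by simp
    note sizes = blocks_permuted[OF permutes_imp_bij[OF q'(1)] this]
    have "conj_size a t = conj_size (q a) t" if "a \<in> {1..p}" for a t
      using sizes[of "q a" t] that permutes_in_image[OF q, of a] permutes_inverses(2)[OF q] by (simp add: q'_def)
    then obtain T T' where T: "T ** T' = ?one" "jordan mu = T ** jordan (mu \<circ> q) ** T'"
      using jordan_permuted_similar[OF q] by metis
    have "(R ** T) ** (T' ** R') = ?one"
    proof -
      have "(R ** T) ** (T' ** R') = R ** (T ** T') ** R'" by (simp only: matrix_mul_assoc)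
      then show ?thesis by (simp add: T R)
    qed
    moreover have "A = (R ** T) ** jordan (mu \<circ> q) ** (T' ** R')"
      unfolding AR T(2) by (simp only: matrix_mul_assoc)
    moreover have "\<forall>a\<in>{1..p}. dist ((mu \<circ> q) a) (lam a) < e"
      using r e1(2) by (force simp: q_def dist_commute)
    ultimately show "\<exists>(R::complex^'n^'n) (R'::complex^'n^'n) mu. R ** R' = ?one \<and> A = R ** jordan mu ** R' \<and> (\<forall>a\<in>{1..p}. dist (mu a) (lam a) < e)"
      by blast
  qed
qed

end

section \<open>A chart around a matrix of the given Jordan type\<close>

lemma clinear_has_derivative: "clinear f \<Longrightarrow> (f has_derivative f) F"
  by (rule bounded_linear_imp_has_derivative[OF clinear_imp_bounded_linear])

lemma clinear_continuous_on: "clinear f \<Longrightarrow> continuous_on S f"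
  by (rule linear_continuous_on[OF clinear_imp_bounded_linear])

lemma clinear_inv_into:
  assumes f: "clinear f" and bij: "bij f"
  shows "clinear (inv_into UNIV f)"
proof -
  have fi: "f (inv_into UNIV f x) = x" for x
    using bij by (simp add: bij_is_surj surj_f_inv_f)
  have inj: "f x = f y \<longleftrightarrow> x = y" for x y
    using bij by (simp add: bij_is_inj inj_eq)
  have add: "f (x + y) = f x + f y" and scale: "f (cscale c x) = cscale c (f x)" for x y c
    using f by (auto simp: clinear_iff)
  show ?thesis
    unfolding clinear_iff
  proof (intro conjI allI)
    fix x y c
    have "f (inv_into UNIV f (x + y)) = f (inv_into UNIV f x + inv_into UNIV f y)"
      by (simp only: fi add)
    then show "inv_into UNIV f (x + y) = inv_into UNIV f x + inv_into UNIV f y" by (simp only: inj)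
    have "f (inv_into UNIV f (cscale c x)) = f (cscale c (inv_into UNIV f x))"
      by (simp only: fi scale)
    then show "inv_into UNIV f (cscale c x) = cscale c (inv_into UNIV f x)" by (simp only: inj)
  qed
qed

text \<open>
  \<open>W\<close> moves \<open>A\<close> by conjugation with \<open>1 + X W\<close>, by a change \<open>T W\<close> of the eigenvalues, and
  transversally by \<open>Z W\<close>.
\<close>

definition conjugation_chart ::
  "(complex^'n^'n \<Rightarrow> complex^'n^'n) \<Rightarrow> (complex^'n^'n \<Rightarrow> complex^'n^'n) \<Rightarrow>
    (complex^'n^'n \<Rightarrow> complex^'n^'n) \<Rightarrow> complex^'n^'n \<Rightarrow> complex^'n^'n \<Rightarrow> complex^'n^'n" where
  "conjugation_chart X T Z A W =
    (Finite_Cartesian_Product.mat 1 + X W) ** (A + T W) **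
      matrix_inv (Finite_Cartesian_Product.mat 1 + X W) + Z W"

text \<open>The hypothesis \<open>sum\<close> says that the derivative at 0 is the identity, so the
  inverse function theorem applies. The derivatives are complex-linear; the inverse map is
  holomorphic because its derivatives are inverses of such maps.\<close>

lemma conjugation_chart_local_inverse:
  fixes A :: "complex^'n^'n"
  assumes X: "clinear X" and T: "clinear T" and Z: "clinear Z"
    and sum: "\<And>W. X W ** A - A ** X W + T W + Z W = W"
    and r: "r > 0"
  obtains U V g where "open U" "0 \<in> U" "U \<subseteq> ball 0 r" "open V" "A \<in> V"
    "homeomorphism U V (conjugation_chart X T Z A) g"
    "mat_holomorphic_on (conjugation_chart X T Z A) U" "mat_holomorphic_on g V"
proof -
  let ?one = "Finite_Cartesian_Product.mat 1 :: complex^'n^'n"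
  interpret bb: bounded_bilinear "(**) :: complex^'n^'n \<Rightarrow> complex^'n^'n \<Rightarrow> complex^'n^'n"
    by (rule bounded_bilinear_matrix_mult)
  let ?G = "conjugation_chart X T Z A"
  let ?P = "\<lambda>W. ?one + X W"
  let ?Q = "\<lambda>W. matrix_inv (?one + X W)"
  define G' where "G' W H = X H ** (A + T W) ** ?Q W + ?P W ** T H ** ?Q W
    - ?P W ** (A + T W) ** (?Q W ** X H ** ?Q W) + Z H" for W H
  define U0 where "U0 = {W. Determinants.det (?P W) \<noteq> 0} \<inter> ball 0 r"
  have X0: "X 0 = 0" and T0: "T 0 = 0" and Z0: "Z 0 = 0"
    using linear_0 clinear_imp_linear X T Z by blast+
  have contP: "continuous_on S ?P" for S
    by (intro continuous_intros clinear_continuous_on[OF X])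
  have "open {W. Determinants.det (?P W) \<noteq> 0}"
  proof -
    have "open (?P -` {A. Determinants.det A \<noteq> 0})"
      by (rule open_vimage[OF open_det_nz contP])
    then show ?thesis by (simp add: vimage_def)
  qed
  then have openU0: "open U0" by (auto simp: U0_def)
  have zeroU0: "0 \<in> U0" using r by (simp add: U0_def X0 det_I)
  have one_inv: "matrix_inv ?one = ?one"
    using matrix_inv_mult(1)[of ?one] by (simp add: det_I)
  have G0: "?G 0 = A" by (simp add: conjugation_chart_def X0 T0 Z0 one_inv)
  have contQ: "continuous_on U0 ?Q"
    by (rule continuous_on_compose2[OF continuous_on_matrix_inv contP]) (auto simp: U0_def)
  have clinG': "clinear (G' W)" for W
    using X T Z unfolding clinear_iff G'_def
    by (simp add: matrix_add_ldistrib matrix_add_rdistrib cscale_matrix_mult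
        cvec.scale_right_distrib cvec.scale_right_diff_distrib)
  have derG: "(?G has_derivative G' W) (at W)" if W: "W \<in> U0" for W
  proof -
    have dP: "(?P has_derivative X) (at W)"
      by (auto intro!: derivative_eq_intros clinear_has_derivative[OF X])
    have dQ: "(?Q has_derivative (\<lambda>H. - (?Q W ** X H ** ?Q W))) (at W)"
      using has_derivative_compose[OF dP has_derivative_matrix_inv[of "?P W"]] W by (simp add: U0_def)
    have dT: "((\<lambda>W. A + T W) has_derivative T) (at W)"
      by (auto intro!: derivative_eq_intros clinear_has_derivative[OF T])
    have "(?G has_derivative (\<lambda>H. ?P W ** (A + T W) ** - (?Q W ** X H ** ?Q W)
        + (?P W ** T H + X H ** (A + T W)) ** ?Q W + Z H)) (at W)"
      unfolding conjugation_chart_def[abs_def]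
      by (rule has_derivative_add[OF has_derivative_matrix_mult[OF has_derivative_matrix_mult[OF dP dT] dQ]
            clinear_has_derivative[OF Z]])
    moreover have "(\<lambda>H. ?P W ** (A + T W) ** - (?Q W ** X H ** ?Q W)
        + (?P W ** T H + X H ** (A + T W)) ** ?Q W + Z H) = G' W"
      by (rule ext) (simp add: G'_def bb.minus_right matrix_add_rdistrib)
    ultimately show ?thesis by simp
  qed
  have G'0: "G' 0 H = H" for H
    using sum[of H] by (simp add: G'_def X0 T0 one_inv algebra_simps)
  have contG': "continuous_on U0 (\<lambda>W. G' W H)" for H
    unfolding G'_def
    by (intro continuous_intros contP contQ clinear_continuous_on[OF T])
  define f' where "f' W = Blinfun (G' W)" for W
  have f': "blinfun_apply (f' W) = G' W" for W
    unfolding f'_def by (rule bounded_linear_Blinfun_apply[OF clinear_imp_bounded_linear[OF clinG']])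
  have contf': "continuous_on U0 f'"
    by (rule continuous_on_blinfun_componentwise) (simp add: f' contG')
  have inv: "id_blinfun o\<^sub>L f' 0 = id_blinfun"
    by (rule blinfun_eqI) (simp add: f' G'0)
  show thesis
  proof (rule inverse_function_theorem[OF openU0 _ contf' zeroU0 inv, of ?G])
    show "(?G has_derivative blinfun_apply (f' W)) (at W)" if "W \<in> U0" for W
      using derG[OF that] by (simp only: f')
    fix U V g g'
    assume U: "open U" "U \<subseteq> U0" "0 \<in> U" and V: "open V" "?G 0 \<in> V" and hom: "homeomorphism U V ?G g"
      and g: "\<And>y. y \<in> V \<Longrightarrow> (g has_derivative g' y) (at y)"
      and g': "\<And>y. y \<in> V \<Longrightarrow> g' y = inv_into UNIV (blinfun_apply (f' (g y)))"
      and bij: "\<And>y. y \<in> V \<Longrightarrow> bij (blinfun_apply (f' (g y)))"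
    show thesis
    proof (rule that[OF U(1,3) _ V(1) _ hom])
      show "U \<subseteq> ball 0 r" using U(2) by (auto simp: U0_def)
      show "A \<in> V" using V(2) by (simp add: G0)
      show "mat_holomorphic_on ?G U"
        unfolding mat_holomorphic_on_def
        using derG clinG' U(2) by (meson clinear_iff subsetD)
      show "mat_holomorphic_on g V"
        unfolding mat_holomorphic_on_def
      proof
        fix y assume y: "y \<in> V"
        have "clinear (g' y)"
          unfolding g'[OF y] f' using bij[OF y] by (intro clinear_inv_into clinG') (simp only: f')
        then show "\<exists>D. (g has_derivative D) (at y) \<and> (\<forall>c X. D (cscale c X) = cscale c (D X))"
          using g[OF y] by (auto simp: clinear_iff)
      qed
    qed
  qed
qed

lemma mat_holomorphic_on_compose_clinear:
  assumes "mat_holomorphic_on f U" "clinear g"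
  shows "mat_holomorphic_on (\<lambda>x. g (f x)) U"
    and "open V \<Longrightarrow> (\<And>x. x \<in> V \<Longrightarrow> g x \<in> U) \<Longrightarrow> mat_holomorphic_on (\<lambda>x. f (g x)) V"
proof -
  show "mat_holomorphic_on (\<lambda>x. g (f x)) U"
    unfolding mat_holomorphic_on_def
  proof
    fix A assume "A \<in> U"
    then obtain D where D: "(f has_derivative D) (at A)" "\<forall>c X. D (cscale c X) = cscale c (D X)"
      using assms(1) unfolding mat_holomorphic_on_def by blast
    have "((\<lambda>x. g (f x)) has_derivative (\<lambda>x. g (D x))) (at A)"
      by (rule has_derivative_compose[OF D(1) clinear_has_derivative[OF assms(2)]])
    then show "\<exists>D. ((\<lambda>x. g (f x)) has_derivative D) (at A) \<and> (\<forall>c X. D (cscale c X) = cscale c (D X))"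
      using D(2) assms(2) by (intro exI[of _ "\<lambda>x. g (D x)"]) (simp add: clinear_iff)
  qed
  show "mat_holomorphic_on (\<lambda>x. f (g x)) V" if "\<And>x. x \<in> V \<Longrightarrow> g x \<in> U"
    unfolding mat_holomorphic_on_def
  proof
    fix A assume "A \<in> V"
    then obtain D where D: "(f has_derivative D) (at (g A))" "\<forall>c X. D (cscale c X) = cscale c (D X)"
      using assms(1) \<open>\<And>x. x \<in> V \<Longrightarrow> g x \<in> U\<close> unfolding mat_holomorphic_on_def by blast
    have "((\<lambda>x. f (g x)) has_derivative (\<lambda>x. D (g x))) (at A)"
      by (rule has_derivative_compose[OF clinear_has_derivative[OF assms(2)] D(1)])
    then show "\<exists>D. ((\<lambda>x. f (g x)) has_derivative D) (at A) \<and> (\<forall>c X. D (cscale c X) = cscale c (D X))"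
      using D(2) assms(2) by (intro exI[of _ "\<lambda>x. D (g x)"]) (simp add: clinear_iff)
  qed
qed

lemma mat_holomorphic_on_subset: "mat_holomorphic_on f U \<Longrightarrow> V \<subseteq> U \<Longrightarrow> mat_holomorphic_on f V"
  unfolding mat_holomorphic_on_def by blast

text \<open>\<open>into\<close> puts the image of the slice \<open>Z W = 0\<close> into
  \<open>S\<close>. \<open>onto\<close> does the converse with small parameters, and smallness
  matters: parameters inside the domain of injectivity are the ones that the local inverse recovers,
  so no other part of \<open>S\<close> enters the chart.\<close>

lemma submanifold_chart_if_parametrized:
  fixes S :: "(complex^'n^'n) set"
  assumes X: "clinear X" and T: "clinear T" and Z: "clinear Z"
    and sum: "\<And>W. X W ** A - A ** X W + T W + Z W = W"
    and r: "r > 0" and into: "\<And>W. norm W < r \<Longrightarrow> Z W = 0 \<Longrightarrow> conjugation_chart X T Z A W \<in> S"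
    and onto: "\<And>e. e > 0 \<Longrightarrow> \<exists>d>0. \<forall>B\<in>S. norm (B - A) < d \<longrightarrow>
      (\<exists>W. norm W < e \<and> Z W = 0 \<and> conjugation_chart X T Z A W = B)"
    and d: "dim {W. Z W = 0} = 2 * d"
  shows "\<exists>U V f g I. open U \<and> open V \<and> A \<in> U \<and> homeomorphism U V f g \<and>
        mat_holomorphic_on f U \<and> mat_holomorphic_on g V \<and>
        card I = d \<and> f ` (S \<inter> U) = coord_subspace I \<inter> V"
proof -
  let ?G = "conjugation_chart X T Z A"
  obtain U V g where U: "open U" "0 \<in> U" "U \<subseteq> ball 0 r" and V: "open V" "A \<in> V"
    and hom: "homeomorphism U V ?G g" and hol: "mat_holomorphic_on ?G U" "mat_holomorphic_on g V"
    by (rule conjugation_chart_local_inverse[OF X T Z sum r])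
  obtain e where e: "e > 0" "ball 0 e \<subseteq> U"
    using U(1,2) open_contains_ball by blast
  obtain \<delta> where \<delta>: "\<delta> > 0" "\<And>B. B \<in> S \<Longrightarrow> norm (B - A) < \<delta> \<Longrightarrow> \<exists>W. norm W < e \<and> Z W = 0 \<and> ?G W = B"
    using onto[OF e(1)] by blast
  have "cvec.subspace {W. Z W = 0}"
    using Z linear_0[OF clinear_imp_linear[OF Z]] by (auto simp: csubspace_iff clinear_iff)
  then have "\<exists>f0 g0 I. clinear f0 \<and> clinear g0 \<and> (\<forall>X. g0 (f0 X) = X) \<and> (\<forall>X. f0 (g0 X) = X) \<and>
      f0 ` {W. Z W = 0} = coord_subspace I"
    by (rule csubspace_straighten) blast
  then obtain f0 g0 I where f0: "clinear f0" and g0: "clinear g0" and g0f0: "\<And>X. g0 (f0 X) = X"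
    and f0g0: "\<And>X. f0 (g0 X) = X" and I: "f0 ` {W. Z W = 0} = coord_subspace I"
    by blast
  have Gg: "?G (g y) = y" "g y \<in> U" if "y \<in> V" for y using hom that by (auto simp: homeomorphism_def)
  have gG: "g (?G W) = W" "?G W \<in> V" if "W \<in> U" for W using hom that by (auto simp: homeomorphism_def)
  have contG: "continuous_on U ?G" and contg: "continuous_on V g" using hom by (auto simp: homeomorphism_def)
  \<comment> \<open>The target is cut down to a ball in which every point of \<open>S\<close> has a
    parameter in \<open>ball 0 e\<close>, hence in \<open>U\<close>; the other two sets are adapted
    to it.\<close>
  define U1 where "U1 = V \<inter> ball A \<delta>"
  define W1 where "W1 = U \<inter> ?G -` ball A \<delta>"
  define V1 where "V1 = g0 -` W1"
  have openW1: "open W1" unfolding W1_def by (rule continuous_open_preimage[OF contG U(1) open_ball])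
  have openV1: "open V1" unfolding V1_def
    by (rule open_vimage[OF openW1 clinear_continuous_on[OF g0]])
  have g_in: "g y \<in> W1" if "y \<in> U1" for y
    using that Gg[of y] by (simp add: U1_def W1_def)
  have G_in: "?G W \<in> U1" if "W \<in> W1" for W
    using that gG[of W] by (simp add: U1_def W1_def)
  have subs: "U1 \<subseteq> V" "W1 \<subseteq> U" by (auto simp: U1_def W1_def)
  have "homeomorphism U1 V1 (\<lambda>y. f0 (g y)) (\<lambda>w. ?G (g0 w))"
  proof (rule homeomorphismI)
    show "continuous_on U1 (\<lambda>y. f0 (g y))"
      by (rule continuous_on_compose2[OF clinear_continuous_on[OF f0, of UNIV] continuous_on_subset[OF contg subs(1)]])
        simp
    show "continuous_on V1 (\<lambda>w. ?G (g0 w))"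
      by (rule continuous_on_compose2[OF contG clinear_continuous_on[OF g0]])
        (use subs in \<open>auto simp: V1_def\<close>)
    show "(\<lambda>y. f0 (g y)) ` U1 \<subseteq> V1" using g_in by (auto simp: V1_def g0f0)
    show "(\<lambda>w. ?G (g0 w)) ` V1 \<subseteq> U1" using G_in by (auto simp: V1_def)
    show "?G (g0 (f0 (g y))) = y" if "y \<in> U1" for y using that subs Gg by (auto simp: g0f0)
    show "f0 (g (?G (g0 w))) = w" if "w \<in> V1" for w
      using that subs gG(1)[of "g0 w"] by (auto simp: V1_def f0g0)
  qed
  moreover have "mat_holomorphic_on (\<lambda>y. f0 (g y)) U1"
    by (rule mat_holomorphic_on_compose_clinear(1)[OF mat_holomorphic_on_subset[OF hol(2) subs(1)] f0])
  moreover have "mat_holomorphic_on (\<lambda>w. ?G (g0 w)) V1"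
    by (rule mat_holomorphic_on_compose_clinear(2)[OF hol(1) g0 openV1]) (use subs in \<open>auto simp: V1_def\<close>)
  moreover have "card I = d"
  proof -
    have "inj f0" using g0f0 by (rule inj_on_inverseI)
    then have "dim (f0 ` {W. Z W = 0}) = dim {W. Z W = 0}"
      by (intro dim_image_eq[OF clinear_imp_linear[OF f0]]) (auto intro: inj_on_subset)
    then show ?thesis using d by (simp add: I dim_coord_subspace)
  qed
  moreover have "(\<lambda>y. f0 (g y)) ` (S \<inter> U1) = coord_subspace I \<inter> V1"
  proof
    show "(\<lambda>y. f0 (g y)) ` (S \<inter> U1) \<subseteq> coord_subspace I \<inter> V1"
    proof clarify
      fix y assume y: "y \<in> S" "y \<in> U1"
      then have "norm (y - A) < \<delta>" by (simp add: U1_def dist_norm norm_minus_commute)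
      then obtain W where W: "norm W < e" "Z W = 0" "?G W = y" using \<delta>(2) y(1) by blast
      then have "W \<in> U" using e(2) by auto
      then have "g y = W" using gG(1) W(3) by blast
      then have "f0 (g y) \<in> coord_subspace I" using W(2) I by blast
      moreover have "f0 (g y) \<in> V1" using g_in[OF y(2)] by (simp add: V1_def g0f0)
      ultimately show "f0 (g y) \<in> coord_subspace I \<inter> V1" by blast
    qed
    show "coord_subspace I \<inter> V1 \<subseteq> (\<lambda>y. f0 (g y)) ` (S \<inter> U1)"
    proof clarify
      fix w assume w: "w \<in> coord_subspace I" "w \<in> V1"
      then obtain W where W: "Z W = 0" "w = f0 W" using I by blast
      have "g0 w = W" by (simp add: W(2) g0f0)
      then have "W \<in> W1" using w(2) by (simp add: V1_def)
      then have "norm W < r" "g (?G W) = W" "?G W \<in> U1"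
        using subs U(3) gG(1) G_in by auto
      then have "?G W \<in> S \<inter> U1" "w = f0 (g (?G W))" using into W by auto
      then show "w \<in> (\<lambda>y. f0 (g y)) ` (S \<inter> U1)" by blast
    qed
  qed
  moreover have "open U1" "A \<in> U1" using V \<delta>(1) by (auto simp: U1_def)
  ultimately show ?thesis using openV1 by blast
qed

text \<open>\<open>g\<close> maps the range isomorphically onto a complement of the kernel.\<close>

lemma dim_kernel_plus_range:
  fixes L :: "'a::euclidean_space \<Rightarrow> 'a"
  assumes L: "linear L" and g: "linear g" and LgL: "\<And>x. L (g (L x)) = L x"
  shows "dim {x. L x = 0} + dim (range L) = DIM('a)"
proof -
  define C where "C = g ` range L"
  have subR: "subspace (range L)" using L by (intro linear_subspace_image) auto
  have subC: "subspace C" unfolding C_def by (rule linear_subspace_image[OF g subR])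
  have sub: "subspace {x. L x = 0}" by (rule linear_subspace_kernel[OF L])
  have "z \<in> {x + y |x y. x \<in> {x. L x = 0} \<and> y \<in> C}" for z
  proof -
    have "L (z - g (L z)) = 0" using linear_diff[OF L, of z "g (L z)"] LgL[of z] by simp
    moreover have "z = (z - g (L z)) + g (L z)" by simp
    ultimately show ?thesis unfolding C_def by blast
  qed
  then have "{x + y |x y. x \<in> {x. L x = 0} \<and> y \<in> C} = UNIV" by blast
  then have "dim {x + y |x y. x \<in> {x. L x = 0} \<and> y \<in> C} = DIM('a)" by (simp only: dim_UNIV)
  moreover have "dim ({x. L x = 0} \<inter> C) = 0"
  proof -
    have "x = 0" if x: "x \<in> {x. L x = 0} \<inter> C" for x
    proof -
      obtain y where y: "x = g (L y)" "L x = 0" using x by (auto simp: C_def)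
      then have "L y = 0" using LgL[of y] by simp
      then show ?thesis using y(1) linear_0[OF g] by simp
    qed
    then have "{x. L x = 0} \<inter> C \<subseteq> {0}" by blast
    then show ?thesis by (simp only: dim_eq_0)
  qed
  moreover have "dim C = dim (range L)"
  proof -
    have "inj_on g (range L)" by (rule inj_on_inverseI[of _ L]) (auto simp: LgL)
    then have "inj_on g (span (range L))" by (simp only: span_eq_iff[THEN iffD2, OF subR])
    then show ?thesis unfolding C_def by (rule dim_image_eq[OF g])
  qed
  ultimately show ?thesis using dim_sums_Int[OF sub subC] by linarith
qed

lemma trace_matrix_mult_commute:
  "trace (A ** B) = trace (B ** A :: complex^'n^'n)" for A B :: "complex^'n^'n"
proof -
  have "trace (A ** B) = (\<Sum>i\<in>UNIV. \<Sum>j\<in>UNIV. A $ i $ j * B $ j $ i)"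
    by (simp add: trace_def matrix_matrix_mult_def)
  also have "\<dots> = (\<Sum>j\<in>UNIV. \<Sum>i\<in>UNIV. B $ j $ i * A $ i $ j)"
    by (subst sum.swap) (simp add: mult.commute)
  also have "\<dots> = trace (B ** A)"
    by (simp add: trace_def matrix_matrix_mult_def)
  finally show ?thesis .
qed

section \<open>Spectral projections and the change of eigenvalues\<close>

context jordan_shape
begin

text \<open>For distinct eigenvalues this is the spectral projection of \<open>jordan lam\<close>
  belonging to \<open>lam a\<close>; it does not depend on \<open>lam\<close>.\<close>

definition block_projection :: "nat \<Rightarrow> complex^'n^'n" where
  "block_projection a = (\<chi> x y. if x = y \<and> fst (label x) = a then 1 else 0)"

lemma block_projection_mult_left:
  "(block_projection a ** X) $ x $ y = (if fst (label x) = a then X $ x $ y else 0)"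
proof -
  have "(block_projection a ** X) $ x $ y = (\<Sum>z\<in>UNIV. block_projection a $ x $ z * X $ z $ y)"
    by (simp add: matrix_matrix_mult_def)
  also have "\<dots> = (\<Sum>z\<in>UNIV. if z = x then (if fst (label x) = a then X $ x $ y else 0) else 0)"
    by (intro sum.cong refl) (auto simp: block_projection_def)
  finally show ?thesis by simp
qed

lemma block_projection_mult_right:
  "(X ** block_projection a) $ x $ y = (if fst (label y) = a then X $ x $ y else 0)"
proof -
  have "(X ** block_projection a) $ x $ y = (\<Sum>z\<in>UNIV. X $ x $ z * block_projection a $ z $ y)"
    by (simp add: matrix_matrix_mult_def)
  also have "\<dots> = (\<Sum>z\<in>UNIV. if z = y then (if fst (label y) = a then X $ x $ y else 0) else 0)"
    by (intro sum.cong refl) (auto simp: block_projection_def)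
  finally show ?thesis by simp
qed

lemma block_projection_idem:
  "block_projection a ** block_projection b = (if a = b then block_projection a else 0)"
  by (auto simp: Finite_Cartesian_Product.vec_eq_iff block_projection_mult_left)
    (auto simp: block_projection_def)

lemma block_projection_commute: "block_projection a ** jordan lam = jordan lam ** block_projection a"
proof -
  have "jordan lam $ x $ y = 0" if "fst (label x) \<noteq> fst (label y)" for x y
  proof -
    obtain b i l where x: "label x = (b, i, l)" by (metis prod_cases3)
    obtain c j l' where y: "label y = (c, j, l')" by (metis prod_cases3)
    show ?thesis using that by (simp add: jordan_def x y)
  qed
  then show ?thesis
    by (auto simp: Finite_Cartesian_Product.vec_eq_iff block_projection_mult_left block_projection_mult_right)
qed

text \<open>The trace counts the positions with label \<open>a\<close>, and the first position of
  the first block is one of them. It becomes the denominator of \<open>coeff\<close>.\<close>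

lemma trace_block_projection:
  assumes "a \<in> {1..p}"
  shows "trace (block_projection a) \<noteq> 0"
proof -
  have "(a, 1, 0) \<in> labels" using assms N_pos[OF assms] k_pos[OF assms, of 1] by auto
  then have "label (index (a, 1, 0)) = (a, 1, 0)" by (rule label_index)
  then have "{x. fst (label x) = a} \<noteq> {}" by (auto intro!: exI[of _ "index (a, 1, 0)"])
  then show ?thesis
    by (simp add: trace_def block_projection_def sum.If_cases)
qed

text \<open>The Jordan matrix is affine in its eigenvalues. For this reason a linear
  \<open>T\<close> suffices to move them.\<close>

lemma jordan_add:
  "jordan (\<lambda>a. lam a + t a) = jordan lam + (\<Sum>a = 1..p. cscale (t a) (block_projection a))"
proof -
  have "jordan (\<lambda>a. lam a + t a) $ x $ y = (jordan lam + (\<Sum>a = 1..p. cscale (t a) (block_projection a))) $ x $ y" for x y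
  proof -
    obtain a i l where x: "label x = (a, i, l)" by (metis prod_cases3)
    obtain b j l' where y: "label y = (b, j, l')" by (metis prod_cases3)
    have a: "a \<in> {1..p}" using label_in[OF x] by blast
    have "x = y \<longleftrightarrow> (a, i, l) = (b, j, l')" using x y index_label by metis
    moreover have "(\<Sum>c = 1..p. cscale (t c) (block_projection c)) $ x $ y =
        (\<Sum>c = 1..p. if c = a then (if x = y then t a else 0) else 0)"
      unfolding sum_component by (intro sum.cong refl) (auto simp: block_projection_def x)
    then have "(\<Sum>c = 1..p. cscale (t c) (block_projection c)) $ x $ y = (if x = y then t a else 0)"
      using a by simp
    ultimately show ?thesis by (auto simp: jordan_def x y)
  qed
  then show ?thesis by (simp add: Finite_Cartesian_Product.vec_eq_iff)
qed

end

locale jordan_point = jordan_shape p N k label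
  for p :: nat and N :: "nat \<Rightarrow> nat" and k :: "nat \<Rightarrow> nat \<Rightarrow> nat"
    and label :: "'n::finite \<Rightarrow> nat \<times> nat \<times> nat" +
  fixes P P' :: "complex^'n^'n" and lam :: "nat \<Rightarrow> complex"
  assumes PP': "P ** P' = Finite_Cartesian_Product.mat 1" and lam: "inj_on lam {1..p}"
begin

lemma P'P: "P' ** P = Finite_Cartesian_Product.mat 1"
  using PP' by (simp add: matrix_left_right_inverse)

definition A :: "complex^'n^'n" where "A = P ** jordan lam ** P'"

definition E :: "nat \<Rightarrow> complex^'n^'n" where "E a = P ** block_projection a ** P'"

text \<open>The functionals dual to the projections \<open>E a\<close>. Defining them by traces
  makes them vanish on commutators with \<open>A\<close>, so that \<open>T\<close> is a projection
  onto the span of the \<open>E a\<close> whose kernel contains all these commutators.\<close>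

definition coeff :: "nat \<Rightarrow> complex^'n^'n \<Rightarrow> complex" where
  "coeff a W = trace (E a ** W) / trace (block_projection a)"

definition T :: "complex^'n^'n \<Rightarrow> complex^'n^'n" where
  "T W = (\<Sum>a = 1..p. cscale (coeff a W) (E a))"

lemma conj_mult: "(P ** X ** P') ** (P ** Y ** P') = P ** (X ** Y) ** P'"
proof -
  have "(P ** X ** P') ** (P ** Y ** P') = P ** X ** (P' ** P) ** Y ** P'" by (simp only: matrix_mul_assoc)
  then show ?thesis by (simp add: P'P matrix_mul_assoc)
qed

lemma E_mult: "E a ** E b = (if a = b then E a else 0)"
  by (simp add: E_def conj_mult block_projection_idem)

lemma E_commute: "E a ** A = A ** E a"
  by (simp add: E_def A_def conj_mult block_projection_commute)

lemma trace_E: "trace (E a) = trace (block_projection a)"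
proof -
  have "trace (E a) = trace (P' ** (P ** block_projection a))"
    unfolding E_def by (rule trace_matrix_mult_commute)
  then show ?thesis by (simp add: matrix_mul_assoc P'P)
qed

lemma coeff_add: "coeff a (X + Y) = coeff a X + coeff a Y"
  by (simp add: coeff_def matrix_add_ldistrib trace_def sum.distrib add_divide_distrib)

lemma coeff_cscale: "coeff a (cscale c X) = c * coeff a X"
  by (simp add: coeff_def cscale_matrix_mult trace_def sum_distrib_left)

lemma coeff_0 [simp]: "coeff a 0 = 0"
  using coeff_add[of a 0 0] by simp

lemma coeff_sum: "coeff a (sum f I) = (\<Sum>i\<in>I. coeff a (f i))"
  by (induction I rule: infinite_finite_induct) (simp_all add: coeff_add)

lemma coeff_E: "a \<in> {1..p} \<Longrightarrow> coeff a (E b) = (if a = b then 1 else 0)"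
  using trace_block_projection[of a] by (auto simp: coeff_def E_mult trace_E trace_def[of 0])

lemma coeff_combination:
  assumes "a \<in> {1..p}"
  shows "coeff a (\<Sum>b = 1..p. cscale (t b) (E b)) = t a"
proof -
  have "coeff a (\<Sum>b = 1..p. cscale (t b) (E b)) = (\<Sum>b = 1..p. if b = a then t a else 0)"
    unfolding coeff_sum by (intro sum.cong) (auto simp: coeff_cscale coeff_E[OF assms])
  then show ?thesis using assms by simp
qed

text \<open>\<open>E a\<close> commutes with \<open>A\<close>, and the trace is cyclic.\<close>

lemma coeff_commutator: "coeff a (X ** A - A ** X) = 0"
proof -
  have "trace (E a ** (X ** A)) = trace (E a ** (A ** X))"
    using trace_matrix_mult_commute[of "E a ** X" A]
    by (simp add: matrix_mul_assoc E_commute)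
  then show ?thesis
    by (simp add: coeff_def matrix_diff_ldistrib trace_def sum_subtractf)
qed

lemma clinear_T: "clinear T"
  by (simp add: clinear_iff T_def coeff_add coeff_cscale cvec.scale_left_distrib sum.distrib
      cvec.scale_sum_right)

lemma T_combination: "T (\<Sum>b = 1..p. cscale (t b) (E b)) = (\<Sum>b = 1..p. cscale (t b) (E b))"
  unfolding T_def by (intro sum.cong refl) (simp only: coeff_combination)

lemma T_idem: "T (T W) = T W"
  using T_combination[of "\<lambda>a. coeff a W"] by (simp add: T_def[of W])

lemma T_commutator: "T (X ** A - A ** X) = 0"
  by (simp add: T_def coeff_commutator)

lemma A_add_combination:
  "A + (\<Sum>b = 1..p. cscale (t b) (E b)) = P ** jordan (\<lambda>a. lam a + t a) ** P'"
proof -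
  have lin: "linear (\<lambda>X. P ** X ** P')" by (rule linear_matrix_mult_left_right)
  show ?thesis
    by (simp add: jordan_add linear_add[OF lin] linear_sum[OF lin] A_def E_def cscale_matrix_mult)
qed

text \<open>The \<open>E a\<close> are independent, because \<open>coeff\<close> recovers the
  coefficients. The diagonal positions \<open>x a\<close>, one for each label, serve to identify the
  range with a coordinate subspace, whose real dimension is known.\<close>

lemma dim_range_T: "dim (range T) = 2 * p"
proof -
  define x where "x a = index (a, 1, 0)" for a
  have x: "x a = x b \<longleftrightarrow> a = b" if "a \<in> {1..p}" "b \<in> {1..p}" for a b
  proof -
    have "(a, 1, 0) \<in> labels" "(b, 1, 0) \<in> labels"
      using that N_pos k_pos[of _ 1] by (force simp: Suc_le_eq)+
    then show ?thesis by (simp only: x_def index_eq_iff prod.inject simp_thms)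
  qed
  define I where "I = (\<lambda>a. (x a, x a)) ` {1..p}"
  have "inj_on (\<lambda>a. (x a, x a)) {1..p}" using x by (intro inj_onI) blast
  then have cardI: "card I = p" by (simp add: I_def card_image)
  define h where "h Y = (\<Sum>a = 1..p. cscale (Y $ x a $ x a) (E a))" for Y :: "complex^'n^'n"
  have "clinear h"
    by (simp add: clinear_iff h_def cvec.scale_left_distrib sum.distrib cvec.scale_sum_right)
  then have lin: "linear h" by (rule clinear_imp_linear)
  have "inj_on h (coord_subspace I)"
  proof (subst linear_injective_on_subspace_0[OF lin subspace_coord_subspace], intro ballI impI)
    fix Y assume Y: "Y \<in> coord_subspace I" "h Y = 0"
    have "Y $ i $ j = 0" for i j
    proof (cases "(i, j) \<in> I")
      case True
      then obtain a where a: "a \<in> {1..p}" "i = x a" "j = x a" by (auto simp: I_def)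
      then show ?thesis using coeff_combination[OF a(1), of "\<lambda>a. Y $ x a $ x a"] Y(2) by (simp add: h_def)
    qed (use Y in \<open>simp add: coord_subspace_def\<close>)
    then show "Y = 0" by (simp add: Finite_Cartesian_Product.vec_eq_iff)
  qed
  then have "inj_on h (span (coord_subspace I))"
    by (simp only: span_eq_iff[THEN iffD2, OF subspace_coord_subspace])
  then have "dim (h ` coord_subspace I) = 2 * p"
    using dim_image_eq[OF lin, of "coord_subspace I"] by (simp add: dim_coord_subspace cardI)
  moreover have "h ` coord_subspace I = range T"
  proof
    have "h Y = T (h Y)" for Y unfolding h_def T_combination by simp
    then show "h ` coord_subspace I \<subseteq> range T" by blast
    show "range T \<subseteq> h ` coord_subspace I"
    proof clarify
      fix W
      define Y :: "complex^'n^'n" where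
        "Y = (\<chi> i j. if (i, j) \<in> I then coeff (fst (label i)) W else 0)"
      have "Y $ x a $ x a = coeff a W" if a: "a \<in> {1..p}" for a
      proof -
        have "(a, 1, 0) \<in> labels" using a N_pos[OF a] k_pos[OF a, of 1] by auto
        then have "label (x a) = (a, 1, 0)" unfolding x_def by (rule label_index)
        then show ?thesis using a by (auto simp: Y_def I_def)
      qed
      then have "T W = h Y" unfolding T_def h_def by (intro sum.cong) auto
      moreover have "Y \<in> coord_subspace I" by (simp add: coord_subspace_def Y_def)
      ultimately show "T W \<in> h ` coord_subspace I" by blast
    qed
  qed
  ultimately show ?thesis by simp
qed

end

section \<open>The chart of the Jordan class at a point\<close>

lemma det_one_plus_nz_near_0:
  obtains r where "r > 0"
    "\<And>X :: complex^'n^'n. norm X < r \<Longrightarrow> Determinants.det (Finite_Cartesian_Product.mat 1 + X) \<noteq> 0"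
proof -
  let ?one = "Finite_Cartesian_Product.mat 1 :: complex^'n^'n"
  have "open ((\<lambda>X. ?one + X) -` {A. Determinants.det A \<noteq> 0})"
    by (intro open_vimage[OF open_det_nz] continuous_intros)
  moreover have "0 \<in> (\<lambda>X. ?one + X) -` {A. Determinants.det A \<noteq> 0}" by (simp add: det_I)
  ultimately obtain r where "r > 0" "ball 0 r \<subseteq> (\<lambda>X. ?one + X) -` {A. Determinants.det A \<noteq> 0}"
    using open_contains_ball by blast
  then show thesis by (intro that[of r]) auto
qed

lemma clinear_compose: "clinear f \<Longrightarrow> clinear g \<Longrightarrow> clinear (\<lambda>x. f (g x))"
  by (simp add: clinear_iff)

lemma clinear_diff: "clinear f \<Longrightarrow> clinear g \<Longrightarrow> clinear (\<lambda>x. f x - g x)"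
  by (simp add: clinear_iff cvec.scale_right_diff_distrib)

lemma clinear_id: "clinear (\<lambda>x. x)"
  by (simp add: clinear_iff)

context jordan_point
begin

abbreviation comm :: "complex^'n^'n \<Rightarrow> complex^'n^'n" where
  "comm X \<equiv> X ** A - A ** X"

lemma coeff_bound: obtains M where "M > 0" "\<And>a W. a \<in> {1..p} \<Longrightarrow> norm (coeff a W) \<le> M * norm W"
proof -
  have "\<exists>M. \<forall>W. norm (coeff a W) \<le> M * norm W" for a
  proof -
    have "linear (coeff a)"
      by (simp add: linear_iff coeff_add scaleR_cscale coeff_cscale) (simp add: scaleR_conv_of_real)
    then have "bounded_linear (coeff a)" by (simp add: linear_conv_bounded_linear)
    then obtain M where "\<And>W. norm (coeff a W) \<le> norm W * M"
      using bounded_linear.pos_bounded by blast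
    then show ?thesis by (metis mult.commute)
  qed
  then obtain M where M: "\<And>a W. norm (coeff a W) \<le> M a * norm W" by metis
  define K where "K = 1 + (\<Sum>a = 1..p. \<bar>M a\<bar>)"
  have "K > 0" unfolding K_def by (intro add_pos_nonneg sum_nonneg) auto
  moreover have "norm (coeff a W) \<le> K * norm W" if a: "a \<in> {1..p}" for a W
  proof -
    have "\<bar>M a\<bar> \<le> (\<Sum>a = 1..p. \<bar>M a\<bar>)" using a by (intro member_le_sum) auto
    then have "M a \<le> K" by (simp add: K_def)
    then have "M a * norm W \<le> K * norm W" by (intro mult_right_mono) auto
    then show ?thesis using M[of a W] by simp
  qed
  ultimately show thesis using that by blast
qed

lemma combination_bound:
  obtains M where "M > 0" "\<And>t e. (\<And>a. a \<in> {1..p} \<Longrightarrow> norm (t a) \<le> e) \<Longrightarrow> e \<ge> 0 \<Longrightarrow>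
    norm (\<Sum>b = 1..p. cscale (t b) (E b)) \<le> M * e"
proof -
  have "\<exists>M. \<forall>c. norm (cscale c (E b)) \<le> norm c * M" for b
  proof (intro exI allI)
    fix c
    have "norm (cscale c (E b)) \<le> (\<Sum>x\<in>UNIV. \<Sum>y\<in>UNIV. norm (cscale c (E b) $ x $ y))"
      by (rule norm_le_sum_entries)
    also have "\<dots> = norm c * (\<Sum>x\<in>UNIV. \<Sum>y\<in>UNIV. norm (E b $ x $ y))"
      by (simp add: norm_mult sum_distrib_left)
    finally show "norm (cscale c (E b)) \<le> norm c * (\<Sum>x\<in>UNIV. \<Sum>y\<in>UNIV. norm (E b $ x $ y))" .
  qed
  then obtain M where M: "\<And>b c. norm (cscale c (E b)) \<le> norm c * M b" by metis
  define K where "K = 1 + (\<Sum>b = 1..p. \<bar>M b\<bar>)"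
  have "K > 0" unfolding K_def by (intro add_pos_nonneg sum_nonneg) auto
  moreover have "norm (\<Sum>b = 1..p. cscale (t b) (E b)) \<le> K * e"
    if t: "\<And>a. a \<in> {1..p} \<Longrightarrow> norm (t a) \<le> e" "e \<ge> 0" for t e
  proof -
    have "norm (\<Sum>b = 1..p. cscale (t b) (E b)) \<le> (\<Sum>b = 1..p. \<bar>M b\<bar> * e)"
    proof (rule sum_norm_le)
      fix b assume b: "b \<in> {1..p}"
      have "norm (cscale (t b) (E b)) \<le> norm (t b) * M b" by (rule M)
      also have "\<dots> \<le> norm (t b) * \<bar>M b\<bar>" by (intro mult_left_mono) auto
      also have "\<dots> \<le> e * \<bar>M b\<bar>" using t(1)[OF b] by (intro mult_right_mono) auto
      finally show "norm (cscale (t b) (E b)) \<le> \<bar>M b\<bar> * e" by (simp add: mult.commute)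
    qed
    also have "\<dots> \<le> K * e"
      unfolding sum_distrib_right[symmetric] K_def using t(2) by (intro mult_right_mono) auto
    finally show ?thesis .
  qed
  ultimately show thesis using that by blast
qed

lemma dim_intertwiners_A: "dim (intertwiners A A) = 2 * (\<Sum>a = 1..p. overlap a a)"
  unfolding A_def using dim_intertwiners_similar[OF PP' P'P PP' P'P] dim_intertwiners_self[OF lam] by simp

text \<open>The slice \<open>Z W = 0\<close> is the direct sum of the commutators with
  \<open>A\<close> and the span of the projections \<open>E a\<close>. Rank and nullity give the
  dimension of the first summand, and the second contributes \<open>p\<close>.\<close>

lemma jordan_class_chart:
  "\<exists>U V f g I. open U \<and> open V \<and> A \<in> U \<and> homeomorphism U V f g \<and>
    mat_holomorphic_on f U \<and> mat_holomorphic_on g V \<and>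
    card I = CARD('n) * CARD('n) - (\<Sum>a = 1..p. overlap a a) + p \<and>
    f ` (jordan_class \<inter> U) = coord_subspace I \<inter> V"
proof -
  let ?one = "Finite_Cartesian_Product.mat 1 :: complex^'n^'n"
  have comm: "clinear comm" by (rule clinear_commutator)
  have comm_add: "comm (X + Y) = comm X + comm Y" for X Y using comm by (simp add: clinear_iff)
  have "\<exists>g. clinear g \<and> (\<forall>X. comm (g (comm X)) = comm X)"
    by (rule generalized_inverse[OF comm]) blast
  then obtain h where h: "clinear h" and hh: "\<And>X. comm (h (comm X)) = comm X" by blast
  define X where "X W = h (comm (h (W - T W)))" for W
  define Z where "Z W = W - T W - comm (h (W - T W))" for W
  have clinX: "clinear X" unfolding X_def
    by (intro clinear_compose[OF h] clinear_compose[OF comm] clinear_diff clinear_id clinear_T)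
  have clinZ: "clinear Z" unfolding Z_def
    by (intro clinear_compose[OF h] clinear_compose[OF comm] clinear_diff clinear_id clinear_T)
  have sum: "X W ** A - A ** X W + T W + Z W = W" for W
    by (simp add: X_def Z_def hh)
  obtain s where s: "s > 0" "\<And>a b. a \<in> {1..p} \<Longrightarrow> b \<in> {1..p} \<Longrightarrow> a \<noteq> b \<Longrightarrow> s \<le> dist (lam a) (lam b)"
    using finite_inj_separated[OF _ lam] by blast
  have inj_close: "inj_on mu {1..p}" if mu: "\<And>a. a \<in> {1..p} \<Longrightarrow> dist (mu a) (lam a) < s / 2" for mu
  proof (rule inj_onI, rule ccontr)
    fix a b assume ab: "a \<in> {1..p}" "b \<in> {1..p}" "mu a = mu b" "a \<noteq> b"
    have "dist (lam a) (lam b) \<le> dist (mu a) (lam a) + dist (mu b) (lam b)"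
      using dist_triangle3[of "lam a" "lam b" "mu a"] ab(3) by simp
    then show False using mu[OF ab(1)] mu[OF ab(2)] s(2)[OF ab(1,2,4)] by simp
  qed
  obtain r0 where r0: "r0 > 0" "\<And>X :: complex^'n^'n. norm X < r0 \<Longrightarrow> Determinants.det (?one + X) \<noteq> 0"
    by (rule det_one_plus_nz_near_0) blast
  obtain MX where MX: "MX > 0" "\<And>W. norm (X W) \<le> norm W * MX"
    using bounded_linear.pos_bounded[OF clinear_imp_bounded_linear[OF clinX]] by blast
  obtain MC where MC: "MC > 0" "\<And>W. norm (comm W) \<le> norm W * MC"
    using bounded_linear.pos_bounded[OF clinear_imp_bounded_linear[OF comm]] by blast
  obtain Mc where Mc: "Mc > 0" "\<And>a W. a \<in> {1..p} \<Longrightarrow> norm (coeff a W) \<le> Mc * norm W"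
    by (rule coeff_bound) blast
  have "\<exists>M>0. \<forall>t e. (\<forall>a\<in>{1..p}. norm (t a) \<le> e) \<longrightarrow> e \<ge> 0 \<longrightarrow> norm (\<Sum>b = 1..p. cscale (t b) (E b)) \<le> M * e"
    by (rule combination_bound) blast
  then obtain ME where ME: "ME > 0" "\<And>t e. (\<And>a. a \<in> {1..p} \<Longrightarrow> norm (t a) \<le> e) \<Longrightarrow> e \<ge> 0 \<Longrightarrow>
      norm (\<Sum>b = 1..p. cscale (t b) (E b)) \<le> ME * e"
    by blast
  \<comment> \<open>The first bound keeps \<open>1 + X W\<close> invertible; the second moves each
    eigenvalue by less than \<open>s / 2\<close>, so that they stay distinct.\<close>
  define r where "r = min (r0 / MX) (s / 2 / Mc)"
  have r: "r > 0" using r0(1) MX(1) Mc(1) s(1) by (simp add: r_def)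
  have into: "conjugation_chart X T Z A W \<in> jordan_class" if W: "norm W < r" "Z W = 0" for W
  proof -
    have "norm (X W) \<le> norm W * MX" by (rule MX)
    also have "\<dots> < r0" using W(1) MX(1) by (simp add: r_def pos_less_divide_eq)
    finally have det: "Determinants.det (?one + X W) \<noteq> 0" by (rule r0(2))
    let ?mu = "\<lambda>a. lam a + coeff a W"
    have "inj_on ?mu {1..p}"
    proof (rule inj_close)
      fix a assume a: "a \<in> {1..p}"
      have "norm (coeff a W) \<le> Mc * norm W" by (rule Mc(2)[OF a])
      also have "\<dots> < s / 2" using W(1) Mc(1) by (simp add: r_def pos_less_divide_eq mult_ac)
      finally show "dist (?mu a) (lam a) < s / 2" by (simp add: dist_norm)
    qed
    moreover have "((?one + X W) ** P) ** (P' ** matrix_inv (?one + X W)) = ?one"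
    proof -
      have "((?one + X W) ** P) ** (P' ** matrix_inv (?one + X W)) =
          (?one + X W) ** (P ** P') ** matrix_inv (?one + X W)" by (simp only: matrix_mul_assoc)
      then show ?thesis by (simp add: PP' matrix_inv_mult[OF det])
    qed
    moreover have "conjugation_chart X T Z A W =
        ((?one + X W) ** P) ** jordan ?mu ** (P' ** matrix_inv (?one + X W))"
    proof -
      have "A + T W = P ** jordan ?mu ** P'" unfolding T_def by (rule A_add_combination)
      then show ?thesis by (simp add: conjugation_chart_def W(2) matrix_mul_assoc)
    qed
    ultimately show ?thesis unfolding jordan_class_def by blast
  qed
  have onto: "\<exists>d>0. \<forall>B\<in>jordan_class. norm (B - A) < d \<longrightarrow>
      (\<exists>W. norm W < e \<and> Z W = 0 \<and> conjugation_chart X T Z A W = B)" if e: "e > 0" for e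
  proof (rule intertwiner_perturbation[OF h hh])
    fix d0 K
    assume d0: "d0 > 0" and K: "K > 0" and
      near: "\<And>A' B'. norm (A' - A) < d0 \<Longrightarrow> norm (B' - A) < d0 \<Longrightarrow>
        dim (intertwiners A A) \<le> dim (intertwiners A' B') \<Longrightarrow>
        \<exists>X. X \<in> h ` range comm \<and> ?one + X \<in> intertwiners A' B' \<and> norm X \<le> K * norm (A' - B')"
    \<comment> \<open>The four bounds give, in this order, invertibility of \<open>1 + Y\<close>,
      \<open>norm (comm Y) < e / 2\<close>, access to the perturbation lemma, and room for
      \<open>F\<close> in the estimate of \<open>W\<close>.\<close>
    define \<eta> where "\<eta> = min (min (r0 / (2 * K)) (e / (4 * (K * MC)))) (min d0 (e / 2))"
    have \<eta>: "\<eta> > 0" "\<eta> \<le> r0 / (2 * K)" "\<eta> \<le> e / (4 * (K * MC))" "\<eta> \<le> d0" "\<eta> \<le> e / 2"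
      using r0(1) K e MC(1) d0 by (auto simp: \<eta>_def)
    \<comment> \<open>The eigenvalues stay distinct, and the eigenvalue part \<open>F\<close> has
      norm at most \<open>\<eta> / 2\<close>.\<close>
    define e' where "e' = min (s / 2) (\<eta> / (2 * ME))"
    have e': "e' > 0" "e' \<le> s / 2" "e' \<le> \<eta> / (2 * ME)" using s(1) \<eta>(1) ME(1) by (auto simp: e'_def)
    have "\<exists>d1>0. \<forall>B. B \<in> jordan_class \<longrightarrow> norm (B - A) < d1 \<longrightarrow>
        (\<exists>(R::complex^'n^'n) (R'::complex^'n^'n) mu. R ** R' = ?one \<and> B = R ** jordan mu ** R' \<and>
          (\<forall>a\<in>{1..p}. dist (mu a) (lam a) < e'))"
      unfolding A_def by (rule nearby_same_type[OF PP' lam e'(1)]) blast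
    then obtain d1 where d1: "d1 > 0" "\<And>B. B \<in> jordan_class \<Longrightarrow> norm (B - A) < d1 \<Longrightarrow>
        \<exists>(R::complex^'n^'n) (R'::complex^'n^'n) mu. R ** R' = ?one \<and> B = R ** jordan mu ** R' \<and>
          (\<forall>a\<in>{1..p}. dist (mu a) (lam a) < e')"
      by blast
    show ?thesis
    proof (intro exI[of _ "min d1 \<eta>"] conjI ballI impI)
      show "min d1 \<eta> > 0" using d1(1) \<eta>(1) by simp
      fix B assume B: "B \<in> jordan_class" "norm (B - A) < min d1 \<eta>"
      then obtain R R' :: "complex^'n^'n" and mu where R: "R ** R' = ?one" "B = R ** jordan mu ** R'"
        and mu: "\<And>a. a \<in> {1..p} \<Longrightarrow> dist (mu a) (lam a) < e'"
        using d1(2)[of B] by auto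
      have R2: "R' ** R = ?one" using R(1) by (simp add: matrix_left_right_inverse)
      have inj: "inj_on mu {1..p}" by (rule inj_close, rule less_le_trans[OF mu e'(2)])
      define F where "F = (\<Sum>b = 1..p. cscale (mu b - lam b) (E b))"
      define B' where "B' = P ** jordan mu ** P'"
      have B': "B' = A + F"
        unfolding B'_def F_def A_add_combination by simp
      have normF: "norm F \<le> \<eta> / 2"
      proof -
        have "norm F \<le> ME * e'"
          unfolding F_def
        proof (rule ME(2))
          show "norm (mu a - lam a) \<le> e'" if "a \<in> {1..p}" for a
            using mu[OF that] by (simp add: dist_norm)
        qed (use e'(1) in simp)
        also have "\<dots> \<le> ME * (\<eta> / (2 * ME))" using e'(3) ME(1) by (intro mult_left_mono) auto
        also have "\<dots> = \<eta> / 2" using ME(1) by simp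
        finally show ?thesis .
      qed
      have "dim (intertwiners A A) = dim (intertwiners (jordan mu) (jordan mu))"
        using dim_intertwiners_A dim_intertwiners_self[OF inj] by simp
      also have "\<dots> = dim (intertwiners B B')"
        unfolding R(2) B'_def by (rule dim_intertwiners_similar[OF R(1) R2 PP' P'P, symmetric])
      finally have "dim (intertwiners A A) \<le> dim (intertwiners B B')" by simp
      moreover have "norm (B - A) < d0" "norm (B' - A) < d0"
        using B(2) \<eta>(1,4) normF by (auto simp: B')
      ultimately obtain Y where Y: "Y \<in> h ` range comm" "?one + Y \<in> intertwiners B B'"
          "norm Y \<le> K * norm (B - B')"
        using near by blast
      have "norm (B - B') \<le> norm (B - A) + norm F"
        using norm_triangle_ineq4[of "B - A" F] by (simp add: B' algebra_simps)
      also have "\<dots> < 2 * \<eta>" using B(2) normF \<eta>(1) by simp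
      finally have "K * norm (B - B') < K * (2 * \<eta>)" using K by simp
      then have normY: "norm Y < K * (2 * \<eta>)" using Y(3) by simp
      also have "\<dots> \<le> K * (2 * (r0 / (2 * K)))" using \<eta>(2) K by (intro mult_left_mono) auto
      also have "\<dots> = r0" using K by simp
      finally have det: "Determinants.det (?one + Y) \<noteq> 0" by (rule r0(2))
      define W where "W = comm Y + F"
      have "norm (comm Y) \<le> norm Y * MC" by (rule MC)
      also have "\<dots> < K * (2 * \<eta>) * MC" using normY MC(1) by simp
      also have "\<dots> \<le> K * (2 * (e / (4 * (K * MC)))) * MC"
        using \<eta>(3) K MC(1) by (intro mult_left_mono mult_right_mono) auto
      also have "\<dots> = e / 2" using K MC(1) by simp
      finally have "norm W < e"
        using norm_triangle_ineq[of "comm Y" F] normF \<eta>(1,5) by (simp add: W_def)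
      have TF: "T F = F" unfolding F_def by (rule T_combination)
      have TW: "T W = F"
        using clinear_T T_commutator[of Y] TF by (simp add: W_def clinear_iff)
      have Wd: "W - T W = comm Y" unfolding TW by (simp add: W_def)
      obtain y where y: "Y = h (comm y)" using Y(1) by auto
      have XW: "X W = Y" unfolding X_def Wd hh by (simp add: y hh)
      have ZW: "Z W = 0" unfolding Z_def Wd hh by simp
      have "B ** (?one + Y) = (?one + Y) ** B'" using Y(2) by (simp add: intertwiners_def)
      then have "B ** ((?one + Y) ** matrix_inv (?one + Y)) = (?one + Y) ** B' ** matrix_inv (?one + Y)"
        by (simp add: matrix_mul_assoc)
      then have "B = (?one + Y) ** B' ** matrix_inv (?one + Y)" by (simp add: matrix_inv_mult[OF det])
      then have "conjugation_chart X T Z A W = B"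
        unfolding conjugation_chart_def XW ZW TW B'[symmetric] by simp
      then show "\<exists>W. norm W < e \<and> Z W = 0 \<and> conjugation_chart X T Z A W = B"
        using \<open>norm W < e\<close> ZW by blast
    qed
  qed
  have ker: "{W. comm W = 0} = intertwiners A A"
    by (simp add: intertwiners_eq_kernel)
  have nn: "DIM(complex^'n^'n) = 2 * (CARD('n) * CARD('n))" by simp
  have rank: "2 * (\<Sum>a = 1..p. overlap a a) + dim (range comm) = 2 * (CARD('n) * CARD('n))"
    using dim_kernel_plus_range[where L = comm and g = h, OF clinear_imp_linear[OF comm] clinear_imp_linear[OF h] hh]
    unfolding ker dim_intertwiners_A nn .
  have "{W. Z W = 0} = {x + y |x y. x \<in> range comm \<and> y \<in> range T}"
  proof
    show "{W. Z W = 0} \<subseteq> {x + y |x y. x \<in> range comm \<and> y \<in> range T}"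
    proof
      fix W assume "W \<in> {W. Z W = 0}"
      then have "W = comm (h (W - T W)) + T W" by (simp add: Z_def algebra_simps)
      then show "W \<in> {x + y |x y. x \<in> range comm \<and> y \<in> range T}" by blast
    qed
    show "{x + y |x y. x \<in> range comm \<and> y \<in> range T} \<subseteq> {W. Z W = 0}"
    proof clarify
      fix x y
      have "T (comm x + T y) = T y" using clinear_T T_commutator[of x] by (simp add: clinear_iff T_idem)
      then have "comm x + T y - T (comm x + T y) = comm x" by simp
      then show "Z (comm x + T y) = 0" unfolding Z_def by (simp only: hh) simp
    qed
  qed
  moreover have "dim {x + y |x y. x \<in> range comm \<and> y \<in> range T} = dim (range comm) + dim (range T)"
  proof -
    have sub: "subspace (range comm)" "subspace (range T)"
      using clinear_imp_linear[OF comm] clinear_imp_linear[OF clinear_T]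
      by (auto intro: linear_subspace_image)
    have "z = 0" if "z \<in> range comm \<inter> range T" for z
    proof -
      obtain x y where "z = comm x" "z = T y" using \<open>z \<in> range comm \<inter> range T\<close> by blast
      then show ?thesis using T_idem[of y] T_commutator[of x] by simp
    qed
    then have "range comm \<inter> range T \<subseteq> {0}" by blast
    then have "dim (range comm \<inter> range T) = 0" by (simp only: dim_eq_0)
    then show ?thesis using dim_sums_Int[OF sub] by linarith
  qed
  ultimately have "dim {W. Z W = 0} = dim (range comm) + 2 * p" by (simp only: dim_range_T)
  also have "\<dots> = 2 * (CARD('n) * CARD('n) - (\<Sum>a = 1..p. overlap a a) + p)"
  proof -
    \<comment> \<open>The premise implies \<open>u \<le> c\<close>, so the subtraction is
      exact.\<close>
    have "2 * u + v = 2 * c \<Longrightarrow> v + 2 * p = 2 * (c - u + p)" for u v c :: nat by arith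
    from this[OF rank] show ?thesis .
  qed
  finally have d: "dim {W. Z W = 0} = 2 * (CARD('n) * CARD('n) - (\<Sum>a = 1..p. overlap a a) + p)" .
  show ?thesis
  proof (rule submanifold_chart_if_parametrized[where X = X and T = T and Z = Z and A = A])
    show "clinear X" "clinear T" "clinear Z" by (fact clinX clinear_T clinZ)+
    show "X W ** A - A ** X W + T W + Z W = W" for W by (rule sum)
    show "r > 0" by (rule r)
    show "conjugation_chart X T Z A W \<in> jordan_class" if "norm W < r" "Z W = 0" for W
      using that by (rule into)
    show "\<exists>d>0. \<forall>B\<in>jordan_class. norm (B - A) < d \<longrightarrow>
      (\<exists>W. norm W < e \<and> Z W = 0 \<and> conjugation_chart X T Z A W = B)" if "e > 0" for e
      using that by (rule onto)
  qed (rule d)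
qed

end

section \<open>Jordan normal forms of type-indexed matrices\<close>

lemma bij_nth_if_mset_eq:
  assumes "finite I" "mset xs = image_mset f (mset_set I)"
  obtains b where "bij_betw b {..<length xs} I" "\<And>i. i < length xs \<Longrightarrow> xs ! i = f (b i)"
proof -
  obtain ys where ys: "set ys = I" "distinct ys" using finite_distinct_list[OF assms(1)] by blast
  then have "mset xs = mset (map f ys)" using assms(2) by (simp add: mset_set_set[symmetric])
  then obtain q where q: "q permutes {..<length (map f ys)}" "permute_list q (map f ys) = xs"
    by (rule mset_eq_permutation)
  have len: "length xs = length ys" using q(2) by (metis length_permute_list length_map)
  show thesis
  proof (rule that[of "\<lambda>i. ys ! q i"])
    have "bij_betw q {..<length xs} {..<length ys}" using permutes_imp_bij[OF q(1)] len by simp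
    moreover have "bij_betw ((!) ys) {..<length ys} I" using ys by (intro bij_betw_nth) auto
    ultimately show "bij_betw (\<lambda>i. ys ! q i) {..<length xs} I"
      using bij_betw_trans[of q _ _ "(!) ys"] by (simp add: o_def)
    fix i assume i: "i < length xs"
    then have "q i < length ys" using permutes_in_image[OF q(1), of i] len by simp
    have "xs ! i = permute_list q (map f ys) ! i" by (simp only: q(2))
    also have "\<dots> = map f ys ! q i" by (rule permute_list_nth[OF q(1)]) (use i len in simp)
    also have "\<dots> = f (ys ! q i)" using \<open>q i < length ys\<close> by simp
    finally show "xs ! i = f (ys ! q i)" .
  qed
qed

text \<open>Number of the block and offset inside it, for a row of \<open>jordan_matrix\<close>.
  Past the last block the value is \<open>length bs\<close> together with the excess, so the
  function is injective on all natural numbers.\<close>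

fun block_position :: "(nat \<times> 'a) list \<Rightarrow> nat \<Rightarrow> nat \<times> nat" where
  "block_position [] i = (0, i)"
| "block_position ((m, z) # bs) i =
    (if i < m then (0, i) else map_prod Suc id (block_position bs (i - m)))"

lemma inj_block_position: "inj (block_position bs)"
proof (rule injI)
  show "block_position bs i = block_position bs j \<Longrightarrow> i = j" for i j
  proof (induction bs i arbitrary: j rule: block_position.induct)
    case (2 m z bs i)
    show ?case
    proof (cases "i < m \<or> j < m")
      case True
      then show ?thesis using "2.prems" by (auto simp: map_prod_def case_prod_unfold split: if_splits)
    next
      case False
      then have "block_position bs (i - m) = block_position bs (j - m)"
        using "2.prems" by (simp add: map_prod_def case_prod_unfold prod_eq_iff)
      then have "i - m = j - m" using "2.IH" False by blast
      then show ?thesis using False by linarith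
    qed
  qed simp
qed

lemma block_position_in:
  "i < sum_list (map fst bs) \<Longrightarrow>
    fst (block_position bs i) < length bs \<and> snd (block_position bs i) < fst (bs ! fst (block_position bs i))"
proof (induction bs i rule: block_position.induct)
  case (2 m z bs i)
  then show ?case by (cases "i < m") auto
qed simp

lemma bij_block_position:
  "bij_betw (block_position bs) {..<sum_list (map fst bs)} (SIGMA b:{..<length bs}. {..<fst (bs ! b)})"
proof -
  let ?S = "SIGMA b:{..<length bs}. {..<fst (bs ! b)}"
  have inj: "inj_on (block_position bs) {..<sum_list (map fst bs)}"
    using inj_block_position by (rule inj_on_subset) simp
  have sub: "block_position bs ` {..<sum_list (map fst bs)} \<subseteq> ?S"
  proof (rule image_subsetI)
    fix i assume "i \<in> {..<sum_list (map fst bs)}"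
    then show "block_position bs i \<in> ?S"
      using block_position_in[of i bs] by (cases "block_position bs i") simp
  qed
  have "card ?S = sum_list (map fst bs)"
    by (simp add: card_SigmaI sum_list_sum_nth atLeast0LessThan)
  then have "block_position bs ` {..<sum_list (map fst bs)} = ?S"
    by (intro card_subset_eq[OF _ sub]) (simp_all add: card_image[OF inj])
  then show ?thesis using inj by (simp add: bij_betw_def)
qed

text \<open>The recursive block matrix in the shape of \<open>jordan_entry\<close>, with block
  numbers in place of the pairs of eigenvalue label and block label.\<close>

lemma jordan_matrix_nth:
  assumes "i < sum_list (map fst bs)" "j < sum_list (map fst bs)"
    "block_position bs i = (b, l)" "block_position bs j = (b', l')"
  shows "jordan_matrix bs $$ (i, j) =
    (if b = b' then if l = l' then snd (bs ! b) else if l' = Suc l then 1 else 0 else 0)"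
  using assms
proof (induction bs i arbitrary: j b b' rule: block_position.induct)
  case (2 m z bs i)
  let ?s = "sum_list (map fst bs)"
  have ij: "i < m + ?s" "j < m + ?s" using "2.prems"(1,2) by simp_all
  have entry: "jordan_matrix ((m, z) # bs) $$ (i, j) =
      (if i < m then if j < m then jordan_block m z $$ (i, j) else 0
       else if j < m then 0 else jordan_matrix bs $$ (i - m, j - m))"
    using ij by (simp add: jordan_matrix_Cons)
  show ?case
  proof (cases "i < m \<or> j < m")
    case True
    then have "b = 0 \<and> l = i \<or> b' = 0 \<and> l' = j" "i < m \<longleftrightarrow> b = 0" "j < m \<longleftrightarrow> b' = 0"
      "i < m \<Longrightarrow> l = i" "j < m \<Longrightarrow> l' = j"
      using "2.prems"(3,4) by (auto simp: map_prod_def case_prod_unfold split: if_splits)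
    then show ?thesis using True unfolding entry by auto
  next
    case False
    obtain c l1 where c: "block_position bs (i - m) = (c, l1)" by (cases "block_position bs (i - m)")
    obtain c' l2 where c': "block_position bs (j - m) = (c', l2)" by (cases "block_position bs (j - m)")
    have eqs: "b = Suc c" "l1 = l" "b' = Suc c'" "l2 = l'"
      using "2.prems"(3,4) False c c' by auto
    have "jordan_matrix bs $$ (i - m, j - m) =
        (if c = c' then if l = l' then snd (bs ! c) else if l' = Suc l then 1 else 0 else 0)"
    proof (rule "2.IH")
      show "i - m < ?s" "j - m < ?s" using ij False by linarith+
    qed (use False c c' eqs in simp_all)
    then show ?thesis using False unfolding entry by (simp add: eqs)
  qed
qed simp

subsection \<open>Transfer of matrices\<close>

definition num :: "'n::finite \<Rightarrow> nat" where
  "num = inv_into {..<CARD('n)} (from_nat_into UNIV)"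

definition of_mat :: "'a mat \<Rightarrow> 'a^'n::finite^'n" where
  "of_mat M = (\<chi> x y. M $$ (num x, num y))"

lemma bij_from_nat_into: "bij_betw (from_nat_into (UNIV :: 'n::finite set)) {..<CARD('n)} UNIV"
  by (rule bij_betw_from_nat_into_finite) simp

lemma bij_num: "bij_betw (num :: 'n::finite \<Rightarrow> nat) UNIV {..<CARD('n)}"
  unfolding num_def by (rule bij_betw_inv_into[OF bij_from_nat_into])

lemma num_less: "num (x :: 'n::finite) < CARD('n)"
  using bij_num bij_betwE by blast

lemma from_nat_into_num [simp]: "from_nat_into UNIV (num (x :: 'n::finite)) = x"
  unfolding num_def by (rule bij_betw_inv_into_right[OF bij_from_nat_into]) simp

lemma num_from_nat_into [simp]: "i < CARD('n) \<Longrightarrow> num (from_nat_into UNIV i :: 'n::finite) = i"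
  unfolding num_def by (rule bij_betw_inv_into_left[OF bij_from_nat_into]) simp

lemma to_mat_carrier [simp]: "to_mat (A :: 'a^'n::finite^'n) \<in> carrier_mat CARD('n) CARD('n)"
  by (simp add: to_mat_def)

lemma of_mat_to_mat [simp]: "of_mat (to_mat A) = A"
  by (simp add: of_mat_def to_mat_def num_less Finite_Cartesian_Product.vec_eq_iff)

lemma to_mat_of_mat: "M \<in> carrier_mat CARD('n) CARD('n) \<Longrightarrow> to_mat (of_mat M :: 'a^'n::finite^'n) = M"
  by (intro eq_matI) (auto simp: of_mat_def to_mat_def)

lemma to_mat_one: "to_mat (Finite_Cartesian_Product.mat 1 :: 'a::semiring_1^'n::finite^'n) = 1\<^sub>m CARD('n)"
proof (rule eq_matI)
  fix i j assume ij: "i < dim_row (1\<^sub>m CARD('n) :: 'a mat)" "j < dim_col (1\<^sub>m CARD('n) :: 'a mat)"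
  then have "(from_nat_into UNIV i :: 'n) = from_nat_into UNIV j \<longleftrightarrow> i = j"
    using num_from_nat_into[where 'n = 'n] by (metis index_one_mat(2,3))
  then show "to_mat (Finite_Cartesian_Product.mat 1 :: 'a^'n^'n) $$ (i, j) = 1\<^sub>m CARD('n) $$ (i, j)"
    using ij by (simp add: to_mat_def Finite_Cartesian_Product.mat_def)
qed (simp_all add: to_mat_def)

lemma to_mat_mult: "to_mat (A ** B) = to_mat A * to_mat (B :: 'a::semiring_1^'n::finite^'n)"
proof (rule eq_matI)
  fix i j assume "i < dim_row (to_mat A * to_mat B)" "j < dim_col (to_mat A * to_mat B)"
  then have ij: "i < CARD('n)" "j < CARD('n)" by (simp_all add: to_mat_def)
  have "(to_mat A * to_mat B) $$ (i, j) = (\<Sum>l\<in>{..<CARD('n)}.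
      A $ from_nat_into UNIV i $ from_nat_into UNIV l * B $ from_nat_into UNIV l $ from_nat_into UNIV j)"
    using ij by (simp add: to_mat_def scalar_prod_def atLeast0LessThan)
  also have "\<dots> = (\<Sum>z\<in>UNIV. A $ from_nat_into UNIV i $ z * B $ z $ from_nat_into UNIV j)"
    by (rule sum.reindex_bij_betw[OF bij_from_nat_into])
  finally show "to_mat (A ** B) $$ (i, j) = (to_mat A * to_mat B) $$ (i, j)"
    using ij by (simp add: to_mat_def matrix_matrix_mult_def)
qed (simp_all add: to_mat_def)

lemma similar_mat_to_mat_iff:
  fixes A B :: "complex^'n::finite^'n"
  shows "similar_mat (to_mat A) (to_mat B) \<longleftrightarrow>
    (\<exists>P P'. P ** P' = Finite_Cartesian_Product.mat 1 \<and> A = P ** B ** P')"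
proof
  assume "similar_mat (to_mat A) (to_mat B)"
  then obtain P Q where w: "similar_mat_wit (to_mat A) (to_mat B) P Q" by (auto simp: similar_mat_def)
  note w = similar_mat_witD2[OF to_mat_carrier w]
  have PQ: "to_mat (of_mat P :: complex^'n^'n) = P" "to_mat (of_mat Q :: complex^'n^'n) = Q"
    using w by (auto intro: to_mat_of_mat)
  have "to_mat ((of_mat P :: complex^'n^'n) ** (of_mat Q :: complex^'n^'n)) = to_mat (Finite_Cartesian_Product.mat 1 :: complex^'n^'n)"
    using w(1) by (simp add: to_mat_mult PQ to_mat_one)
  moreover have "to_mat A = to_mat ((of_mat P :: complex^'n^'n) ** B ** (of_mat Q :: complex^'n^'n))"
    using w(3) by (simp add: to_mat_mult PQ)
  ultimately show "\<exists>P P'. P ** P' = Finite_Cartesian_Product.mat 1 \<and> A = P ** B ** P'"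
    by (metis of_mat_to_mat)
next
  assume "\<exists>P P'. P ** P' = Finite_Cartesian_Product.mat 1 \<and> A = P ** B ** P'"
  then obtain P P' :: "complex^'n^'n" where P: "P ** P' = Finite_Cartesian_Product.mat 1" "A = P ** B ** P'"
    by blast
  then have "P' ** P = Finite_Cartesian_Product.mat 1" by (simp add: matrix_left_right_inverse)
  then have "to_mat P' * to_mat P = 1\<^sub>m CARD('n)" "to_mat P * to_mat P' = 1\<^sub>m CARD('n)"
    using P(1) by (simp_all flip: to_mat_mult to_mat_one)
  then show "similar_mat (to_mat A) (to_mat B)"
  proof (intro similar_matI[of _ _ "to_mat P" "to_mat P'" "CARD('n)"])
    show "to_mat A = to_mat P * to_mat B * to_mat P'" by (simp add: P(2) to_mat_mult)
  qed simp_all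
qed

text \<open>Hence a multiset of pairs is determined by the orders listed separately for each
  eigenvalue.\<close>

lemma count_filter_snd:
  "count (image_mset fst (filter_mset (\<lambda>b. snd b = z) M)) s = count M (s, z)"
  by (induction M) auto

section \<open>Identification of the Jordan class with \<open>jordan_type_set\<close>\<close>

context jordan_shape
begin

definition blocks :: "(nat \<Rightarrow> complex) \<Rightarrow> (nat \<times> complex) multiset" where
  "blocks lam = image_mset (\<lambda>(a, j). (k a j, lam a)) (mset_set (SIGMA a:{1..p}. {1..N a}))"

text \<open>The list form and the labelled form differ by a permutation of positions: a row number
  is turned into block number and offset, the bijection \<open>b\<close> replaces the block number
  by a pair \<open>(a, j)\<close>, and \<open>index\<close> names the position with the resulting
  label.\<close>

lemma similar_jordan_matrix_iff:
  fixes A :: "complex^'n^'n"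
  assumes bs: "mset bs = blocks lam"
  shows "similar_mat (to_mat A) (jordan_matrix bs) \<longleftrightarrow>
    (\<exists>P P'. P ** P' = Finite_Cartesian_Product.mat 1 \<and> A = P ** jordan lam ** P')"
proof -
  have "finite (SIGMA a:{1..p}. {1..N a})" by simp
  from bij_nth_if_mset_eq[OF this bs[unfolded blocks_def]] obtain b
    where b: "bij_betw b {..<length bs} (SIGMA a:{1..p}. {1..N a})"
      and nth: "\<And>i. i < length bs \<Longrightarrow> bs ! i = (case b i of (a, j) \<Rightarrow> (k a j, lam a))" by blast
  define lab where "lab = (\<lambda>(i, l). (fst (b i), snd (b i), l::nat))"
  have b_in: "fst (b i) \<in> {1..p} \<and> snd (b i) \<in> {1..N (fst (b i))}" if "i < length bs" for i
    using bij_betwE[OF b] that by (force simp: mem_Sigma_iff)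
  have nth': "bs ! i = (k (fst (b i)) (snd (b i)), lam (fst (b i)))" if "i < length bs" for i
    using nth[OF that] by (simp add: case_prod_unfold)
  let ?D = "SIGMA i:{..<length bs}. {..<fst (bs ! i)}"
  have lab: "bij_betw lab ?D labels"
  proof (rule bij_betw_imageI)
    show "inj_on lab ?D"
    proof (rule inj_onI)
      fix x y assume xy: "x \<in> ?D" "y \<in> ?D" "lab x = lab y"
      then have "b (fst x) = b (fst y)" "snd x = snd y"
        by (auto simp: lab_def case_prod_unfold prod_eq_iff)
      moreover have "fst x < length bs" "fst y < length bs" using xy by auto
      ultimately show "x = y" using b by (auto simp: bij_betw_def inj_on_def prod_eq_iff)
    qed
    show "lab ` ?D = labels"
    proof
      show "lab ` ?D \<subseteq> labels"
        using b_in nth' by (auto simp: lab_def)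
      show "labels \<subseteq> lab ` ?D"
      proof
        fix t assume t: "t \<in> labels"
        obtain a j l where ajl: "t = (a, j, l)" by (metis prod_cases3)
        have "(a, j) \<in> (SIGMA a:{1..p}. {1..N a})" using t ajl by auto
        then have "(a, j) \<in> b ` {..<length bs}" by (simp only: bij_betw_imp_surj_on[OF b])
        then obtain i where i: "i < length bs" "b i = (a, j)" by auto
        then have "(i, l) \<in> ?D" using nth' t ajl by auto
        moreover have "lab (i, l) = t" by (simp add: lab_def i ajl)
        ultimately show "t \<in> lab ` ?D" by blast
      qed
    qed
  qed
  define \<tau> where "\<tau> i = index (lab (block_position bs i))" for i
  have index: "bij_betw index labels UNIV"
    unfolding index_def using bij_betw_inv_into[OF label] by (simp add: labels_def)
  have \<tau>: "bij_betw \<tau> {..<sum_list (map fst bs)} UNIV"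
    using bij_betw_trans[OF bij_betw_trans[OF bij_block_position lab] index] by (simp add: \<tau>_def[abs_def] o_def)
  then have n: "sum_list (map fst bs) = CARD('n)"
    using bij_betw_same_card by fastforce
  have entry: "jordan_matrix bs $$ (i, j) = jordan lam $ \<tau> i $ \<tau> j" if "i < CARD('n)" "j < CARD('n)" for i j
  proof -
    obtain c l where c: "block_position bs i = (c, l)" by (cases "block_position bs i")
    obtain c' l' where c': "block_position bs j = (c', l')" by (cases "block_position bs j")
    have cl: "c < length bs" "c' < length bs"
      using block_position_in[of i bs] block_position_in[of j bs] that n c c' by auto
    have "lab (c, l) \<in> labels" "lab (c', l') \<in> labels"
      using bij_betwE[OF lab] bij_betwE[OF bij_block_position[of bs]] that n c c' by (metis lessThan_iff)+
    then have lt: "label (\<tau> i) = lab (c, l)" "label (\<tau> j) = lab (c', l')"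
      unfolding \<tau>_def c c' by (simp_all only: label_index)
    have "fst (b c) = fst (b c') \<and> snd (b c) = snd (b c') \<longleftrightarrow> c = c'"
      using b cl by (auto simp: bij_betw_def inj_on_def prod_eq_iff)
    then show ?thesis
      using jordan_matrix_nth[of i bs j, OF _ _ c c'] that n cl nth'
      by (auto simp: jordan_def lt lab_def)
  qed
  have "jordan_matrix bs \<in> carrier_mat CARD('n) CARD('n)"
    by (rule carrier_matI) (simp_all only: jordan_matrix_dim n)
  then have J: "to_mat (of_mat (jordan_matrix bs) :: complex^'n^'n) = jordan_matrix bs"
    by (rule to_mat_of_mat)
  have "bij (\<tau> \<circ> (num :: 'n \<Rightarrow> nat))"
    by (rule bij_betw_trans[OF bij_num \<tau>[unfolded n]])
  moreover have "(of_mat (jordan_matrix bs) :: complex^'n^'n) $ x $ y = jordan lam $ (\<tau> \<circ> num) x $ (\<tau> \<circ> num) y" for x y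
    by (simp add: of_mat_def entry num_less)
  ultimately obtain P P' :: "complex^'n^'n" where P: "P ** P' = Finite_Cartesian_Product.mat 1" "P' ** P = Finite_Cartesian_Product.mat 1"
    "of_mat (jordan_matrix bs) = P ** jordan lam ** P'"
    by (rule permuted_matrix_similar)
  have "similar_mat (to_mat (of_mat (jordan_matrix bs) :: complex^'n^'n)) (to_mat (jordan lam))"
    unfolding similar_mat_to_mat_iff using P by blast
  then have sim: "similar_mat (jordan_matrix bs) (to_mat (jordan lam))" by (simp only: J)
  have "similar_mat (to_mat A) (jordan_matrix bs) \<longleftrightarrow> similar_mat (to_mat A) (to_mat (jordan lam))"
    using similar_mat_trans[OF _ sim] similar_mat_trans[OF _ similar_mat_sym[OF sim]] by blast
  then show ?thesis by (simp only: similar_mat_to_mat_iff)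
qed

lemma filter_blocks:
  assumes "inj_on lam {1..p}" "a \<in> {1..p}"
  shows "image_mset fst (filter_mset (\<lambda>b. snd b = lam a) (blocks lam)) = image_mset (k a) (mset_set {1..N a})"
proof -
  have "{x \<in> SIGMA a:{1..p}. {1..N a}. lam (fst x) = lam a} = Pair a ` {1..N a}"
  proof (intro Set.set_eqI iffI)
    fix x assume "x \<in> {x \<in> SIGMA a:{1..p}. {1..N a}. lam (fst x) = lam a}"
    then obtain b j where x: "x = (b, j)" "b \<in> {1..p}" "j \<in> {1..N b}" "lam b = lam a" by fastforce
    then have "b = a" using inj_onD[OF assms(1)] assms(2) by blast
    then show "x \<in> Pair a ` {1..N a}" using x by blast
  next
    fix x assume "x \<in> Pair a ` {1..N a}"
    then show "x \<in> {x \<in> SIGMA a:{1..p}. {1..N a}. lam (fst x) = lam a}" using assms(2) by fastforce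
  qed
  then have "filter_mset (\<lambda>b. snd b = lam a) (blocks lam) =
      image_mset (\<lambda>(a, j). (k a j, lam a)) (mset_set (Pair a ` {1..N a}))"
    by (simp add: blocks_def filter_mset_image_mset filter_mset_mset_set case_prod_unfold)
  also have "mset_set (Pair a ` {1..N a}) = image_mset (Pair a) (mset_set {1..N a})"
    by (simp add: image_mset_mset_set inj_on_def)
  finally show ?thesis by (simp add: image_mset.compositionality o_def)
qed

lemma snd_blocks: "x \<in># blocks lam \<Longrightarrow> snd x \<in> lam ` {1..p}"
  by (auto simp: blocks_def)

lemma fst_blocks: "x \<in># blocks lam \<Longrightarrow> fst x > 0"
  using k_pos by (force simp: blocks_def Suc_le_eq)

lemma order_char_poly_jordan_nf:
  assumes "jordan_nf B bs"
  shows "Polynomial.order z (char_poly B) = sum_mset (image_mset fst (filter_mset (\<lambda>b. snd b = z) (mset bs)))"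
  using jordan_nf_order[OF assms, of z] by (simp add: sum_mset_sum_list[symmetric])

lemma eigenvalue_iff_order:
  "eigenvalue (to_mat A) z \<longleftrightarrow> Polynomial.order z (char_poly (to_mat (A :: complex^'m::finite^'m))) \<noteq> 0"
proof -
  have "char_poly (to_mat A) \<noteq> 0"
    using degree_monic_char_poly[OF to_mat_carrier[of A]] by auto
  then show ?thesis
    by (simp add: eigenvalue_root_char_poly[OF to_mat_carrier] order_root)
qed

text \<open>The list of blocks is recovered, up to order, from the orders at each eigenvalue.
  Conversely, the multiplicity of an eigenvalue is the sum of the orders of its blocks, which is
  where \<open>k_sum\<close> enters.\<close>

lemma jordan_type_set_eq:
  assumes k_sum: "\<And>a. a \<in> {1..p} \<Longrightarrow> (\<Sum>j = 1..N a. k a j) = ns a"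
    and ns_pos: "\<And>a. a \<in> {1..p} \<Longrightarrow> ns a \<ge> 1"
  shows "jordan_type_set p ns N k = jordan_class"
proof
  show "jordan_type_set p ns N k \<subseteq> jordan_class"
  proof
    fix A :: "complex^'n^'n" assume "A \<in> jordan_type_set p ns N k"
    then obtain lam bs where lam: "inj_on lam {1..p}" and ev: "{z. eigenvalue (to_mat A) z} = lam ` {1..p}"
      and nf: "jordan_nf (to_mat A) bs"
      and fil: "\<And>a. a \<in> {1..p} \<Longrightarrow> image_mset fst (filter_mset (\<lambda>b. snd b = lam a) (mset bs)) = image_mset (k a) (mset_set {1..N a})"
      unfolding jordan_type_set_def by blast
    have "mset bs = blocks lam"
    proof (rule multiset_eqI)
      fix x :: "nat \<times> complex"
      obtain s z where x: "x = (s, z)" by (cases x)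
      show "count (mset bs) x = count (blocks lam) x"
      proof (cases "z \<in> lam ` {1..p}")
        case True
        then obtain a where a: "a \<in> {1..p}" "z = lam a" by blast
        have "image_mset fst (filter_mset (\<lambda>b. snd b = z) (mset bs)) = image_mset fst (filter_mset (\<lambda>b. snd b = z) (blocks lam))"
          unfolding a(2) fil[OF a(1)] filter_blocks[OF lam a(1)] ..
        then show ?thesis unfolding x by (metis count_filter_snd)
      next
        case False
        \<comment> \<open>The filters only control the blocks at the values \<open>lam a\<close>. A
          block at any other value has positive order and would make that value an additional
          eigenvalue.\<close>
        have "x \<notin># mset bs"
        proof
          assume "x \<in># mset bs"
          then have xin: "(s, z) \<in> set bs" by (simp add: x)
          then have "s \<noteq> 0" using nf by (force simp: jordan_nf_def)
          moreover have "s \<in># image_mset fst (filter_mset (\<lambda>b. snd b = z) (mset bs))"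
            using xin by force
          ultimately have "Polynomial.order z (char_poly (to_mat A)) \<noteq> 0"
            unfolding order_char_poly_jordan_nf[OF nf] by (auto simp: sum_mset_0_iff)
          then show False using False ev by (auto simp: eigenvalue_iff_order)
        qed
        moreover have "x \<notin># blocks lam" using snd_blocks[of x lam] False x by auto
        ultimately show ?thesis by (simp only: not_in_iff)
      qed
    qed
    from similar_jordan_matrix_iff[OF this, of A] show "A \<in> jordan_class"
      using nf lam unfolding jordan_class_def jordan_nf_def by blast
  qed
  show "jordan_class \<subseteq> jordan_type_set p ns N k"
  proof
    fix A assume "A \<in> jordan_class"
    then obtain P P' lam where A: "P ** P' = Finite_Cartesian_Product.mat 1" "A = P ** jordan lam ** P'"
      and lam: "inj_on lam {1..p}"
      unfolding jordan_class_def by blast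
    obtain bs where bs: "mset bs = blocks lam" using ex_mset by blast
    have "similar_mat (to_mat A) (jordan_matrix bs)"
      unfolding similar_jordan_matrix_iff[OF bs] using A by blast
    moreover have "0 \<notin> fst ` set bs"
      using fst_blocks[of _ lam] bs by (force simp flip: set_mset_mset)
    ultimately have nf: "jordan_nf (to_mat A) bs" by (simp add: jordan_nf_def)
    have ord: "Polynomial.order (lam a) (char_poly (to_mat A)) = ns a" if a: "a \<in> {1..p}" for a
      unfolding order_char_poly_jordan_nf[OF nf] bs filter_blocks[OF lam a] using k_sum[OF a]
      by (simp add: sum_unfold_sum_mset)
    have ord0: "Polynomial.order z (char_poly (to_mat A)) = 0" if "z \<notin> lam ` {1..p}" for z
    proof -
      have "filter_mset (\<lambda>b. snd b = z) (blocks lam) = filter_mset (\<lambda>b. False) (blocks lam)"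
        by (rule filter_mset_cong[OF refl]) (use snd_blocks[of _ lam] that in blast)
      note empty = this
      show ?thesis unfolding order_char_poly_jordan_nf[OF nf] bs empty by simp
    qed
    have "{z. eigenvalue (to_mat A) z} = lam ` {1..p}"
    proof (intro Set.set_eqI iffI)
      fix z assume "z \<in> {z. eigenvalue (to_mat A) z}"
      then show "z \<in> lam ` {1..p}" using ord0[of z] by (auto simp: eigenvalue_iff_order)
    next
      fix z assume "z \<in> lam ` {1..p}"
      then obtain a where "a \<in> {1..p}" "z = lam a" by blast
      then show "z \<in> {z. eigenvalue (to_mat A) z}"
        using ord[of a] ns_pos[of a] by (simp add: eigenvalue_iff_order)
    qed
    then show "A \<in> jordan_type_set p ns N k"
      unfolding jordan_type_set_def
      by (intro CollectI exI[of _ lam] conjI ballI lam ord exI[of _ bs] nf)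
        (simp_all only: bs filter_blocks[OF lam])
  qed
qed

lemma has_complex_dimension_jordan_class:
  "has_complex_dimension jordan_class (CARD('n) * CARD('n) - (\<Sum>a = 1..p. overlap a a) + p)"
  unfolding has_complex_dimension_def complex_submanifold_def
proof (intro conjI ballI)
  \<comment> \<open>The labels themselves, read as complex numbers, are distinct
    eigenvalues.\<close>
  have "Finite_Cartesian_Product.mat 1 ** jordan of_nat ** Finite_Cartesian_Product.mat 1 \<in> jordan_class"
    unfolding jordan_class_def
    by (intro CollectI exI[of _ "Finite_Cartesian_Product.mat 1"] exI[of _ of_nat] conjI) (simp_all add: inj_on_def)
  then show "jordan_class \<noteq> {}" by blast
next
  fix A assume "A \<in> jordan_class"
  then obtain P P' lam where A: "P ** P' = Finite_Cartesian_Product.mat 1" "A = P ** jordan lam ** P'"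
    and lam: "inj_on lam {1..p}"
    unfolding jordan_class_def by blast
  interpret jp: jordan_point p N k label P P' lam
    by unfold_locales (rule A(1), rule lam)
  show "\<exists>U V f g I. open U \<and> open V \<and> A \<in> U \<and> homeomorphism U V f g \<and>
      mat_holomorphic_on f U \<and> mat_holomorphic_on g V \<and>
      card I = CARD('n) * CARD('n) - (\<Sum>a = 1..p. overlap a a) + p \<and>
      f ` (jordan_class \<inter> U) = coord_subspace I \<inter> V"
    using jp.jordan_class_chart unfolding jp.A_def A(2)[symmetric] .
qed

text \<open>The sum is the complex dimension of a centralizer. The bound makes the subtraction of
  natural numbers in the dimension exact.\<close>

lemma sum_overlap_le: "(\<Sum>a = 1..p. overlap a a) \<le> CARD('n) * CARD('n)"
proof -
  have "2 * (\<Sum>a = 1..p. overlap a a) = dim (intertwiners (jordan of_nat) (jordan of_nat))"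
    by (rule dim_intertwiners_self[symmetric]) (simp add: inj_on_def)
  also have "\<dots> \<le> DIM(complex^'n^'n)" by (rule dim_subset_UNIV)
  finally show ?thesis by simp
qed

end

theorem theorem7:
  fixes n p Nmax :: nat
    and ns N m :: "nat \<Rightarrow> nat"
    and k :: "nat \<Rightarrow> nat \<Rightarrow> nat"
    and S :: "(complex^'n::finite^'n) set"
  assumes n: "n = CARD('n)"
    and p: "p \<ge> 1"
    and ns_pos: "\<And>a. a \<in> {1..p} \<Longrightarrow> ns a \<ge> 1"
    and ns_sum: "(\<Sum>a = 1..p. ns a) = n"
    and N_pos: "\<And>a. a \<in> {1..p} \<Longrightarrow> N a \<ge> 1"
    and k_pos: "\<And>a j. a \<in> {1..p} \<Longrightarrow> j \<in> {1..N a} \<Longrightarrow> k a j \<ge> 1"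
    and k_decr: "\<And>a i j. a \<in> {1..p} \<Longrightarrow> 1 \<le> i \<Longrightarrow> i \<le> j \<Longrightarrow> j \<le> N a \<Longrightarrow> k a j \<le> k a i"
    and k_sum: "\<And>a. a \<in> {1..p} \<Longrightarrow> (\<Sum>j = 1..N a. k a j) = ns a"
    and k_zero: "\<And>a j. a \<in> {1..p} \<Longrightarrow> j > N a \<Longrightarrow> k a j = 0"
    and Nmax: "Nmax = Max (N ` {1..p})"
    and m: "\<And>j. m j = (\<Sum>a = 1..p. k a j)"
    and S: "S = jordan_type_set p ns N k"
  shows "(\<exists>d. has_complex_dimension S d \<and>
              int d = int n ^ 2 - (\<Sum>j = 1..Nmax. (2 * int j - 1) * (\<Sum>a = 1..p. int (k a j))) + int p) \<and>
         int n ^ 2 - (\<Sum>j = 1..Nmax. (2 * int j - 1) * (\<Sum>a = 1..p. int (k a j))) + int p =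
         int n ^ 2 - (\<Sum>j = 1..Nmax. (2 * int j - 1) * int (m j)) + int p"
proof
  let ?labels = "{(a, j, l). a \<in> {1..p} \<and> j \<in> {1..N a} \<and> l < k a j}"
  have labels: "?labels = (SIGMA a:{1..p}. SIGMA j:{1..N a}. {..<k a j})" by auto
  \<comment> \<open>There are as many labels as rows, so the index type can be labelled by some
    bijection; the choice is arbitrary.\<close>
  have "card ?labels = CARD('n)"
    unfolding labels using k_sum ns_sum n by (simp add: card_SigmaI)
  moreover have "finite ?labels" unfolding labels by auto
  ultimately obtain label where label: "bij_betw label (UNIV :: 'n set) ?labels"
    using finite_same_card_bij[of "UNIV :: 'n set" ?labels] by auto
  interpret jordan_shape p N k label
    using label N_pos k_pos k_decr by unfold_locales
  let ?d = "n * n - (\<Sum>a = 1..p. overlap a a) + p"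
  have "has_complex_dimension S ?d"
    using has_complex_dimension_jordan_class jordan_type_set_eq[OF k_sum ns_pos] by (simp add: S n)
  moreover have "int ?d = int n ^ 2 - (\<Sum>j = 1..Nmax. (2 * int j - 1) * (\<Sum>a = 1..p. int (k a j))) + int p"
  proof -
    have "(\<Sum>a = 1..p. int (overlap a a)) = (\<Sum>a = 1..p. \<Sum>j = 1..Nmax. (2 * int j - 1) * int (k a j))"
    proof (rule sum.cong[OF refl])
      fix a assume a: "a \<in> {1..p}"
      have "N a \<le> Nmax" unfolding Nmax using a by (intro Max_ge) auto
      \<comment> \<open>The convention that \<open>k a j\<close> vanishes beyond \<open>N a\<close>
        lets all labels share the range up to \<open>Nmax\<close>, so that the two sums can be
        interchanged.\<close>
      then have "(\<Sum>j = 1..N a. (2 * int j - 1) * int (k a j)) = (\<Sum>j = 1..Nmax. (2 * int j - 1) * int (k a j))"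
        using k_zero[OF a] by (intro sum.mono_neutral_left) auto
      then show "int (overlap a a) = (\<Sum>j = 1..Nmax. (2 * int j - 1) * int (k a j))"
        by (simp only: overlap_self[OF a])
    qed
    also have "\<dots> = (\<Sum>j = 1..Nmax. (2 * int j - 1) * (\<Sum>a = 1..p. int (k a j)))"
      by (subst sum.swap) (simp only: sum_distrib_left)
    finally show ?thesis
      using sum_overlap_le by (simp add: n of_nat_diff power2_eq_square)
  qed
  ultimately show "\<exists>d. has_complex_dimension S d \<and>
      int d = int n ^ 2 - (\<Sum>j = 1..Nmax. (2 * int j - 1) * (\<Sum>a = 1..p. int (k a j))) + int p"
    by blast
  show "int n ^ 2 - (\<Sum>j = 1..Nmax. (2 * int j - 1) * (\<Sum>a = 1..p. int (k a j))) + int p =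
      int n ^ 2 - (\<Sum>j = 1..Nmax. (2 * int j - 1) * int (m j)) + int p"
    by (simp add: m)
qed

end
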